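(* Let $G$ be a finite simple graph such that $e(H)\leq \frac{7}{2}v(H)$ for every subgraph $H$ of $G$ and $e(H)\leq \frac{9}{4}v(H)$ for every bipartite subgraph $H$ of $G$. If $\Delta(G)\geq 10$, then $G$ has an equitable $r$-coloring for every integer $r\geq \Delta(G)$.
   Context: $e(H)$ and $v(H)$ denote the numbers of edges and vertices of $H$, and $\Delta(G)$ is the maximum degree of $G$. An equitable $r$-coloring of a graph $G$ is a partition of $V(G)$ into $r$ independent sets $V_1,\ldots,V_r$ (some possibly empty) such that $\bigl||V_i|-|V_j|\bigr|\leq 1$ for all $i,j$. *)

theory Defs
  imports Complex_Main "HOL-Library.Disjoint_Sets"
begin

text \<open>A graph is given by its vertex set \<open>V\<close> and its edge set \<open>E\<close>; an edge is an
  unordered pair, that is, a two-element set of vertices.\<close>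

definition finite_simple_graph :: "'a set \<Rightarrow> 'a set set \<Rightarrow> bool" where
  "finite_simple_graph V E \<longleftrightarrow> finite V \<and> (\<forall>e\<in>E. e \<subseteq> V \<and> card e = 2)"

definition subgraph :: "'a set \<Rightarrow> 'a set set \<Rightarrow> 'a set \<Rightarrow> 'a set set \<Rightarrow> bool" where
  "subgraph W F V E \<longleftrightarrow> W \<subseteq> V \<and> F \<subseteq> E \<and> finite_simple_graph W F"

definition bipartite :: "'a set \<Rightarrow> 'a set set \<Rightarrow> bool" where
  "bipartite V E \<longleftrightarrow>
     (\<exists>A B. A \<union> B = V \<and> A \<inter> B = {} \<and> (\<forall>e\<in>E. \<exists>a\<in>A. \<exists>b\<in>B. e = {a, b}))"

definition degree :: "'a set set \<Rightarrow> 'a \<Rightarrow> nat" where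
  "degree E v = card {e \<in> E. v \<in> e}"

text \<open>Inserting \<open>0\<close> only matters for the graph without vertices, whose maximum
  degree is thereby \<open>0\<close>.\<close>

definition max_degree :: "'a set \<Rightarrow> 'a set set \<Rightarrow> nat" where
  "max_degree V E = Max (insert 0 (degree E ` V))"

definition independent_set :: "'a set \<Rightarrow> 'a set set \<Rightarrow> 'a set \<Rightarrow> bool" where
  "independent_set V E S \<longleftrightarrow> S \<subseteq> V \<and> (\<forall>u\<in>S. \<forall>v\<in>S. {u, v} \<notin> E)"

text \<open>The classes form an indexed family, since several of them may be empty.\<close>

definition equitable_coloring :: "'a set \<Rightarrow> 'a set set \<Rightarrow> nat \<Rightarrow> (nat \<Rightarrow> 'a set) \<Rightarrow> bool" where
  "equitable_coloring V E r C \<longleftrightarrow>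
     (\<Union>i\<in>{1..r}. C i) = V \<and>
     disjoint_family_on C {1..r} \<and>
     (\<forall>i\<in>{1..r}. independent_set V E (C i)) \<and>
     (\<forall>i\<in>{1..r}. \<forall>j\<in>{1..r}. \<bar>int (card (C i)) - int (card (C j))\<bar> \<le> 1)"

end

theory Submission
  imports Defs
begin

text \<open>
  Adding a small disjoint clique makes \<open>r\<close> divide the number of vertices, say \<open>r t\<close>, and
  deleting all edges at a vertex \<open>x\<close> of small degree gives by induction a colouring of the other
  vertices in which one class has \<open>t - 1\<close> elements and all others have \<open>t\<close>. As in the proof of the
  Hajnal--Szemeredi theorem by Kierstead and Kostochka, consider the digraph on the classes with an
  arc from \<open>P\<close> to \<open>Q\<close> if some vertex of \<open>P\<close> has no neighbour in \<open>Q\<close>. If \<open>x\<close> misses a class from which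
  the small class can be reached, then shifting vertices along a path of arcs makes room for \<open>x\<close>.
  Otherwise every vertex outside the \<open>a\<close> classes that reach the small class has a neighbour in
  each of them, and the bound \<open>9/4\<close> for bipartite subgraphs leaves only \<open>a \<le> 3\<close>, or \<open>a = 7\<close> when
  the maximum degree is at most \<open>7\<close>.

  If \<open>a = 1\<close>, the small class \<open>W\<close> dominates all other vertices. Exchanging a component of the graph
  induced by \<open>W\<close> and another class, or a single pair of vertices, must not create a vertex without
  neighbours in the small class. This forces so many neighbours of \<open>W\<close> to lie in near-cliques that
  the bound \<open>7/2\<close> fails. If \<open>a \<ge> 2\<close>, there are two disjoint dominating sets of size \<open>t - 1\<close> whose roles
  can be interchanged, and almost all remaining classes are mutually reachable. Hence a vertex \<open>z\<close>
  of such a set can be exchanged for any vertex \<open>y\<close> whose only neighbour in the set is \<open>z\<close>, provided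
  \<open>z\<close> has no neighbours, or only \<open>y\<close>, in some class. Such exchanges again force near-cliques, and an
  edge count contradicts one of the two density bounds.
\<close>

text \<open>The threshold 10 comes from one cut. If \<open>a\<close> classes reach the small class,
  about \<open>a (r - a) t\<close> edges join them to the rest. For 4 <= a <= r - 4 this is at least
  \<open>4 (r - 4) t\<close>, more than the permitted \<open>9/4 r t\<close> once r >= 10. To stay
  in that range one wants a <= 6, which is why \<open>x\<close> should have degree at most 6: it has
  a neighbour in each of the \<open>a\<close> classes. The bound 7/2 makes the average degree at
  most 7, so such an \<open>x\<close> exists unless all degrees among the vertices still carrying
  edges equal 7. There the only surviving case is a = 7 and r = 10; the vertices outside the 7
  classes are then independent and can be split freely among three colours. Exact divisibility must
  survive the induction, so vertices whose edges are deleted stay behind as isolated vertices. The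
  padding clique may have at most 6 vertices, small enough for both density bounds; when more
  padding would be required, at least 8 classes are small, and a vertex of degree at most 7 misses
  one of them.\<close>

lemma rtrancl_avoid_start:
  assumes "(p, q) \<in> R\<^sup>*" "p \<noteq> q"
  shows "\<exists>s. (p, s) \<in> R \<and> s \<noteq> p \<and> (s, q) \<in> {(a, b) \<in> R. a \<noteq> p \<and> b \<noteq> p}\<^sup>*"
  using assms
proof (induction rule: rtrancl_induct)
  case base then show ?case by simp
next
  case (step y z)
  show ?case
  proof (cases "y = p")
    case True then show ?thesis using step by blast
  next
    case False
    then obtain s where "(p, s) \<in> R" "s \<noteq> p" "(s, y) \<in> {(a, b) \<in> R. a \<noteq> p \<and> b \<noteq> p}\<^sup>*"
      using step by blast
    moreover have "(y, z) \<in> {(a, b) \<in> R. a \<noteq> p \<and> b \<noteq> p}" using False step by auto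
    ultimately show ?thesis by (meson rtrancl.rtrancl_into_rtrancl)
  qed
qed

text \<open>Cut the path at its first visit to \<open>q\<close>. This is needed in
  \<open>rotate\<close>, where a vertex has left class \<open>q\<close>, so that arcs leaving
  \<open>q\<close> may have lost their witness.\<close>

lemma rtrancl_avoid_end:
  assumes "(p, q) \<in> R\<^sup>*"
  shows "(p, q) \<in> {(a, b) \<in> R. a \<noteq> q}\<^sup>*"
  using assms
proof (induction rule: converse_rtrancl_induct)
  case base then show ?case by simp
next
  case (step y z)
  show ?case
  proof (cases "y = q")
    case True then show ?thesis by simp
  next
    case False
    then have "(y, z) \<in> {(a, b) \<in> R. a \<noteq> q}" using step by auto
    then show ?thesis using step by (meson converse_rtrancl_into_rtrancl)
  qed
qed

section \<open>Colourings and recolouring along arcs\<close>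

locale fgraph =
  fixes V :: "'a set" and adj :: "'a \<Rightarrow> 'a \<Rightarrow> bool"
  assumes finV: "finite V"
    and adj_sym: "adj u v \<Longrightarrow> adj v u"
    and adj_irrefl: "\<not> adj u u"
    and adj_in: "adj u v \<Longrightarrow> v \<in> V"
begin

definition nb :: "'a set \<Rightarrow> 'a \<Rightarrow> 'a set" where
  "nb X v = {u \<in> X. adj v u}"

definition miss :: "'a \<Rightarrow> 'a set \<Rightarrow> bool" where
  "miss v X \<longleftrightarrow> nb X v = {}"

text \<open>Adjacent pairs are ordered, so \<open>ecount H H\<close> is twice the number of edges inside \<open>H\<close>.\<close>

definition ecount :: "'a set \<Rightarrow> 'a set \<Rightarrow> nat" where
  "ecount X Y = (\<Sum>v\<in>X. card (nb Y v))"

definition cls :: "'a set \<Rightarrow> ('a \<Rightarrow> nat) \<Rightarrow> nat \<Rightarrow> 'a set" where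
  "cls D c i = {v \<in> D. c v = i}"

definition proper :: "'a set \<Rightarrow> ('a \<Rightarrow> nat) \<Rightarrow> bool" where
  "proper D c \<longleftrightarrow> (\<forall>u\<in>D. \<forall>v\<in>D. adj u v \<longrightarrow> c u \<noteq> c v)"

text \<open>An arc means that some vertex of class \<open>p\<close> can be moved into class \<open>q\<close>.\<close>

definition arcs :: "'a set \<Rightarrow> ('a \<Rightarrow> nat) \<Rightarrow> nat set \<Rightarrow> (nat \<times> nat) set" where
  "arcs D c J = {(p, q). p \<in> J \<and> q \<in> J \<and> (\<exists>v\<in>cls D c p. miss v (cls D c q))}"

lemma finite_subV: "X \<subseteq> V \<Longrightarrow> finite X"
  using finV finite_subset by blast

lemma nb_subset: "nb X v \<subseteq> X"
  by (auto simp: nb_def)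

lemma nb_mono: "X \<subseteq> Y \<Longrightarrow> nb X v \<subseteq> nb Y v"
  by (auto simp: nb_def)

lemma finite_nb [simp, intro]: "finite (nb X v)"
  by (rule finite_subset[OF _ finV]) (auto simp: nb_def adj_in)

lemma nb_Un: "nb (X \<union> Y) v = nb X v \<union> nb Y v"
  by (auto simp: nb_def)

lemma card_nb_Un: "X \<inter> Y = {} \<Longrightarrow> card (nb (X \<union> Y) v) = card (nb X v) + card (nb Y v)"
  unfolding nb_Un by (rule card_Un_disjoint) (use nb_subset in auto)

lemma card_nb_UN:
  assumes "finite I" "\<And>i k. i \<in> I \<Longrightarrow> k \<in> I \<Longrightarrow> i \<noteq> k \<Longrightarrow> A i \<inter> A k = {}"
  shows "card (nb (\<Union>i\<in>I. A i) v) = (\<Sum>i\<in>I. card (nb (A i) v))"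
proof -
  have "nb (\<Union>i\<in>I. A i) v = (\<Union>i\<in>I. nb (A i) v)" by (auto simp: nb_def)
  also have "card \<dots> = (\<Sum>i\<in>I. card (nb (A i) v))"
  proof (rule card_UN_disjoint[OF assms(1)])
    show "\<forall>i\<in>I. \<forall>j\<in>I. i \<noteq> j \<longrightarrow> nb (A i) v \<inter> nb (A j) v = {}"
      using assms(2) nb_subset by blast
  qed simp
  finally show ?thesis .
qed

lemma not_missI: "\<not> miss v X \<Longrightarrow> card (nb X v) \<ge> 1"
  by (simp add: miss_def Suc_le_eq card_gt_0_iff)

lemma miss_mono: "X \<subseteq> Y \<Longrightarrow> miss v Y \<Longrightarrow> miss v X"
  by (auto simp: miss_def nb_def)

lemma miss_iff: "miss v X \<longleftrightarrow> (\<forall>u\<in>X. \<not> adj v u)"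
  by (auto simp: miss_def nb_def)

lemma ecount_sym:
  assumes "X \<subseteq> V" "Y \<subseteq> V" shows "ecount X Y = ecount Y X"
proof -
  have f: "finite X" "finite Y" using assms finite_subV by auto
  have "ecount X Y = (\<Sum>v\<in>X. \<Sum>u\<in>Y. if adj v u then 1 else 0)"
    unfolding ecount_def nb_def using f by (simp add: sum.If_cases Int_def)
  also have "\<dots> = (\<Sum>u\<in>Y. \<Sum>v\<in>X. if adj v u then 1 else 0)" by (rule sum.swap)
  also have "\<dots> = (\<Sum>u\<in>Y. \<Sum>v\<in>X. if adj u v then 1 else 0)"
    using adj_sym by (intro sum.cong refl) meson
  also have "\<dots> = ecount Y X"
    unfolding ecount_def nb_def using f by (simp add: sum.If_cases Int_def)
  finally show ?thesis .
qed

lemma ecount_Un1: "finite X \<Longrightarrow> finite Y \<Longrightarrow> X \<inter> Y = {} \<Longrightarrow> ecount (X \<union> Y) Z = ecount X Z + ecount Y Z"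
  unfolding ecount_def by (rule sum.union_disjoint)

lemma ecount_Un2: "X \<inter> Y = {} \<Longrightarrow> ecount Z (X \<union> Y) = ecount Z X + ecount Z Y"
  unfolding ecount_def by (simp add: card_nb_Un sum.distrib)

lemma ecount_mono:
  assumes "X \<subseteq> X'" "Y \<subseteq> Y'" "finite X'" shows "ecount X Y \<le> ecount X' Y'"
proof -
  have "ecount X Y \<le> ecount X Y'"
    unfolding ecount_def by (intro sum_mono card_mono nb_mono assms finite_nb)
  also have "\<dots> \<le> ecount X' Y'"
    unfolding ecount_def by (rule sum_mono2) (use assms in auto)
  finally show ?thesis .
qed

lemma ecount_ge:
  assumes "\<And>v. v \<in> X \<Longrightarrow> k \<le> card (nb Y v)" shows "k * card X \<le> ecount X Y"
  unfolding ecount_def using sum_bounded_below[of X k "\<lambda>v. card (nb Y v)"] assms by (simp add: mult.commute)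

lemma properI_cls: "(\<And>k u v. u \<in> cls D c' k \<Longrightarrow> v \<in> cls D c' k \<Longrightarrow> \<not> adj u v) \<Longrightarrow> proper D c'"
  by (auto simp: proper_def cls_def)

lemma proper_miss: "proper D c \<Longrightarrow> v \<in> cls D c i \<Longrightarrow> miss v (cls D c i)"
  by (fastforce simp: proper_def cls_def miss_iff)

text \<open>Recolouring along a path of arcs: \<open>u\<close> enters class \<open>p\<close>, pushes a witness of the first arc
  into the next class, and so on, until class \<open>q\<close> has grown by one.\<close>

lemma absorb:
  assumes "finite J" "p \<in> J" "(p, q) \<in> (arcs D c J)\<^sup>*" "proper D c" "u \<notin> D" "insert u D \<subseteq> V"
    "miss u (cls D c p)"
  shows "\<exists>c'. proper (insert u D) c' \<and> (\<forall>v\<in>D. c v \<notin> J \<longrightarrow> c' v = c v) \<and>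
    (\<forall>v\<in>D. c v \<in> J \<longrightarrow> c' v \<in> J) \<and> c' u \<in> J \<and>
    (\<forall>i. card (cls (insert u D) c' i) = card (cls D c i) + (if i = q then 1 else 0))"
  using assms
proof (induction "card J" arbitrary: J p D c u)
  case 0 then show ?case by auto
next
  case (Suc n)
  have finD: "finite D" using Suc.prems finite_subV by blast
  have nadj: "\<not> adj u v \<and> \<not> adj v u" if "v \<in> cls D c p" for v
    using Suc.prems(7) that adj_sym by (auto simp: miss_iff)
  show ?case
  proof (cases "p = q")
    case True
    let ?c = "c(u := p)"
    have "proper (insert u D) ?c"
      using Suc.prems(4,5) nadj adj_irrefl unfolding proper_def cls_def by auto
    moreover have "cls (insert u D) ?c i = (if i = p then insert u (cls D c i) else cls D c i)" for i
      using Suc.prems(5) by (auto simp: cls_def)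
    moreover have "u \<notin> cls D c p" using Suc.prems(5) by (auto simp: cls_def)
    moreover have "finite (cls D c p)" using finD by (simp add: cls_def)
    ultimately show ?thesis using True Suc.prems(2,5) by (intro exI[of _ ?c]) auto
  next
    case False
    from rtrancl_avoid_start[OF Suc.prems(3) False] obtain s where
      s: "(p, s) \<in> arcs D c J" "s \<noteq> p"
         "(s, q) \<in> {(a, b) \<in> arcs D c J. a \<noteq> p \<and> b \<noteq> p}\<^sup>*" by blast
    from s(1) obtain v where v: "v \<in> cls D c p" "miss v (cls D c s)" and sJ: "s \<in> J"
      by (auto simp: arcs_def)
    \<comment> \<open>\<open>u\<close> replaces \<open>v\<close> in class \<open>p\<close>, and
      \<open>v\<close> becomes the vertex to absorb. The rest of the path avoids \<open>p\<close>,
      so its arcs survive when \<open>p\<close> is dropped from \<open>J\<close>.\<close>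
    let ?J = "J - {p}" and ?D = "insert u D - {v}" and ?c = "c(u := p)"
    have vD: "v \<in> D" "c v = p" "v \<noteq> u" using v Suc.prems(5) by (auto simp: cls_def)
    have same: "cls ?D ?c i = cls D c i" if "i \<noteq> p" for i
      using that vD Suc.prems(5) by (auto simp: cls_def)
    have "(a, b) \<in> arcs ?D ?c ?J" if "(a, b) \<in> arcs D c J" "a \<noteq> p" "b \<noteq> p" for a b
      using that same[of a] same[of b] by (auto simp: arcs_def)
    then have "{(a, b) \<in> arcs D c J. a \<noteq> p \<and> b \<noteq> p} \<subseteq> arcs ?D ?c ?J" by auto
    then have reach: "(s, q) \<in> (arcs ?D ?c ?J)\<^sup>*" using s(3) rtrancl_mono by blast
    have pr: "proper ?D ?c"
      using Suc.prems(4,5) nadj adj_irrefl unfolding proper_def cls_def by auto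
    have vn: "v \<notin> ?D" by simp
    have "n = card ?J" using Suc.hyps(2) Suc.prems(1,2) by simp
    have "v \<in> V" using vD Suc.prems(6) by auto
    have "\<exists>c'. proper (insert v ?D) c' \<and> (\<forall>w\<in>?D. ?c w \<notin> ?J \<longrightarrow> c' w = ?c w) \<and>
      (\<forall>w\<in>?D. ?c w \<in> ?J \<longrightarrow> c' w \<in> ?J) \<and> c' v \<in> ?J \<and>
      (\<forall>i. card (cls (insert v ?D) c' i) = card (cls ?D ?c i) + (if i = q then 1 else 0))"
      using \<open>v \<in> V\<close> Suc.prems(1,6) sJ s(2) v(2) same[OF s(2)]
      by (intro Suc.hyps(1)[OF \<open>n = card ?J\<close> _ _ reach pr vn]) auto
    then obtain c' where c': "proper (insert v ?D) c'" "\<forall>w\<in>?D. ?c w \<notin> ?J \<longrightarrow> c' w = ?c w"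
      "\<forall>w\<in>?D. ?c w \<in> ?J \<longrightarrow> c' w \<in> ?J" "c' v \<in> ?J"
      "\<forall>i. card (cls (insert v ?D) c' i) = card (cls ?D ?c i) + (if i = q then 1 else 0)"
      by blast
    have eq: "insert v ?D = insert u D" using vD by auto
    have szp: "card (cls ?D ?c p) = card (cls D c p)"
    proof -
      have "cls ?D ?c p = insert u (cls D c p - {v})"
        using vD Suc.prems(5) by (auto simp: cls_def)
      moreover have "u \<notin> cls D c p" using Suc.prems(5) by (auto simp: cls_def)
      moreover have "finite (cls D c p)" using finD by (simp add: cls_def)
      ultimately show ?thesis using card_Suc_Diff1[OF \<open>finite (cls D c p)\<close> v(1)] by simp
    qed
    have sz: "card (cls ?D ?c i) = card (cls D c i)" for i
      using szp same by (cases "i = p") auto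
    have "\<forall>w\<in>D. c w \<notin> J \<longrightarrow> c' w = c w"
      using c'(2) vD Suc.prems(2,5) by (metis Diff_iff fun_upd_other insert_iff singletonD)
    moreover have "\<forall>w\<in>D. c w \<in> J \<longrightarrow> c' w \<in> J"
    proof (intro ballI impI)
      fix w assume w: "w \<in> D" "c w \<in> J"
      show "c' w \<in> J"
      proof (cases "w = v")
        case True then show ?thesis using c'(4) by simp
      next
        case False
        then have wD: "w \<in> ?D" "?c w = c w" using w Suc.prems(5) by auto
        show ?thesis
        proof (cases "c w = p")
          case True then show ?thesis using c'(2) wD Suc.prems(2) by auto
        next
          case False then show ?thesis using c'(3) wD w by auto
        qed
      qed
    qed
    moreover have "c' u \<in> J" using c'(2) vD Suc.prems(2) by auto
    ultimately show ?thesis using c'(1,5) sz eq by (intro exI[of _ c']) auto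
  qed
qed

end

section \<open>Nearly equitable colourings\<close>

text \<open>A hypothetical counterexample in which only the vertex \<open>x\<close> remains to be coloured.\<close>

locale defect = fgraph V adj for V :: "'a set" and adj +
  fixes r t :: nat and x :: 'a
  assumes xV: "x \<in> V"
    and cardV: "card V = r * t"
    and r10: "10 \<le> r"
    and degr: "card (nb V v) \<le> r"
    and dens: "H \<subseteq> V \<Longrightarrow> ecount H H \<le> 7 * card H"
    and bip: "X \<subseteq> V \<Longrightarrow> Y \<subseteq> V \<Longrightarrow> X \<inter> Y = {} \<Longrightarrow> 4 * ecount X Y \<le> 9 * (card X + card Y)"
    and notdone: "proper V c \<Longrightarrow> (\<And>v. v \<in> V \<Longrightarrow> c v < r) \<Longrightarrow> (\<And>i. i < r \<Longrightarrow> card (cls V c i) = t) \<Longrightarrow> False"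
begin

abbreviation cl :: "('a \<Rightarrow> nat) \<Rightarrow> nat \<Rightarrow> 'a set" where
  "cl \<equiv> cls (V - {x})"

definition clU :: "('a \<Rightarrow> nat) \<Rightarrow> nat set \<Rightarrow> 'a set" where
  "clU c I = {v \<in> V - {x}. c v \<in> I}"

definition near :: "('a \<Rightarrow> nat) \<Rightarrow> nat \<Rightarrow> bool" where
  "near c i \<longleftrightarrow> proper (V - {x}) c \<and> (\<forall>v\<in>V - {x}. c v < r) \<and> i < r \<and>
     (\<forall>k<r. card (cl c k) = (if k = i then t - 1 else t))"

text \<open>The colours in \<open>F\<close> are kept fixed: paths avoid them.\<close>

definition reaching :: "('a \<Rightarrow> nat) \<Rightarrow> nat set \<Rightarrow> nat \<Rightarrow> nat set" where
  "reaching c F i = {p \<in> {..<r} - F. (p, i) \<in> (arcs (V - {x}) c ({..<r} - F))\<^sup>*}"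

lemma t_pos: "0 < t"
  using xV cardV finV by (metis card_gt_0_iff empty_iff mult_0_right not_gr0)

lemma finite_cl [simp, intro]: "finite (cl c i)"
  using finV by (simp add: cls_def)

lemma cl_sub: "cl c i \<subseteq> V"
  by (auto simp: cls_def)

lemma clU_sub: "clU c I \<subseteq> V"
  by (auto simp: clU_def)

lemma finite_clU [simp, intro]: "finite (clU c I)"
  using finV by (simp add: clU_def)

lemma clU_UN: "clU c I = (\<Union>i\<in>I. cl c i)"
  by (auto simp: clU_def cls_def)

lemma cl_disj: "i \<noteq> k \<Longrightarrow> cl c i \<inter> cl c k = {}"
  by (auto simp: cls_def)

lemma card_nb_clU: "finite I \<Longrightarrow> card (nb (clU c I) v) = (\<Sum>i\<in>I. card (nb (cl c i) v))"
  unfolding clU_UN by (rule card_nb_UN) (auto simp: cls_def)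

lemma card_nb_clU_ge:
  assumes "finite I" "\<And>i. i \<in> I \<Longrightarrow> \<not> miss v (cl c i)"
  shows "card I \<le> card (nb (clU c I) v)"
proof -
  have "(\<Sum>i\<in>I. 1) \<le> (\<Sum>i\<in>I. card (nb (cl c i) v))"
    by (rule sum_mono) (use assms not_missI in auto)
  then show ?thesis using card_nb_clU[OF assms(1)] by simp
qed

lemma card_clU_eq:
  assumes "finite I" shows "card (clU c I) = (\<Sum>i\<in>I. card (cl c i))"
  unfolding clU_UN using assms by (intro card_UN_disjoint) (auto simp: cls_def finV)

lemma card_clU:
  assumes "near c i" "I \<subseteq> {..<r}"
  shows "card (clU c I) + (if i \<in> I then 1 else 0) = card I * t"
proof -
  have fI: "finite I" using assms(2) finite_subset by blast
  have "card (clU c I) + (if i \<in> I then 1 else 0) = (\<Sum>k\<in>I. card (cl c k)) + (\<Sum>k\<in>I. if k = i then 1 else 0)"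
    using fI card_clU_eq[OF fI] by (simp add: sum.delta)
  also have "\<dots> = (\<Sum>k\<in>I. card (cl c k) + (if k = i then 1 else 0))" by (simp add: sum.distrib)
  also have "\<dots> = (\<Sum>k\<in>I. t)"
    using assms t_pos by (intro sum.cong refl) (auto simp: near_def)
  finally show ?thesis by simp
qed

text \<open>On 4 <= k <= r - 4 the product \<open>k * (r - k)\<close> is smallest at the ends, and
  \<open>16 * (r - 4)\<close> exceeds \<open>9 * r\<close> from \<open>r = 10\<close> on. The margin
  \<open>6 * t + 7 * (r - 10) * t\<close> is larger than 4, so it absorbs the slack 1 in the last
  hypothesis, which later pays for an exceptional vertex.\<close>

lemma dens_contradiction:
  assumes "X \<subseteq> V" "Y \<subseteq> V" "X \<inter> Y = {}" "4 \<le> k" "k + 4 \<le> r" "k * (r - k) * t \<le> ecount X Y + 1"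
  shows False
proof -
  have "card X + card Y \<le> r * t"
    using card_mono[OF finV, of "X \<union> Y"] assms(1-3) finite_subV card_Un_disjoint[of X Y] cardV by auto
  then have b: "4 * ecount X Y \<le> 9 * (r * t)" using bip[OF assms(1-3)] by (meson le_trans mult_le_mono2)
  obtain a where a: "k = 4 + a" using assms(4) le_Suc_ex by blast
  obtain d where d: "r = k + 4 + d" using assms(5) le_Suc_ex by blast
  have "4 * (r - 4) \<le> k * (r - k)" unfolding a d by (simp add: algebra_simps)
  then have "4 * (r - 4) * t \<le> ecount X Y + 1" using assms(6) by (meson le_trans mult_le_mono1)
  then have "16 * (r - 4) * t \<le> 9 * (r * t) + 4" using b by simp
  moreover obtain g where "r = 10 + g" using r10 le_Suc_ex by blast
  ultimately have "6 * t + 7 * (g * t) \<le> 4" by (simp add: algebra_simps)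
  then show False using t_pos by linarith
qed

lemma ecount_ge_exc:
  assumes "finite Y" "\<And>v. v \<in> Y \<Longrightarrow> v \<notin> Z \<Longrightarrow> k \<le> card (nb X v)" "\<And>v. v \<in> Y \<Longrightarrow> k \<le> card (nb X v) + f"
    "finite Z"
  shows "k * card Y \<le> ecount Y X + f * card Z"
proof -
  have "k * card Y = (\<Sum>v\<in>Y. k)" by simp
  also have "\<dots> \<le> (\<Sum>v\<in>Y. card (nb X v) + (if v \<in> Z then f else 0))"
    by (rule sum_mono) (use assms in auto)
  also have "\<dots> = ecount Y X + f * card (Y \<inter> Z)"
    using assms(1) by (simp add: sum.distrib ecount_def sum.If_cases Int_def)
  also have "\<dots> \<le> ecount Y X + f * card Z"
    using assms(4) by (simp add: card_mono)
  finally show ?thesis .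
qed

lemma near_color: "near c i \<Longrightarrow> v \<in> V \<Longrightarrow> v \<noteq> x \<Longrightarrow> c v < r"
  by (auto simp: near_def)

lemma near_lt: "near c i \<Longrightarrow> i < r"
  by (auto simp: near_def)

lemma near_proper: "near c i \<Longrightarrow> proper (V - {x}) c"
  by (auto simp: near_def)

lemma near_card: "near c i \<Longrightarrow> k < r \<Longrightarrow> card (cl c k) = (if k = i then t - 1 else t)"
  by (auto simp: near_def)

lemma reaching_sub: "reaching c F i \<subseteq> {..<r} - F"
  by (auto simp: reaching_def)

lemma reaching_self: "i < r \<Longrightarrow> i \<notin> F \<Longrightarrow> i \<in> reaching c F i"
  by (auto simp: reaching_def)

lemma reaching_step:
  assumes "p \<in> reaching c F i" "q < r" "q \<notin> F" "v \<in> cl c q" "miss v (cl c p)"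
  shows "q \<in> reaching c F i"
proof -
  have "(q, p) \<in> arcs (V - {x}) c ({..<r} - F)" using assms by (auto simp: arcs_def reaching_def)
  then show ?thesis using assms by (auto simp: reaching_def intro: converse_rtrancl_into_rtrancl)
qed

text \<open>Otherwise \<open>absorb\<close> puts \<open>x\<close> into class \<open>p\<close> and
  lets the small class grow to \<open>t\<close>, which \<open>notdone\<close> forbids.\<close>

lemma x_hits:
  assumes "near c i" "p \<in> reaching c F i" shows "\<not> miss x (cl c p)"
proof
  assume m: "miss x (cl c p)"
  have "\<exists>c'. proper (insert x (V - {x})) c' \<and> (\<forall>v\<in>V - {x}. c v \<notin> {..<r} - F \<longrightarrow> c' v = c v) \<and>
    (\<forall>v\<in>V - {x}. c v \<in> {..<r} - F \<longrightarrow> c' v \<in> {..<r} - F) \<and> c' x \<in> {..<r} - F \<and>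
    (\<forall>k. card (cls (insert x (V - {x})) c' k) = card (cl c k) + (if k = i then 1 else 0))"
    using assms m xV by (intro absorb) (auto simp: reaching_def near_def)
  then obtain c' where c': "proper V c'" "\<forall>v\<in>V - {x}. c v \<notin> {..<r} - F \<longrightarrow> c' v = c v"
    "\<forall>v\<in>V - {x}. c v \<in> {..<r} - F \<longrightarrow> c' v \<in> {..<r} - F" "c' x \<in> {..<r} - F"
    "\<forall>k. card (cls V c' k) = card (cl c k) + (if k = i then 1 else 0)"
    using xV by (auto simp: insert_absorb)
  have "c' v < r" if "v \<in> V" for v
    using that c'(2-4) near_color[OF assms(1), of v] by (cases "v = x"; cases "c v \<in> F") auto
  moreover have "card (cls V c' k) = t" if "k < r" for k
    using c'(5) near_card[OF assms(1) that] t_pos by auto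
  ultimately show False using notdone c'(1) by blast
qed

lemma reaching_hits:
  assumes "near c i" "p \<in> reaching c F i" "v \<in> V" "v \<notin> clU c (F \<union> reaching c F i)"
  shows "\<not> miss v (cl c p)"
proof (cases "v = x")
  case True then show ?thesis using x_hits assms by blast
next
  case False
  then have "v \<in> cl c (c v)" "c v \<notin> F" "c v \<notin> reaching c F i" "c v < r"
    using assms near_color by (auto simp: cls_def clU_def)
  then show ?thesis using reaching_step[OF assms(2)] by blast
qed

text \<open>Following a single arc moves the deficit from \<open>i\<close> to \<open>j\<close>, so
  that every domination result can be applied again with \<open>j\<close> as the small
  class.\<close>

lemma near_shift:
  assumes "near c i" "m \<in> cl c j" "j \<noteq> i" "miss m (cl c i)"
  shows "near (c(m := i)) j" "cl (c(m := i)) i = insert m (cl c i)" "cl (c(m := i)) j = cl c j - {m}"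
    "\<And>k. k \<noteq> i \<Longrightarrow> k \<noteq> j \<Longrightarrow> cl (c(m := i)) k = cl c k"
proof -
  let ?c = "c(m := i)"
  have m: "m \<in> V - {x}" "c m = j" using assms by (auto simp: cls_def)
  show 1: "cl ?c i = insert m (cl c i)" "cl ?c j = cl c j - {m}"
    "\<And>k. k \<noteq> i \<Longrightarrow> k \<noteq> j \<Longrightarrow> cl ?c k = cl c k"
    using m assms(3) by (auto simp: cls_def)
  have mn: "m \<notin> cl c i" using m assms(3) by (auto simp: cls_def)
  have jr: "j < r" using assms(1) m by (auto simp: near_def)
  have "\<not> adj m v \<and> \<not> adj v m" if "v \<in> V - {x}" "c v = i" for v
    using assms(4) that adj_sym by (auto simp: miss_iff cls_def)
  then have "proper (V - {x}) ?c"
    using assms(1) adj_irrefl unfolding near_def proper_def by auto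
  moreover have "card (cl ?c k) = (if k = j then t - 1 else t)" if "k < r" for k
  proof -
    consider "k = i" | "k = j" | "k \<noteq> i \<and> k \<noteq> j" by blast
    then show ?thesis
    proof cases
      case 1 then show ?thesis using \<open>cl ?c i = _\<close> mn near_card[OF assms(1) that] assms(3) t_pos by simp
    next
      case 2 then show ?thesis using \<open>cl ?c j = _\<close> assms(2,3) near_card[OF assms(1) that] by simp
    next
      case 3 then show ?thesis using 1(3) near_card[OF assms(1) that] by simp
    qed
  qed
  ultimately show "near ?c j" using assms(1) jr by (auto simp: near_def)
qed

lemma reaching_open:
  assumes "near c i" "m \<in> cl c j" "miss m (cl c i)" "i \<notin> F" "j \<notin> F"
  shows "j \<in> reaching c F i"
  using reaching_step[OF reaching_self[OF near_lt[OF assms(1)] assms(4)], of j m] assms near_color by (auto simp: cls_def)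

end

section \<open>Few classes reach the small class\<close>

locale low_defect = defect +
  assumes degx: "card (nb V x) \<le> 6"
begin

text \<open>Up to the exceptions in \<open>Z\<close>, each outside vertex has a neighbour in each of
  the \<open>k\<close> classes of \<open>F\<close> and \<open>reaching c F i\<close>. Applied to
  \<open>x\<close>, this gives k <= 6 and hence k + 4 <= r; if also 4 <= k, the cut has too many
  edges for \<open>dens_contradiction\<close>.\<close>

lemma reach_bound:
  assumes near: "near c i" and F: "F \<subseteq> {..<r}" "card F \<le> 2" and Z: "finite Z" "card Z \<le> 2" "x \<notin> Z"
    and dom: "\<And>v l. v \<in> V \<Longrightarrow> l \<in> F \<Longrightarrow> v \<notin> clU c (F \<union> reaching c F i) \<Longrightarrow> v \<notin> Z \<Longrightarrow> \<not> miss v (cl c l)"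
    and iF: "i \<notin> F"
  shows "card F + card (reaching c F i) \<le> 3"
proof (rule ccontr)
  let ?A = "reaching c F i" and ?I = "F \<union> reaching c F i"
  let ?X = "clU c ?I" and ?k = "card F + card (reaching c F i)"
  assume "\<not> ?k \<le> 3"
  then have k4: "4 \<le> ?k" by simp
  have fin: "finite F" "finite ?A" "finite ?I"
    using F reaching_sub[of c F i] finite_subset by (blast, blast, meson finite_UnI finite_lessThan finite_subset finite_Diff)
  have Ir: "?I \<subseteq> {..<r}" using F reaching_sub[of c F i] by blast
  have cI: "card ?I = ?k" using fin reaching_sub[of c F i] by (intro card_Un_disjoint) auto
  have iI: "i \<in> ?I" using reaching_self[OF near_lt[OF near] iF] by blast
  have hitA: "card ?A \<le> card (nb (clU c ?A) v)" if "v \<in> V - ?X" for v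
    using that reaching_hits[OF near] fin by (intro card_nb_clU_ge) auto
  have hit: "?k \<le> card (nb ?X v)" if "v \<in> V - ?X" "v \<notin> Z" for v
    using card_nb_clU_ge[of ?I v c] reaching_hits[OF near] dom[of v] that cI fin(3) by (metis DiffE Un_iff)
  have "?k \<le> card (nb ?X x)" using hit[of x] Z xV by (auto simp: clU_def)
  also have "\<dots> \<le> card (nb V x)" by (intro card_mono nb_mono finite_nb clU_sub)
  finally have k6: "?k \<le> 6" using degx by simp
  have cX: "card ?X + 1 = ?k * t" using card_clU[OF near Ir] iI cI by simp
  have "card (V - ?X) = r * t - card ?X" using card_Diff_subset[OF finite_clU clU_sub] cardV by simp
  moreover have "r * t = ?k * t + (r - ?k) * t" using k6 r10 by (simp add: add_mult_distrib[symmetric])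
  ultimately have cY: "card (V - ?X) = (r - ?k) * t + 1" using cX by simp
  have "?k * card (V - ?X) \<le> ecount (V - ?X) ?X + card F * card Z"
  proof (rule ecount_ge_exc)
    fix v assume "v \<in> V - ?X"
    have "card (nb (clU c ?A) v) \<le> card (nb ?X v)"
      by (intro card_mono finite_nb nb_mono) (auto simp: clU_def)
    then show "?k \<le> card (nb ?X v) + card F" using hitA[OF \<open>v \<in> V - ?X\<close>] by simp
  qed (use finV Z hit in auto)
  \<comment> \<open>The loss caused by \<open>Z\<close> is cancelled by the outside having one
    vertex more than \<open>(r - ?k) * t\<close>: that vertex adds \<open>?k\<close>, which is at
    least 4, to the count.\<close>
  moreover have "card F * card Z \<le> 4" using mult_le_mono[OF F(2) Z(2)] by simp
  moreover have "?k * card (V - ?X) = ?k * (r - ?k) * t + ?k" using cY by (simp add: algebra_simps)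
  ultimately have "?k * (r - ?k) * t \<le> ecount (V - ?X) ?X" using k4 by linarith
  then show False
    using dens_contradiction[of "V - ?X" ?X ?k] clU_sub[of c ?I] k4 k6 r10 by auto
qed

text \<open>Since \<open>m\<close> fits into both, the sets \<open>cl c i\<close> and \<open>cl c j - {m}\<close> have the same size \<open>t - 1\<close> and
  symmetric roles. The set \<open>L\<close> is empty or consists of the colour of a third class that dominates all
  remaining vertices except possibly the one in \<open>Z\<close>.\<close>

definition twin :: "('a \<Rightarrow> nat) \<Rightarrow> nat \<Rightarrow> nat \<Rightarrow> 'a \<Rightarrow> nat set \<Rightarrow> 'a set \<Rightarrow> bool" where
  "twin c i j m L Z \<longleftrightarrow> near c i \<and> j < r \<and> j \<noteq> i \<and> m \<in> cl c j \<and> miss m (cl c i) \<and>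
     L \<subseteq> {..<r} - {i, j} \<and> card L \<le> 1 \<and> finite Z \<and> card Z \<le> 1 \<and> x \<notin> Z \<and>
     (\<forall>v\<in>V. v \<notin> clU c ({i, j} \<union> L) \<longrightarrow> \<not> miss v (cl c i) \<and> \<not> miss v (cl c j - {m}) \<and>
        (v \<notin> Z \<longrightarrow> (\<forall>l\<in>L. \<not> miss v (cl c l))))"

text \<open>The classes \<open>i\<close> and \<open>j\<close> both reach \<open>i\<close>, so
  together with the two colours of \<open>F\<close> there would be four, against
  \<open>reach_bound\<close>.\<close>

lemma no_opening_two_bases:
  assumes near: "near c i" and m: "m \<in> cl c j" "miss m (cl c i)" and F: "F \<subseteq> {..<r} - {i, j}" "card F = 2"
    and Z: "finite Z" "card Z \<le> 2" "x \<notin> Z" and ji: "j \<noteq> i"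
    and dom: "\<And>v l. v \<in> V \<Longrightarrow> l \<in> F \<Longrightarrow> v \<notin> clU c (F \<union> {i, j}) \<Longrightarrow> v \<notin> Z \<Longrightarrow> \<not> miss v (cl c l)"
  shows False
proof -
  have sub: "{i, j} \<subseteq> reaching c F i"
    using reaching_self[OF near_lt[OF near], of F] reaching_open[OF near m, of F] F by auto
  have "card F + card (reaching c F i) \<le> 3"
  proof (rule reach_bound[OF near _ _ Z])
    fix v l assume a: "v \<in> V" "l \<in> F" "v \<notin> clU c (F \<union> reaching c F i)" "v \<notin> Z"
    have "v \<notin> clU c (F \<union> {i, j})" using a(3) sub by (auto simp: clU_def)
    then show "\<not> miss v (cl c l)" using dom a by blast
  qed (use F in auto)
  moreover have "2 \<le> card (reaching c F i)"
    using card_mono[OF finite_subset[OF reaching_sub finite_Diff[OF finite_lessThan]] sub] ji by simp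
  ultimately show False using F by simp
qed

text \<open>With \<open>l\<close> fixed, \<open>reach_bound\<close> leaves only \<open>i\<close> and
  \<open>j\<close> as reaching classes. A vertex that misses \<open>cl c j - {m}\<close> would, once
  \<open>m\<close> is shifted and \<open>j\<close> is the small class, add its own class as a third
  one.\<close>

lemma opening_twin_based:
  assumes near: "near c i" and m: "m \<in> cl c j" "miss m (cl c i)" and ji: "j \<noteq> i"
    and l: "l < r" "l \<noteq> i" "l \<noteq> j" and Z: "finite Z" "card Z \<le> 1" "x \<notin> Z"
    and dom: "\<And>v. v \<in> V \<Longrightarrow> v \<notin> clU c {i, j, l} \<Longrightarrow> v \<notin> Z \<Longrightarrow> \<not> miss v (cl c l)"
  shows "twin c i j m {l} Z"
proof -
  have jr: "j < r" using m near_color[OF near] by (auto simp: cls_def)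
  have sub: "{i, j} \<subseteq> reaching c {l} i"
    using reaching_self[OF near_lt[OF near], of "{l}"] reaching_open[OF near m, of "{l}"] l by auto
  have finrc: "finite (reaching c' {l} k)" for c' k
    by (simp add: reaching_def)
  have "card {l} + card (reaching c {l} i) \<le> 3"
  proof (rule reach_bound[OF near _ _ Z(1) _ Z(3)])
    fix v l' assume a: "v \<in> V" "l' \<in> {l}" "v \<notin> clU c ({l} \<union> reaching c {l} i)" "v \<notin> Z"
    have "v \<notin> clU c {i, j, l}" using a(3) sub by (auto simp: clU_def)
    then show "\<not> miss v (cl c l')" using dom a by blast
  qed (use l Z in auto)
  then have "card (reaching c {l} i) \<le> card {i, j}" using ji by simp
  then have reaching_eq: "reaching c {l} i = {i, j}" using card_seteq[OF finrc sub] by simp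
  have h1: "\<not> miss v (cl c p)" if "v \<in> V" "v \<notin> clU c {i, j, l}" "p \<in> {i, j}" for v p
    using reaching_hits[OF near, of p "{l}" v] that reaching_eq by (simp add: insert_commute)
  have h2: "\<not> miss v (cl c j - {m})" if v: "v \<in> V" "v \<notin> clU c {i, j, l}" for v
  proof
    assume mv: "miss v (cl c j - {m})"
    let ?c = "c(m := i)"
    note sh = near_shift[OF near m(1) ji m(2)]
    have jrc: "j \<in> reaching ?c {l} j" using reaching_self jr l by auto
    have mv': "miss v (cl ?c j)" using mv sh(3) by simp
    have vx: "v \<noteq> x" using x_hits[OF sh(1) jrc] mv' by blast
    have vq: "v \<in> cl c (c v)" "c v \<notin> {i, j, l}" using v vx by (auto simp: cls_def clU_def)
    then have vm: "v \<noteq> m" using m by (auto simp: cls_def)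
    have "v \<in> cl ?c (c v)" using vq vm by (auto simp: cls_def)
    then have q: "c v \<in> reaching ?c {l} j" using reaching_open[OF sh(1) _ mv'] vq l by auto
    have "miss m (cl ?c j)" using sh(3) proper_miss[OF near_proper[OF near] m(1)] miss_mono by (metis Diff_subset)
    then have i': "i \<in> reaching ?c {l} j" using reaching_open[OF sh(1), of m i] sh(2) l by auto
    have sub': "{i, j, c v} \<subseteq> reaching ?c {l} j" using q i' jrc by blast
    have eqU: "clU ?c {i, j, l} = clU c {i, j, l}" using m by (auto simp: clU_def cls_def)
    have "card {l} + card (reaching ?c {l} j) \<le> 3"
    proof (rule reach_bound[OF sh(1) _ _ Z(1) _ Z(3)])
      fix w l' assume a: "w \<in> V" "l' \<in> {l}" "w \<notin> clU ?c ({l} \<union> reaching ?c {l} j)" "w \<notin> Z"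
      have "w \<notin> clU ?c {i, j, l}" using a(3) sub' by (auto simp: clU_def)
      then have "w \<notin> clU c {i, j, l}" using eqU by simp
      then have "\<not> miss w (cl c l)" using dom a by blast
      then show "\<not> miss w (cl ?c l')" using sh(4)[of l] l a(2) by auto
    qed (use l Z in auto)
    moreover have "card {i, j, c v} = 3" using vq ji by auto
    ultimately show False using card_mono[OF finrc sub'] by simp
  qed
  show ?thesis unfolding twin_def
    using near m ji jr l Z h1 h2 dom by (auto simp: insert_commute)
qed

text \<open>The third reaching class is hit by every outside vertex, so it can serve as
  \<open>l\<close> without exceptions.\<close>

lemma opening_twin_3:
  assumes near: "near c i" and m: "m \<in> cl c j" "miss m (cl c i)" and ji: "j \<noteq> i" and c3: "card (reaching c {} i) \<ge> 3"
  shows "\<exists>l Z. twin c i j m {l} Z"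
proof -
  have fin: "finite (reaching c {} i)" by (simp add: reaching_def)
  have "card (reaching c {} i) \<le> 3" using reach_bound[OF near, of "{}" "{}"] by simp
  then have "card (reaching c {} i) = 3" using c3 by simp
  moreover have sub: "{i, j} \<subseteq> reaching c {} i"
    using reaching_self[OF near_lt[OF near], of "{}"] reaching_open[OF near m, of "{}"] by auto
  ultimately have "card (reaching c {} i - {i, j}) = 1" using ji by (simp add: card_Diff_subset)
  then obtain l where "reaching c {} i - {i, j} = {l}" using card_1_singletonE by blast
  then have reaching_eq: "reaching c {} i = {i, j, l}" and l: "l \<noteq> i" "l \<noteq> j" using sub by blast+
  have "l < r" using reaching_eq reaching_sub[of c "{}" i] by auto
  have "twin c i j m {l} {}"
    by (rule opening_twin_based[OF near m ji \<open>l < r\<close> l]) (use reaching_hits[OF near, of l "{}"] reaching_eq in auto)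
  then show ?thesis by blast
qed

text \<open>If only \<open>i\<close> and \<open>j\<close> reach \<open>i\<close>, then either
  \<open>cl c j - {m}\<close> dominates the rest, giving a twin with empty \<open>L\<close>, or a
  vertex missing it produces three reaching classes after the shift of \<open>m\<close>.\<close>

lemma opening_twin:
  assumes near: "near c i" and m: "m \<in> cl c j" "miss m (cl c i)" and ji: "j \<noteq> i"
  shows "\<exists>c i j m L Z. twin c i j m L Z"
proof (cases "card (reaching c {} i) \<ge> 3")
  case True then show ?thesis using opening_twin_3[OF assms] by blast
next
  case False
  have jr: "j < r" using m near_color[OF near] by (auto simp: cls_def)
  have fin: "finite (reaching c' {} k)" for c' k by (simp add: reaching_def)
  have sub: "{i, j} \<subseteq> reaching c {} i"
    using reaching_self[OF near_lt[OF near], of "{}"] reaching_open[OF near m, of "{}"] by auto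
  then have reaching_eq: "reaching c {} i = {i, j}" using card_seteq[OF fin sub] False ji by auto
  show ?thesis
  proof (cases "\<forall>v\<in>V. v \<notin> clU c {i, j} \<longrightarrow> \<not> miss v (cl c j - {m})")
    case True
    have "\<not> miss v (cl c i)" if "v \<in> V" "v \<notin> clU c {i, j}" for v
      using reaching_hits[OF near, of i "{}" v] that reaching_eq by simp
    then have "twin c i j m {} {}" unfolding twin_def using near m ji jr True by auto
    then show ?thesis by blast
  next
    case False
    then obtain v where v: "v \<in> V" "v \<notin> clU c {i, j}" and mv: "miss v (cl c j - {m})" by blast
    let ?c = "c(m := i)"
    note sh = near_shift[OF near m(1) ji m(2)]
    have jrc: "j \<in> reaching ?c {} j" using reaching_self jr by auto
    have mv': "miss v (cl ?c j)" using mv sh(3) by simp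
    have vx: "v \<noteq> x" using x_hits[OF sh(1) jrc] mv' by blast
    have vq: "v \<in> cl c (c v)" "c v \<notin> {i, j}" using v vx by (auto simp: cls_def clU_def)
    then have vm: "v \<noteq> m" using m by (auto simp: cls_def)
    have "v \<in> cl ?c (c v)" using vq vm by (auto simp: cls_def)
    then have q: "c v \<in> reaching ?c {} j" using reaching_open[OF sh(1) _ mv'] vq by auto
    have mj: "miss m (cl ?c j)" using sh(3) proper_miss[OF near_proper[OF near] m(1)] miss_mono by (metis Diff_subset)
    then have i': "i \<in> reaching ?c {} j" using reaching_open[OF sh(1), of m i] sh(2) by auto
    have "{i, j, c v} \<subseteq> reaching ?c {} j" using q i' jrc by blast
    moreover have "card {i, j, c v} = 3" using vq ji by auto
    ultimately have "card (reaching ?c {} j) \<ge> 3" using card_mono[OF fin] by metis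
    from opening_twin_3[OF sh(1) _ mj _ this, of i] sh(2) ji show ?thesis by blast
  qed
qed

end

section \<open>Two interchangeable dominating sets\<close>

text \<open>A twin with empty \<open>L\<close> is studied only after twins with a third dominating
  class have been excluded. Thus any exchange that gains a further dominating class is a
  contradiction for either kind of \<open>L\<close>.\<close>

locale twin_state = low_defect V adj r t x for V :: "'a set" and adj r t x +
  fixes c :: "'a \<Rightarrow> nat" and i j :: nat and m :: 'a and L :: "nat set" and Z :: "'a set"
  assumes T: "twin c i j m L Z"
    and no_based_twin: "L = {} \<Longrightarrow> \<not> twin c' i' j' m' {l} Z'"
begin

abbreviation S1 where "S1 \<equiv> cl c i"
abbreviation S2 where "S2 \<equiv> cl c j - {m}"
abbreviation J where "J \<equiv> {..<r} - ({i, j} \<union> L)"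
abbreviation R where "R \<equiv> arcs (V - {x}) c J"

lemma nearc: "near c i" and jr: "j < r" and ji: "j \<noteq> i" and mj: "m \<in> cl c j" and mi: "miss m S1"
  and Lsub: "L \<subseteq> {..<r} - {i, j}" and cardL: "card L \<le> 1" and Zf: "finite Z" "card Z \<le> 1" "x \<notin> Z"
  using T by (auto simp: twin_def)

lemma ir: "i < r"
  using nearc near_lt by blast

lemma finL: "finite L"
  using Lsub finite_subset by blast

lemma dom1: "v \<in> V \<Longrightarrow> v \<notin> clU c ({i, j} \<union> L) \<Longrightarrow> \<not> miss v S1"
  and dom2: "v \<in> V \<Longrightarrow> v \<notin> clU c ({i, j} \<union> L) \<Longrightarrow> \<not> miss v S2"
  and dom3: "v \<in> V \<Longrightarrow> v \<notin> clU c ({i, j} \<union> L) \<Longrightarrow> v \<notin> Z \<Longrightarrow> l \<in> L \<Longrightarrow> \<not> miss v (cl c l)"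
  using T by (auto simp: twin_def)

lemma cardJ: "card J = r - 2 - card L"
proof -
  have "card ({i, j} \<union> L) = 2 + card L"
    using ji Lsub finL by (subst card_Un_disjoint) auto
  moreover have "{i, j} \<union> L \<subseteq> {..<r}" using ir jr Lsub by auto
  ultimately show ?thesis using finL by (simp add: card_Diff_subset)
qed

lemma cardS1: "card S1 = t - 1"
  using near_card[OF nearc ir] by simp

lemma cardS2: "card S2 = t - 1"
  using near_card[OF nearc jr] ji mj by simp

text \<open>The full class \<open>j\<close> plays the role of a further dominating class. For empty
  \<open>L\<close> it turns the new opening into a twin based on \<open>j\<close>; otherwise
  \<open>j\<close> and the colour in \<open>L\<close> are the two bases of
  \<open>no_opening_two_bases\<close>.\<close>

lemma progress:
  assumes near: "near c' i'" and o: "w \<in> cl c' j'" "miss w (cl c' i')" "j' \<noteq> i'"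
    and sep: "i' \<notin> insert j L" "j' \<notin> insert j L"
    and Z': "finite Z'" "card Z' \<le> 1" "x \<notin> Z'"
    and d2: "\<And>v. v \<in> V \<Longrightarrow> v \<notin> clU c' (insert j L \<union> {i', j'}) \<Longrightarrow> v \<notin> Z' \<Longrightarrow> \<not> miss v (cl c' j)"
    and d3: "\<And>v l. v \<in> V \<Longrightarrow> v \<notin> clU c' (insert j L \<union> {i', j'}) \<Longrightarrow> v \<notin> Z' \<Longrightarrow> v \<notin> Z \<Longrightarrow> l \<in> L
              \<Longrightarrow> \<not> miss v (cl c' l)"
  shows False
proof (cases "L = {}")
  case True
  have "twin c' i' j' w {j} Z'"
  proof (rule opening_twin_based[OF near o(1,2,3) jr _ _ Z'])
    fix v assume "v \<in> V" "v \<notin> clU c' {i', j', j}" "v \<notin> Z'"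
    then show "\<not> miss v (cl c' j)" using d2[of v] True by (simp add: insert_commute)
  qed (use sep in auto)
  then show False using no_based_twin True by blast
next
  case False
  then have "card L = 1" using cardL finL by (simp add: le_Suc_eq)
  then have "card (insert j L) = 2" using Lsub finL by (auto simp: card_insert_if)
  moreover have "insert j L \<subseteq> {..<r} - {i', j'}" using sep Lsub jr by auto
  moreover have "card (Z \<union> Z') \<le> 2" using card_Un_le[of Z Z'] Zf Z' by linarith
  ultimately show False
    using no_opening_two_bases[OF near o(1,2), of "insert j L" "Z \<union> Z'"] o(3) Zf Z' d2 d3 by auto
qed

text \<open>The vertex \<open>z\<close> leaves \<open>S1\<close> for class \<open>p\<close>, a shift along arcs moves the surplus to the class of \<open>y\<close>,
  and \<open>y\<close> replaces \<open>z\<close> in \<open>S1\<close>. Then \<open>y'\<close> has no neighbour left in the small class.\<close>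

lemma rotate:
  assumes z: "z \<in> S1" and y: "y \<in> clU c J" "nb S1 y = {z}" and y': "y' \<in> clU c J" "nb S1 y' = {z}"
    and yy: "y \<noteq> y'" "\<not> adj y y'" and p: "p \<in> J" "nb (cl c p) z \<subseteq> {y}" "(p, c y) \<in> R\<^sup>*"
  shows False
proof -
  let ?D = "V - {x} - {z}" and ?c = "c(y := i)"
  have zc: "z \<in> V - {x}" "c z = i" using z by (auto simp: cls_def)
  have yc: "y \<in> V - {x}" "c y \<in> J" "y \<noteq> z" using y zc by (auto simp: clU_def)
  have y'c: "y' \<in> V - {x}" "c y' \<in> J" "y' \<noteq> z" using y' zc by (auto simp: clU_def)
  have iJ: "i \<notin> J" by simp
  have cls1: "cls ?D ?c k = cl c k" if "k \<noteq> i" "k \<noteq> c y" for k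
    using that zc by (auto simp: cls_def)
  have cls2: "cls ?D ?c (c y) = cl c (c y) - {y}"
    using zc yc by (auto simp: cls_def)
  have cls3: "cls ?D ?c i = insert y (S1 - {z})"
    using zc yc by (auto simp: cls_def)
  have clsJ: "cls ?D ?c k \<subseteq> cl c k" if "k \<in> J" for k
    using that cls1[of k] cls2 by (cases "k = c y") auto
  have "(a, b) \<in> arcs ?D ?c J" if "(a, b) \<in> R" "a \<noteq> c y" for a b
  proof -
    from that obtain v where v: "a \<in> J" "b \<in> J" "v \<in> cl c a" "miss v (cl c b)" by (auto simp: arcs_def)
    then have "v \<in> cls ?D ?c a" using cls1[of a] that by auto
    moreover have "miss v (cls ?D ?c b)" using miss_mono[OF clsJ] v by blast
    ultimately show ?thesis using v by (auto simp: arcs_def)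
  qed
  then have "{(a, b) \<in> R. a \<noteq> c y} \<subseteq> arcs ?D ?c J" by auto
  then have reach: "(p, c y) \<in> (arcs ?D ?c J)\<^sup>*"
    using rtrancl_avoid_end[OF p(3)] rtrancl_mono by blast
  have yn: "\<not> adj y v \<and> \<not> adj v y" if "v \<in> ?D" "c v = i" for v
  proof -
    have "v \<in> S1" "v \<noteq> z" using that by (auto simp: cls_def)
    then have "\<not> adj y v" using y(2) by (auto simp: nb_def)
    then show ?thesis using adj_sym by blast
  qed
  have pr: "proper ?D ?c"
    using near_proper[OF nearc] yn adj_irrefl unfolding proper_def by auto
  have mz: "miss z (cls ?D ?c p)"
  proof (cases "p = c y")
    case True then show ?thesis using p(2) cls2 by (auto simp: miss_iff nb_def)
  next
    case False
    then have "y \<notin> cl c p" by (auto simp: cls_def)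
    then have "miss z (cl c p)" using p(2) nb_subset by (auto simp: miss_def)
    then show ?thesis using cls1[of p] False p(1) by auto
  qed
  have ins: "insert z ?D = V - {x}" using zc by auto
  have "\<exists>c'. proper (insert z ?D) c' \<and> (\<forall>v\<in>?D. ?c v \<notin> J \<longrightarrow> c' v = ?c v) \<and>
    (\<forall>v\<in>?D. ?c v \<in> J \<longrightarrow> c' v \<in> J) \<and> c' z \<in> J \<and>
    (\<forall>k. card (cls (insert z ?D) c' k) = card (cls ?D ?c k) + (if k = c y then 1 else 0))"
    using p(1) zc by (intro absorb[OF _ p(1) reach pr _ _ mz]) auto
  then obtain c' where c': "proper (V - {x}) c'" "\<forall>v\<in>?D. ?c v \<notin> J \<longrightarrow> c' v = ?c v"
    "\<forall>v\<in>?D. ?c v \<in> J \<longrightarrow> c' v \<in> J" "c' z \<in> J"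
    "\<forall>k. card (cl c' k) = card (cls ?D ?c k) + (if k = c y then 1 else 0)"
    unfolding ins by blast
  have cl': "cl c' k = cls ?D ?c k" if "k \<notin> J" for k
  proof (intro set_eqI iffI)
    fix v assume "v \<in> cl c' k"
    then have v: "v \<in> V - {x}" "c' v = k" by (auto simp: cls_def)
    then have "v \<noteq> z" using c'(4) that by auto
    then have vD: "v \<in> ?D" using v by auto
    then have "?c v \<notin> J" using c'(3) v that by blast
    then show "v \<in> cls ?D ?c k" using c'(2) vD v by (auto simp: cls_def)
  next
    fix v assume "v \<in> cls ?D ?c k"
    then have v: "v \<in> ?D" "?c v = k" by (auto simp: cls_def)
    then show "v \<in> cl c' k" using c'(2) that by (auto simp: cls_def)
  qed
  have "c' v < r" if "v \<in> V - {x}" for v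
  proof (cases "v = z")
    case True then show ?thesis using c'(4) by auto
  next
    case False
    then have vD: "v \<in> ?D" using that by auto
    have "?c v < r" using near_color[OF nearc] that ir by auto
    show ?thesis
    proof (cases "?c v \<in> J")
      case True
      then have "c' v \<in> J" using c'(3) vD by blast
      then show ?thesis by simp
    next
      case False
      then have "c' v = ?c v" using c'(2) vD by blast
      then show ?thesis using \<open>?c v < r\<close> by simp
    qed
  qed
  moreover have "card (cl c' k) = (if k = i then t - 1 else t)" if "k < r" for k
  proof -
    consider "k = i" | "k = c y" | "k \<noteq> i \<and> k \<noteq> c y" by blast
    then show ?thesis
    proof cases
      case 1
      have "y \<notin> S1 - {z}" using yc by (auto simp: cls_def)
      then have "card (cls ?D ?c i) = t - 1" unfolding cls3
        using card_Suc_Diff1[OF finite_cl z] cardS1 by simp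
      then show ?thesis using 1 c'(5) yc by auto
    next
      case 2
      have "y \<in> cl c (c y)" using yc by (auto simp: cls_def)
      then have "card (cls ?D ?c (c y)) + 1 = card (cl c (c y))" unfolding cls2
        using card_Suc_Diff1[OF finite_cl] by simp
      then show ?thesis using 2 c'(5) yc near_card[OF nearc that] by auto
    next
      case 3 then show ?thesis using c'(5) cls1[of k] near_card[OF nearc that] by auto
    qed
  qed
  ultimately have near': "near c' i" using c'(1) ir by (auto simp: near_def)
  have cy': "c' y' \<in> J" using c'(3) y'c yy by auto
  have iy: "c' y = i" using c'(2) yc by auto
  have cli: "cl c' i = insert y (S1 - {z})" using cl'[OF iJ] cls3 by simp
  have "y' \<in> cl c' (c' y')" using y'c by (auto simp: cls_def)
  moreover have "miss y' (cl c' i)"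
    using y'(2) yy adj_sym unfolding cli by (auto simp: miss_iff nb_def)
  ultimately show False
  \<comment> \<open>\<open>z\<close> now lies in an outside class, but as a former member of
    \<open>S1\<close> it need not have neighbours in class \<open>j\<close> or in the class of
    \<open>L\<close>.\<close>
  proof (rule progress[OF near', where Z' = "{z}"])
    have key: "v \<notin> clU c ({i, j} \<union> L)"
      if "v \<in> V" "v \<notin> clU c' (insert j L \<union> {i, c' y'})" "v \<notin> {z}" for v
    proof
      assume v: "v \<in> clU c ({i, j} \<union> L)"
      then have vD: "v \<in> ?D" "c v \<notin> J" using that by (auto simp: clU_def)
      show False
      proof (cases "v = y")
        case True then show ?thesis using vD yc by auto
      next
        case False
        then have "c' v = c v" using c'(2) vD by auto
        then show False using v that by (auto simp: clU_def)
      qed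
    qed
    fix v assume v: "v \<in> V" "v \<notin> clU c' (insert j L \<union> {i, c' y'})" "v \<notin> {z}"
    have "cl c' j = cl c j" using cl'[of j] cls1[of j] ji yc by auto
    then show "\<not> miss v (cl c' j)" using dom2[OF v(1) key[OF v]] miss_mono[of S2] by auto
    fix l assume l: "v \<notin> Z" "l \<in> L"
    then have "cl c' l = cl c l" using cl'[of l] cls1[of l] Lsub yc by auto
    then show "\<not> miss v (cl c' l)" using dom3[OF v(1) key[OF v]] l by auto
  qed (use cy' zc ji Lsub in auto)
qed

text \<open>Moving \<open>z\<close> to \<open>S2\<close> and both \<open>m\<close> and \<open>y\<close> to \<open>S1\<close> fills the two classes.\<close>

lemma movable:
  assumes z: "z \<in> S1" "miss z S2" and y: "y \<in> V" "y \<notin> clU c ({i, j} \<union> L)" "nb S1 y = {z}" "\<not> adj y m"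
  shows False
proof -
  have zc: "z \<in> V - {x}" "c z = i" using z by (auto simp: cls_def)
  have mc: "m \<in> V - {x}" "c m = j" using mj by (auto simp: cls_def)
  have ne: "z \<noteq> m" "y \<noteq> z" "y \<noteq> m" using zc mc y ji by (auto simp: clU_def)
  have my: "\<not> adj m y" using y(4) adj_sym by blast
  have n1: "\<not> adj y v \<and> \<not> adj v y" if "v \<in> V - {x}" "c v = i" "v \<noteq> z" for v
  proof -
    have "v \<in> S1" using that by (auto simp: cls_def)
    then have "\<not> adj y v" using y(3) that by (auto simp: nb_def)
    then show ?thesis using adj_sym by blast
  qed
  have n2: "\<not> adj m v \<and> \<not> adj v m" if "v \<in> V - {x}" "c v = i" for v
    using mi that adj_sym by (auto simp: miss_iff cls_def)
  have n3: "\<not> adj z v \<and> \<not> adj v z" if "v \<in> V - {x}" "c v = j" "v \<noteq> m" for v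
    using z(2) that adj_sym by (auto simp: miss_iff cls_def)
  have t2: "2 \<le> t" using cardS1 z(1) finite_cl by (cases "t \<le> 1") (auto simp: card_gt_0_iff)
  let ?c = "c(z := j, m := i, y := i)"
  have ciS: "cls (insert y (V - {x})) ?c i = insert y (insert m (S1 - {z}))"
    using zc mc ne ji by (auto simp: cls_def)
  have cjS: "cls (insert y (V - {x})) ?c j = insert z S2"
    using zc mc ne ji y(2) by (auto simp: cls_def clU_def)
  have ckS: "cls (insert y (V - {x})) ?c k = cl c k - {y}" if "k \<noteq> i" "k \<noteq> j" for k
    using that zc mc ne by (auto simp: cls_def)
  have ind: "\<not> adj u v" if "u \<in> cl c k" "v \<in> cl c k" for u v k
    using proper_miss[OF near_proper[OF nearc] that(1)] that(2) by (auto simp: miss_iff)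
  have pr: "proper (insert y (V - {x})) ?c"
    unfolding proper_def
  proof (intro ballI impI notI)
    fix u v assume univ: "u \<in> insert y (V - {x})" "v \<in> insert y (V - {x})" "adj u v" "?c u = ?c v"
    obtain k where "?c u = k" "?c v = k" using univ(4) by metis
    then have in': "u \<in> cls (insert y (V - {x})) ?c k" "v \<in> cls (insert y (V - {x})) ?c k"
      using univ(1,2) unfolding cls_def by blast+
    consider "k = i" | "k = j" | "k \<noteq> i" "k \<noteq> j" by blast
    then show False
    proof cases
      case 1
      have "u \<in> insert y (insert m (S1 - {z}))" "v \<in> insert y (insert m (S1 - {z}))"
        using in' 1 ciS by auto
      moreover have "\<not> adj y w \<and> \<not> adj w y \<and> \<not> adj m w \<and> \<not> adj w m" if "w \<in> S1 - {z}" for w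
        using n1[of w] n2[of w] that by (simp add: cls_def)
      ultimately show False using univ(3) ind[of u i v] adj_irrefl my y(4) by blast
    next
      case 2
      have "u \<in> insert z S2" "v \<in> insert z S2" using in' 2 cjS by auto
      moreover have "\<not> adj z w \<and> \<not> adj w z" if "w \<in> S2" for w
        using n3[of w] that by (simp add: cls_def)
      ultimately show False using univ(3) ind[of u j v] adj_irrefl by blast
    next
      case 3
      have "u \<in> cl c k" "v \<in> cl c k" using in' unfolding ckS[OF 3] by blast+
      then show False using ind univ(3) by blast
    qed
  qed
  have ysm: "y \<notin> insert m (S1 - {z})" "m \<notin> S1 - {z}"
    using y(2) mc ne ji by (auto simp: cls_def clU_def)
  have szi: "card (cls (insert y (V - {x})) ?c i) = t"
    unfolding ciS using ysm card_Suc_Diff1[OF finite_cl z(1)] cardS1 t2 by simp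
  have "z \<notin> S2" using zc ji by (auto simp: cls_def)
  then have szj: "card (cls (insert y (V - {x})) ?c j) = t"
    unfolding cjS using cardS2 t2 by simp
  have lt: "?c v < r" if "v \<in> insert y (V - {x})" for v
    using that near_color[OF nearc] ir jr by auto
  show False
  \<comment> \<open>If \<open>y = x\<close>, filling both classes completes an equitable colouring.
    Otherwise the former class of \<open>y\<close> becomes the small one, and \<open>y\<close>
    itself, now in class \<open>i\<close>, can move back into it.\<close>
  proof (cases "y = x")
    case True
    have V': "insert y (V - {x}) = V" using True xV by auto
    have "card (cls V ?c k) = t" if "k < r" for k
    proof -
      consider "k = i" | "k = j" | "k \<noteq> i \<and> k \<noteq> j" by blast
      then show ?thesis
      proof cases
        case 3
        have "y \<notin> cl c k" using True by (auto simp: cls_def)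
        then show ?thesis using ckS[of k] 3 near_card[OF nearc that] V' by simp
      qed (use szi szj V' in auto)
    qed
    then show False using notdone[of ?c] pr lt V' by auto
  next
    case False
    then have yc: "y \<in> V - {x}" "c y \<in> J"
      using y near_color[OF nearc, of y] by (auto simp: clU_def)
    have V': "insert y (V - {x}) = V - {x}" using yc by auto
    note pr = pr[unfolded V'] and ciS = ciS[unfolded V'] and cjS = cjS[unfolded V'] and ckS = ckS[unfolded V']
      and szi = szi[unfolded V'] and szj = szj[unfolded V'] and lt = lt[unfolded V']
    have ysz: "y \<in> cl c (c y)" using yc by (auto simp: cls_def)
    have "card (cl ?c k) = (if k = c y then t - 1 else t)" if "k < r" for k
    proof -
      consider "k = i" | "k = j" | "k = c y" | "k \<noteq> i \<and> k \<noteq> j \<and> k \<noteq> c y" by blast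
      then show ?thesis
      proof cases
        case 3
        then show ?thesis using ckS[of k] yc near_card[OF nearc that] card_Suc_Diff1[OF finite_cl ysz] by auto
      next
        case 4
        then have "y \<notin> cl c k" by (auto simp: cls_def)
        then show ?thesis using ckS[of k] 4 near_card[OF nearc that] by simp
      qed (use szi szj yc in auto)
    qed
    then have near': "near ?c (c y)" using pr lt yc by (auto simp: near_def)
    show False
    proof (rule progress[OF near', where Z' = "{}"])
      show yi: "y \<in> cl ?c i" using ciS by auto
      show "miss y (cl ?c (c y))"
        using proper_miss[OF near_proper[OF nearc] ysz] ckS[of "c y"] yc miss_mono[of "cl c (c y) - {y}"] by auto
      have key: "v \<notin> clU c ({i, j} \<union> L)"
        if "v \<in> V" "v \<notin> clU ?c (insert j L \<union> {c y, i})" for v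
      proof
        assume v: "v \<in> clU c ({i, j} \<union> L)"
        have "?c z = j" "?c m = i" "?c y = i" using ne by auto
        with v have "v \<notin> {z, m, y}" using that by (auto simp: clU_def simp del: fun_upd_apply)
        then show False using v that by (auto simp: clU_def)
      qed
      fix v assume v: "v \<in> V" "v \<notin> clU ?c (insert j L \<union> {c y, i})"
      then show "\<not> miss v (cl ?c j)" using dom2[OF v(1) key[OF v]] miss_mono[of S2 "cl ?c j"] cjS by auto
      fix l assume l: "v \<notin> Z" "l \<in> L"
      have "l \<noteq> i" "l \<noteq> j" "y \<notin> cl c l" using l Lsub yc by (auto simp: cls_def)
      then have "cl ?c l = cl c l" using ckS[of l] by blast
      then show "\<not> miss v (cl ?c l)" using dom3[OF v(1) key[OF v]] l by auto
    qed (use yc ji Lsub in auto)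
  qed
qed

text \<open>Shifting \<open>m\<close> interchanges \<open>S1\<close> and \<open>S2\<close> exactly;
  this later permits assuming that \<open>S1\<close> sends out no more edges than
  \<open>S2\<close>.\<close>

lemma mirror: "twin (c(m := i)) j i m L Z"
proof -
  note sh = near_shift[OF nearc mj ji mi]
  have "miss m (cl (c(m := i)) j)"
    using sh(3) proper_miss[OF near_proper[OF nearc] mj] miss_mono by (metis Diff_subset)
  moreover have "m \<notin> S1" using mj ji by (auto simp: cls_def)
  then have "cl (c(m := i)) i - {m} = S1" using sh(2) by simp
  moreover have "clU (c(m := i)) ({j, i} \<union> L) = clU c ({i, j} \<union> L)" using mj by (auto simp: clU_def cls_def)
  moreover have "cl (c(m := i)) l = cl c l" if "l \<in> L" for l using sh(4) that Lsub by blast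
  ultimately show ?thesis
    unfolding twin_def using sh ji ir Lsub cardL Zf dom1 dom2 dom3 by auto
qed

end

section \<open>Near-cliques excluded by the bound 7/2\<close>

context defect
begin

text \<open>Six pairwise adjacent vertices joined to three others span \<open>33 > 7/2 \<cdot> 9\<close> edges.\<close>

lemma no_joined_clique:
  assumes "P \<subseteq> V" "Q \<subseteq> V" "P \<inter> Q = {}" "card P = 6" "card Q = 3"
    and PP: "\<And>u v. u \<in> P \<Longrightarrow> v \<in> P \<Longrightarrow> u \<noteq> v \<Longrightarrow> adj u v"
    and PQ: "\<And>u v. u \<in> P \<Longrightarrow> v \<in> Q \<Longrightarrow> adj u v"
  shows False
proof -
  have fin: "finite P" "finite Q" using assms finite_subV by auto
  have cPQ: "card (P \<union> Q) = 9" using assms fin by (simp add: card_Un_disjoint)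
  have "8 * card P \<le> ecount P (P \<union> Q)"
  proof (rule ecount_ge)
    fix v assume v: "v \<in> P"
    have "P \<union> Q - {v} \<subseteq> nb (P \<union> Q) v" using PP[OF v] PQ[OF v] by (auto simp: nb_def)
    then have "card (P \<union> Q - {v}) \<le> card (nb (P \<union> Q) v)" by (intro card_mono) auto
    then show "8 \<le> card (nb (P \<union> Q) v)" using cPQ v fin by simp
  qed
  moreover have "6 * card Q \<le> ecount Q (P \<union> Q)"
  proof (rule ecount_ge)
    fix v assume v: "v \<in> Q"
    have "P \<subseteq> nb (P \<union> Q) v" using PQ v adj_sym by (auto simp: nb_def)
    then have "card P \<le> card (nb (P \<union> Q) v)" by (intro card_mono) auto
    then show "6 \<le> card (nb (P \<union> Q) v)" using assms by simp
  qed
  ultimately have "66 \<le> ecount (P \<union> Q) (P \<union> Q)"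
    using ecount_Un1[OF fin assms(3), of "P \<union> Q"] assms(4,5) by simp
  then show False using dens[of "P \<union> Q"] assms(1,2) cPQ by simp
qed

text \<open>Five such vertices and \<open>z\<close> would form a 6-clique joined to three further
  vertices of \<open>S\<close>; this is where 8 = 5 + 3 comes from.\<close>

lemma card_universal_le:
  assumes z: "z \<in> V" and S: "S \<subseteq> V" and adjz: "\<And>y. y \<in> S \<Longrightarrow> adj z y" and s8: "8 \<le> card S"
  shows "card {y \<in> S. \<forall>y'\<in>S. y' \<noteq> y \<longrightarrow> adj y y'} \<le> 4" (is "card ?A \<le> 4")
proof (rule ccontr)
  assume "\<not> card ?A \<le> 4"
  then have "5 \<le> card ?A" by simp
  then obtain U where U: "U \<subseteq> ?A" "card U = 5" by (rule obtain_subset_with_card_n)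
  have Usol: "U \<subseteq> S" using U by blast
  have fU: "finite U" using Usol S finite_subV by blast
  have "3 \<le> card (S - U)" using U(2) Usol s8 fU by (simp add: card_Diff_subset)
  then obtain Q where Q: "Q \<subseteq> S - U" "card Q = 3" by (rule obtain_subset_with_card_n)
  have zn: "z \<notin> S" using adjz adj_irrefl by blast
  have adjU: "adj a b" if "a \<in> U" "b \<in> S" "a \<noteq> b" for a b
  proof -
    have "a \<in> ?A" using that U(1) by blast
    then show ?thesis using that by auto
  qed
  show False
  proof (rule no_joined_clique[of "insert z U" Q])
    show "insert z U \<subseteq> V" "Q \<subseteq> V" using S Usol Q z by blast+
    show "insert z U \<inter> Q = {}" using Q zn by blast
    show "card (insert z U) = 6" using U(2) zn Usol fU by (subst card_insert_disjoint) auto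
    show "card Q = 3" by (rule Q(2))
    show "adj u v" if "u \<in> insert z U" "v \<in> insert z U" "u \<noteq> v" for u v
      using that adjz adjU Usol adj_sym by blast
    show "adj u v" if "u \<in> insert z U" "v \<in> Q" for u v
      using that adjz adjU Q(1) by blast
  qed
qed

end

section \<open>Strong connectivity of the classes outside the twin sets\<close>

context twin_state
begin

abbreviation base where "base \<equiv> S1 \<union> S2 \<union> clU c L"

lemma J_outside: "v \<in> clU c J \<Longrightarrow> v \<in> V \<and> v \<notin> clU c ({i, j} \<union> L)"
  by (auto simp: clU_def)

lemma card_nb_base: "card (nb base v) = card (nb S1 v) + card (nb S2 v) + card (nb (clU c L) v)"
proof -
  have "(S1 \<union> S2) \<inter> clU c L = {}" "S1 \<inter> S2 = {}" using Lsub ji by (auto simp: clU_def cls_def)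
  then show ?thesis by (simp add: card_nb_Un)
qed

lemma base_hits2: "v \<in> clU c J \<Longrightarrow> 2 \<le> card (nb base v)"
  using card_nb_base[of v] not_missI[OF dom1] not_missI[OF dom2] J_outside by fastforce

lemma base_hits: "v \<in> clU c J \<Longrightarrow> v \<notin> Z \<Longrightarrow> 2 + card L \<le> card (nb base v)"
proof -
  assume v: "v \<in> clU c J" "v \<notin> Z"
  have "card L \<le> card (nb (clU c L) v)"
    using dom3 J_outside[OF v(1)] v finL by (intro card_nb_clU_ge) auto
  moreover have "1 \<le> card (nb S1 v)" "1 \<le> card (nb S2 v)"
    using not_missI dom1 dom2 J_outside[OF v(1)] by auto
  ultimately show ?thesis using card_nb_base[of v] by linarith
qed

lemma base_sub: "base \<subseteq> V"
  using cl_sub clU_sub by auto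

lemma base_disj: "Q \<subseteq> J \<Longrightarrow> base \<inter> clU c Q = {}"
  using Lsub jr ir by (auto simp: clU_def cls_def)

lemma card_L_card_Z_le: "card L * card Z \<le> 1"
  using mult_le_mono[OF cardL Zf(2)] by simp

text \<open>The use of this notion lies in the missing arcs: every vertex of the other classes of
  \<open>J\<close> has a neighbour in each class of \<open>Q\<close>, so these classes can be
  counted together with the dominating sets.\<close>

definition in_closed :: "nat set \<Rightarrow> bool" where
  "in_closed Q \<longleftrightarrow> Q \<subseteq> J \<and> (\<forall>q\<in>J - Q. \<forall>p\<in>Q. (q, p) \<notin> R)"

lemma in_closed_hit:
  assumes "in_closed Q" "v \<in> clU c (J - Q)" "p \<in> Q" shows "\<not> miss v (cl c p)"
proof
  assume "miss v (cl c p)"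
  moreover have "v \<in> cl c (c v)" "c v \<in> J - Q" using assms by (auto simp: clU_def cls_def)
  ultimately have "(c v, p) \<in> R" using assms by (auto simp: arcs_def in_closed_def)
  then show False using assms \<open>c v \<in> J - Q\<close> by (auto simp: in_closed_def)
qed

lemma card_clUJ: "Q \<subseteq> J \<Longrightarrow> card (clU c Q) = card Q * t"
proof -
  assume "Q \<subseteq> J"
  then have "Q \<subseteq> {..<r}" "i \<notin> Q" by auto
  then show ?thesis using card_clU[OF nearc, of Q] by simp
qed

text \<open>Two cuts are counted. In the first, the classes of \<open>J - Q\<close> face
  \<open>base\<close> and \<open>Q\<close>. In the second, \<open>Q\<close> faces
  \<open>base\<close> and \<open>J - Q\<close>: with \<open>k = card Q\<close>, each of its
  \<open>k * t\<close> vertices has \<open>2 + card L\<close> neighbours in \<open>base\<close>, and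
  each vertex of \<open>J - Q\<close> has \<open>k\<close> in \<open>Q\<close>, which adds up to
  \<open>k * (r - k) * t\<close>. The exceptions in \<open>Z\<close> cost at most 1.\<close>

lemma in_closed_size:
  assumes "in_closed Q"
  shows "\<not> (4 \<le> 2 + card L + card Q \<and> 2 + card L + card Q + 4 \<le> r)" "\<not> (4 \<le> card Q \<and> card Q + 4 \<le> r)"
proof -
  have QJ: "Q \<subseteq> J" and finQ: "finite Q" using assms finite_subset[of Q J] by (auto simp: in_closed_def)
  have cJQ: "card (J - Q) = r - (2 + card L + card Q)"
    using QJ finQ cardJ by (simp add: card_Diff_subset)
  have cQJ: "card Q \<le> card J" using QJ by (intro card_mono) auto
  have hitQ: "card Q \<le> card (nb (clU c Q) v)" if "v \<in> clU c (J - Q)" for v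
    using in_closed_hit[OF assms that] finQ by (intro card_nb_clU_ge) auto
  have JQ: "v \<in> clU c J" if "v \<in> clU c (J - Q)" for v using that by (auto simp: clU_def)
  have bq: "card (nb (base \<union> clU c Q) v) = card (nb base v) + card (nb (clU c Q) v)" for v
    by (rule card_nb_Un) (use base_disj QJ in auto)
  show "\<not> (4 \<le> 2 + card L + card Q \<and> 2 + card L + card Q + 4 \<le> r)"
  proof
    let ?k = "2 + card L + card Q" and ?Y = "clU c (J - Q)"
    assume k: "4 \<le> ?k \<and> ?k + 4 \<le> r"
    have "?k * card ?Y \<le> ecount ?Y (base \<union> clU c Q) + card L * card Z"
    proof (rule ecount_ge_exc)
      fix v assume v: "v \<in> ?Y"
      show "?k \<le> card (nb (base \<union> clU c Q) v) + card L" using bq[of v] hitQ[OF v] base_hits2[OF JQ[OF v]] by simp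
      assume "v \<notin> Z"
      then show "?k \<le> card (nb (base \<union> clU c Q) v)" using bq[of v] hitQ[OF v] base_hits[OF JQ[OF v]] by simp
    qed (use Zf in auto)
    moreover have "?k * card ?Y = ?k * (r - ?k) * t" using card_clUJ[of "J - Q"] cJQ by (metis Diff_subset mult.assoc)
    ultimately have "?k * (r - ?k) * t \<le> ecount ?Y (base \<union> clU c Q) + 1" using card_L_card_Z_le by linarith
    moreover have "?Y \<inter> (base \<union> clU c Q) = {}" using base_disj[of "J - Q"] by (auto simp: clU_def)
    ultimately show False using dens_contradiction[of ?Y "base \<union> clU c Q" ?k] k base_sub clU_sub by auto
  qed
  show "\<not> (4 \<le> card Q \<and> card Q + 4 \<le> r)"
  proof
    let ?k = "card Q" and ?Y = "clU c Q" and ?N = "clU c (J - Q)"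
    assume k: "4 \<le> ?k \<and> ?k + 4 \<le> r"
    have "(2 + card L) * card ?Y \<le> ecount ?Y base + card L * card Z"
    proof (rule ecount_ge_exc)
      fix v assume v: "v \<in> ?Y"
      then have vJ: "v \<in> clU c J" using QJ by (auto simp: clU_def)
      show "2 + card L \<le> card (nb base v) + card L" using base_hits2[OF vJ] by simp
      assume "v \<notin> Z"
      then show "2 + card L \<le> card (nb base v)" using base_hits[OF vJ] by simp
    qed (use Zf in auto)
    moreover have "?k * card ?N \<le> ecount ?N ?Y" using hitQ by (rule ecount_ge)
    moreover have "ecount ?N ?Y = ecount ?Y ?N" by (rule ecount_sym[OF clU_sub clU_sub])
    moreover have "ecount ?Y (base \<union> ?N) = ecount ?Y base + ecount ?Y ?N"
      by (rule ecount_Un2) (use base_disj[of "J - Q"] in auto)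
    ultimately have "(2 + card L) * card ?Y + ?k * card ?N \<le> ecount ?Y (base \<union> ?N) + 1"
      using card_L_card_Z_le by linarith
    moreover have "card ?Y = ?k * t" "card ?N = (r - (2 + card L + ?k)) * t"
      using card_clUJ[of "J - Q"] card_clUJ[OF QJ] cJQ by auto
    moreover have "r - ?k = 2 + card L + (r - (2 + card L + ?k))" using cQJ cardJ cardL r10 by simp
    then have "?k * (r - ?k) * t = (2 + card L) * (?k * t) + ?k * ((r - (2 + card L + ?k)) * t)"
      by (simp only: add_mult_distrib add_mult_distrib2 ac_simps)
    ultimately have "?k * (r - ?k) * t \<le> ecount ?Y (base \<union> ?N) + 1" by simp
    moreover have "?Y \<inter> (base \<union> ?N) = {}" using base_disj[OF QJ] by (auto simp: clU_def)
    ultimately show False using dens_contradiction[of ?Y "base \<union> ?N" ?k] k base_sub clU_sub by auto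
  qed
qed

definition reachset :: "nat \<Rightarrow> nat set" where
  "reachset p = {q \<in> J. (q, p) \<in> R\<^sup>*}"

lemma in_closed_reachset: "p \<in> J \<Longrightarrow> in_closed (reachset p)"
  unfolding in_closed_def reachset_def by (auto intro: converse_rtrancl_into_rtrancl)

lemma in_closed_Un: "in_closed P \<Longrightarrow> in_closed Q \<Longrightarrow> in_closed (P \<union> Q)"
  unfolding in_closed_def by blast

text \<open>Each vertex of the other \<open>r - 4\<close> classes sends two edges to
  \<open>base\<close> and one to class \<open>p\<close>, while class \<open>q\<close> sends them at
  least \<open>(r - 4) * t\<close> edges; the resulting cut has at least
  \<open>4 * (r - 4) * t\<close> edges.\<close>

lemma no_two_special:
  assumes "L = {}" "p \<in> J" "q \<in> J" "p \<noteq> q"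
    and hp: "\<And>v. v \<in> clU c (J - {p, q}) \<Longrightarrow> \<not> miss v (cl c p)"
    and hq: "\<And>v s. v \<in> cl c q \<Longrightarrow> s \<in> J - {p, q} \<Longrightarrow> \<not> miss v (cl c s)"
  shows False
proof -
  let ?Y = "clU c (J - {p, q})"
  have cJ: "card (J - {p, q}) = r - 4" using assms(1-4) cardJ by (simp add: card_Diff_subset)
  have cY: "card ?Y = (r - 4) * t" using card_clUJ[of "J - {p, q}"] cJ by auto
  have "3 * card ?Y \<le> ecount ?Y (base \<union> cl c p)"
  proof (rule ecount_ge)
    fix v assume v: "v \<in> ?Y"
    then have "v \<in> clU c J" by (auto simp: clU_def)
    then have "2 \<le> card (nb base v)" using base_hits2 by blast
    moreover have "1 \<le> card (nb (cl c p) v)" using not_missI hp[OF v] by blast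
    moreover have "card (nb (base \<union> cl c p) v) = card (nb base v) + card (nb (cl c p) v)"
      by (rule card_nb_Un) (use base_disj[of "{p}"] assms(2) in \<open>auto simp: clU_def cls_def\<close>)
    ultimately show "3 \<le> card (nb (base \<union> cl c p) v)" by simp
  qed
  moreover have "card (J - {p, q}) * card (cl c q) \<le> ecount (cl c q) ?Y"
    using hq by (intro ecount_ge card_nb_clU_ge) auto
  moreover have "card (cl c q) = t" using near_card[OF nearc, of q] assms(3) by auto
  moreover have "ecount (cl c q) ?Y = ecount ?Y (cl c q)" by (rule ecount_sym[OF cl_sub clU_sub])
  moreover have "ecount ?Y (base \<union> cl c p \<union> cl c q) = ecount ?Y (base \<union> cl c p) + ecount ?Y (cl c q)"
    by (rule ecount_Un2) (use base_disj[of "{q}"] assms(3,4) in \<open>auto simp: clU_def cls_def\<close>)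
  ultimately have "4 * (r - 4) * t \<le> ecount ?Y (base \<union> cl c p \<union> cl c q) + 1"
    using cY cJ by simp
  moreover have "?Y \<inter> (base \<union> cl c p \<union> cl c q) = {}"
    using base_disj[of "J - {p, q}"] by (auto simp: clU_def cls_def)
  ultimately show False
    using dens_contradiction[of ?Y "base \<union> cl c p \<union> cl c q" 4] base_sub clU_sub cl_sub r10 by auto
qed

text \<open>By \<open>in_closed_size\<close>, the set of classes reaching a given one is almost
  everything or a single class. If connectivity fails, one class \<open>l\<close> can be singled out
  that has about as many edges to the rest as a dominating set would have.\<close>

lemma connectivity:
  "(L = {} \<and> (\<forall>p\<in>J. \<forall>q\<in>J. (p, q) \<in> R\<^sup>*)) \<or>
   (\<exists>C l. C \<subseteq> J \<and> card C = r - 3 \<and> l < r \<and> l \<notin> {i, j} \<union> C \<and> (\<forall>p\<in>C. \<forall>q\<in>C. (p, q) \<in> R\<^sup>*) \<and>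
      (r - 3) * t \<le> ecount (cl c l) (clU c C) + 1)"
proof (cases "L = {}")
  case False
  then have cL: "card L = 1" using cardL finL by (simp add: le_Suc_eq)
  then obtain l where l: "L = {l}" using card_1_singletonE by blast
  have cJ: "card J = r - 3" using cardJ cL by simp
  have "reachset p = J" if p: "p \<in> J" for p
  proof -
    have sub: "reachset p \<subseteq> J" by (auto simp: reachset_def)
    have fI: "finite (reachset p)" using sub finite_subset by blast
    have "p \<in> reachset p" using p by (auto simp: reachset_def)
    then have "0 < card (reachset p)" using fI card_gt_0_iff by blast
    moreover have "card (reachset p) \<le> card J" using sub by (intro card_mono) auto
    ultimately have "card J \<le> card (reachset p)" using in_closed_size[OF in_closed_reachset[OF p]] cL cJ r10 by linarith
    then show ?thesis using card_seteq[OF _ sub] by auto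
  qed
  then have "\<forall>p\<in>J. \<forall>q\<in>J. (p, q) \<in> R\<^sup>*" unfolding reachset_def by blast
  moreover have "l < r" "l \<notin> {i, j} \<union> J" using l Lsub by auto
  moreover have "1 * card (clU c J) \<le> ecount (clU c J) (cl c l) + 1 * card Z"
    using dom3 J_outside l Zf not_missI by (intro ecount_ge_exc) auto
  then have "(r - 3) * t \<le> ecount (cl c l) (clU c J) + 1"
    using card_clUJ[of J] cJ Zf(2) ecount_sym[OF clU_sub cl_sub, of c J c l] by simp
  ultimately show ?thesis using cJ by blast
next
  case L: True
  have cJ: "card J = r - 2" using cardJ L by simp
  \<comment> \<open>The two cuts exclude the sizes from 2 to r - 6 and from 4 to r - 4; these ranges
    overlap since r >= 10.\<close>
  have sizes: "card Q \<le> 1 \<or> r - 3 \<le> card Q" if "in_closed Q" for Q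
    using in_closed_size[OF that] L r10 by (simp add: not_le) linarith
  show ?thesis
  proof (cases "\<forall>p\<in>J. \<forall>q\<in>J. (q, p) \<in> R\<^sup>*")
    case True then show ?thesis using L by blast
  next
    case False
    then obtain p q where pq: "p \<in> J" "q \<in> J" "(q, p) \<notin> R\<^sup>*" by blast
    have incp: "in_closed (reachset p)" using in_closed_reachset pq by blast
    have pI: "p \<in> reachset p" "q \<notin> reachset p" "reachset p \<subseteq> J" using pq by (auto simp: reachset_def)
    have fin: "finite Q" if "Q \<subseteq> J" for Q using that finite_subset by blast
    show ?thesis
    \<comment> \<open>Either \<open>p\<close> is reached by no other class, so all others dominate
      their way into it, or exactly one class \<open>q\<close> has no arc to the others. In both
      cases a second such defect would give the pair excluded by
      \<open>no_two_special\<close>.\<close>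
    proof (cases "card (reachset p) \<le> 1")
      case True
      have Ip: "reachset p = {p}"
        using card_seteq[of "reachset p" "{p}"] True pI fin by auto
      let ?C = "J - {p}"
      have hitp: "\<not> miss v (cl c p)" if "v \<in> clU c ?C" for v
        using in_closed_hit[OF incp, of v p] that Ip by simp
      have "(a, b) \<in> R\<^sup>*" if ab: "a \<in> ?C" "b \<in> ?C" for a b
      proof (rule ccontr)
        assume nab: "(a, b) \<notin> R\<^sup>*"
        let ?Q = "reachset b \<union> {p}"
        have incQ: "in_closed ?Q" using in_closed_Un[OF in_closed_reachset incp] ab Ip by auto
        have sub: "?Q \<subseteq> J - {a}" using nab ab pI by (auto simp: reachset_def)
        have fQ: "finite ?Q" using sub fin by auto
        have "{b, p} \<subseteq> ?Q" using ab by (auto simp: reachset_def)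
        then have "card {b, p} \<le> card ?Q" using card_mono[OF fQ] by blast
        then have "r - 3 \<le> card ?Q" using sizes[OF incQ] ab by auto
        then have eq: "?Q = J - {a}" using card_seteq[OF _ sub] cJ ab by auto
        show False
        proof (rule no_two_special[OF L pq(1), of a])
          show "\<not> miss v (cl c p)" if "v \<in> clU c (J - {p, a})" for v
            using hitp[of v] that by (auto simp: clU_def)
          show "\<not> miss v (cl c s)" if "v \<in> cl c a" "s \<in> J - {p, a}" for v s
          proof (rule in_closed_hit[OF incQ])
            show "v \<in> clU c (J - ?Q)" unfolding eq using that(1) ab by (auto simp: clU_def cls_def)
            show "s \<in> ?Q" unfolding eq using that(2) by blast
          qed
        qed (use ab in auto)
      qed
      moreover have "card ?C = r - 3" using cJ pq by simp
      moreover have "1 * card (clU c ?C) \<le> ecount (clU c ?C) (cl c p)"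
        using hitp not_missI by (intro ecount_ge) auto
      then have "(r - 3) * t \<le> ecount (cl c p) (clU c ?C) + 1"
        using card_clUJ[of ?C] \<open>card ?C = r - 3\<close> ecount_sym[OF clU_sub cl_sub, of c ?C c p] by auto
      ultimately show ?thesis using pq(1) by (intro disjI2 exI[of _ ?C] exI[of _ p]) auto
    next
      case False
      then have "r - 3 \<le> card (reachset p)" using sizes[OF incp] by blast
      moreover have sub: "reachset p \<subseteq> J - {q}" using pI by blast
      ultimately have Ip: "reachset p = J - {q}" using card_seteq[OF _ sub] cJ pq(2) by auto
      let ?C = "J - {q}"
      have hitq: "\<not> miss v (cl c s)" if "v \<in> cl c q" "s \<in> ?C" for v s
      proof (rule in_closed_hit[OF incp])
        show "v \<in> clU c (J - reachset p)" unfolding Ip using that(1) pq(2) by (auto simp: clU_def cls_def)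
        show "s \<in> reachset p" unfolding Ip using that(2) by blast
      qed
      have "(a, b) \<in> R\<^sup>*" if ab: "a \<in> ?C" "b \<in> ?C" for a b
      proof (rule ccontr)
        assume nab: "(a, b) \<notin> R\<^sup>*"
        have incb: "in_closed (reachset b)" using in_closed_reachset ab by blast
        have "(b, p) \<in> R\<^sup>*" using ab Ip by (auto simp: reachset_def)
        then have "q \<notin> reachset b" using pq(3) rtrancl_trans[of q b R p] by (auto simp: reachset_def)
        then have subb: "reachset b \<subseteq> J - {q, a}" using nab by (auto simp: reachset_def)
        have "card (J - {q, a}) = r - 4" using cJ pq(2) ab by (simp add: card_Diff_subset)
        then have "card (reachset b) \<le> r - 4" using card_mono[OF _ subb] by auto
        then have "card (reachset b) \<le> 1" using sizes[OF incb] r10 by linarith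
        moreover have "b \<in> reachset b" using ab by (auto simp: reachset_def)
        ultimately have Ib: "reachset b = {b}"
          using card_seteq[of "reachset b" "{b}"] fin[of "reachset b"] subb by auto
        show False
        proof (rule no_two_special[OF L, of b q])
          show "\<not> miss v (cl c b)" if "v \<in> clU c (J - {b, q})" for v
            using in_closed_hit[OF incb, of v b] that Ib by (auto simp: clU_def)
          show "\<not> miss v (cl c s)" if "v \<in> cl c q" "s \<in> J - {b, q}" for v s
            using hitq that by blast
        qed (use ab pq in auto)
      qed
      moreover have cC: "card ?C = r - 3" using cJ pq by simp
      moreover have "card ?C * card (cl c q) \<le> ecount (cl c q) (clU c ?C)"
        using hitq by (intro ecount_ge card_nb_clU_ge) auto
      moreover have "card (cl c q) = t" using near_card[OF nearc, of q] pq(2) by auto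
      ultimately show ?thesis using pq(2) by (intro disjI2 exI[of _ ?C] exI[of _ q]) auto
    qed
  qed
qed

end

text \<open>The coefficients in the next two lemmas, and in the bound \<open>3 s \<le> 14 + d\<close> used for \<open>r = 11\<close>,
  come from solving the linear program behind the final count.\<close>

lemma quad_bound_nonmov:
  fixes u n d :: int
  assumes "0 \<le> n" "n \<le> 4" "n \<le> 2 * d"
  shows "14 * (u + n) - 30 \<le> u * (u + 2 * n - 1) + 4 * (7 + d) + 2"
proof -
  \<comment> \<open>Parity: the number is odd, which gains 1 over the bare nonnegativity of its
    square.\<close>
  have "2 * u + 2 * n - 15 \<noteq> 0" by presburger
  then have "1 \<le> (2 * u + 2 * n - 15)\<^sup>2" using zero_less_power2[of "2 * u + 2 * n - 15"] by linarith
  moreover have "0 \<le> (4 - n) * (n + 1)" using assms by simp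
  ultimately show ?thesis using assms(3) by (simp add: power2_eq_square algebra_simps)
qed

lemma quad_bound_mov:
  fixes u n d :: int
  assumes "0 \<le> n" "n \<le> 6" "n \<le> 2 * d"
  shows "10 * (u + n) - 30 \<le> u * (u + 2 * n - 1) + 4 * (7 + d)"
proof -
  have "0 \<le> (2 * u + 2 * n - 11)\<^sup>2" by simp
  moreover have "0 \<le> (6 - n) * n" using assms by simp
  ultimately show ?thesis using assms by (simp add: power2_eq_square algebra_simps)
qed

section \<open>Counting edges at a dominating set\<close>

locale connected_twin = twin_state V adj r t x c i j m L Z
  for V :: "'a set" and adj r t x c i j m L Z +
  fixes C :: "nat set"
  assumes CJ: "C \<subseteq> {..<r} - ({i, j} \<union> L)"
    and Cconn: "p \<in> C \<Longrightarrow> q \<in> C \<Longrightarrow> (p, q) \<in> (arcs (V - {x}) c ({..<r} - ({i, j} \<union> L)))\<^sup>*"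
begin

abbreviation B where "B \<equiv> clU c C"

text \<open>These vertices lose their only neighbour in \<open>S1\<close> when \<open>z\<close>
  leaves, so they are the candidates for \<open>y\<close> and \<open>y'\<close> in
  \<open>rotate\<close>.\<close>

definition solo :: "'a \<Rightarrow> 'a set" where "solo z = {y \<in> B. nb S1 y = {z}}"

definition univ :: "'a \<Rightarrow> 'a set" where "univ z = {y \<in> solo z. \<forall>y'\<in>solo z. y' \<noteq> y \<longrightarrow> adj y y'}"

abbreviation degB where "degB z \<equiv> card (nb B z)"

lemma finC: "finite C"
  using CJ finite_subset by blast

lemma solo_sub: "solo z \<subseteq> nb B z"
proof
  fix y assume "y \<in> solo z"
  then have "y \<in> B" "nb S1 y = {z}" by (auto simp: solo_def)
  then have "adj y z" by (auto simp: nb_def)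
  then show "y \<in> nb B z" using \<open>y \<in> B\<close> adj_sym by (auto simp: nb_def)
qed

lemma finite_solo [simp, intro]: "finite (solo z)"
  using finite_subset[OF solo_sub] by blast

lemma finite_univ [simp, intro]: "finite (univ z)"
  by (simp add: univ_def)

lemma univ_sub: "univ z \<subseteq> solo z"
  by (auto simp: univ_def)

lemma solo_le: "card (solo z) \<le> degB z"
  by (intro card_mono finite_nb solo_sub)

lemma soloJ: "y \<in> solo z \<Longrightarrow> y \<in> clU c J \<and> c y \<in> C \<and> nb S1 y = {z}"
  using CJ by (auto simp: solo_def clU_def)

text \<open>If \<open>z\<close> can move to some class of \<open>C\<close> outright, any solo vertex
  can take its place, and by \<open>rotate\<close> two solo vertices are never nonadjacent:
  \<open>solo z\<close> is a clique.\<close>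

lemma univ_all:
  assumes "z \<in> S1" "p \<in> C" "miss z (cl c p)" shows "univ z = solo z"
proof -
  have "adj y y'" if "y \<in> solo z" "y' \<in> solo z" "y' \<noteq> y" for y y'
  proof (rule ccontr)
    assume "\<not> adj y y'"
    moreover have "nb (cl c p) z \<subseteq> {y}" using assms(3) by (simp add: miss_def)
    moreover have "(p, c y) \<in> R\<^sup>*" using Cconn assms(2) soloJ[OF that(1)] by blast
    ultimately show False
      using rotate[OF assms(1), of y y' p] soloJ[OF that(1)] soloJ[OF that(2)] that(3) assms(2) CJ by blast
  qed
  then show ?thesis by (auto simp: univ_def)
qed

text \<open>Here \<open>z\<close> can enter the class of \<open>y\<close> as soon as
  \<open>y\<close> leaves it, so \<open>rotate\<close> applies with the trivial path.\<close>

lemma unique_univ: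
  assumes "z \<in> S1" "y \<in> solo z" "nb (cl c (c y)) z = {y}" shows "y \<in> univ z"
proof -
  have "adj y y'" if "y' \<in> solo z" "y' \<noteq> y" for y'
    using rotate[OF assms(1), of y y' "c y"] soloJ[OF assms(2)] soloJ[OF that(1)] that(2) assms(3) CJ by blast
  then show ?thesis using assms(2) by (auto simp: univ_def)
qed

text \<open>By \<open>unique_univ\<close>, a solo vertex outside \<open>univ z\<close> lies in a
  class where \<open>z\<close> has n >= 2 neighbours. Then n <= 2 (n - 1), and the excesses n - 1
  over all classes of \<open>C\<close> sum to \<open>degB z - card C\<close>.\<close>

lemma hits_all_count:
  assumes z: "z \<in> S1" and hit: "\<And>p. p \<in> C \<Longrightarrow> \<not> miss z (cl c p)"
  shows "card C \<le> degB z" "card (solo z) \<le> card (univ z) + 2 * (degB z - card C)"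
proof -
  let ?n = "\<lambda>p. card (nb (cl c p) z)"
  have d: "degB z = (\<Sum>p\<in>C. ?n p)" by (rule card_nb_clU[OF finC])
  have n1: "1 \<le> ?n p" if "p \<in> C" for p using hit[OF that] not_missI by blast
  show le: "card C \<le> degB z" using card_nb_clU_ge[OF finC hit] by blast
  have "solo z - univ z \<subseteq> (\<Union>p\<in>{p\<in>C. 2 \<le> ?n p}. nb (cl c p) z)"
  proof
    fix y assume y: "y \<in> solo z - univ z"
    then have yb: "y \<in> nb B z" and yC: "c y \<in> C" using solo_sub soloJ by auto
    then have yn: "y \<in> nb (cl c (c y)) z" by (auto simp: nb_def clU_def cls_def)
    have "?n (c y) \<noteq> 1"
    proof
      assume "?n (c y) = 1"
      then have "nb (cl c (c y)) z = {y}" using yn card_1_singletonE by (metis singletonD)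
      then show False using unique_univ[OF z, of y] y by blast
    qed
    then show "y \<in> (\<Union>p\<in>{p\<in>C. 2 \<le> ?n p}. nb (cl c p) z)" using yC yn n1[OF yC] by auto
  qed
  then have "card (solo z - univ z) \<le> card (\<Union>p\<in>{p\<in>C. 2 \<le> ?n p}. nb (cl c p) z)"
    using finC by (intro card_mono) auto
  also have "\<dots> \<le> (\<Sum>p\<in>{p\<in>C. 2 \<le> ?n p}. ?n p)" using finC by (intro card_UN_le) auto
  also have "\<dots> \<le> (\<Sum>p\<in>{p\<in>C. 2 \<le> ?n p}. 2 * (?n p - 1))" by (intro sum_mono) auto
  also have "\<dots> \<le> (\<Sum>p\<in>C. 2 * (?n p - 1))" using finC by (intro sum_mono2) auto
  also have "\<dots> = 2 * (degB z - card C)"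
    using n1 sum_subtractf_nat[of C "\<lambda>_. 1" ?n] d by (simp add: sum_distrib_left[symmetric])
  finally have "card (solo z - univ z) \<le> 2 * (degB z - card C)" .
  moreover have "card (solo z) = card (univ z) + card (solo z - univ z)"
    using card_Diff_subset[OF finite_univ univ_sub] card_mono[OF finite_solo univ_sub] by simp
  ultimately show "card (solo z) \<le> card (univ z) + 2 * (degB z - card C)" by simp
qed

lemma card_univ_solo_le:
  assumes z: "z \<in> S1" and s8: "8 \<le> card (solo z)" shows "card (univ z) \<le> 4"
  unfolding univ_def
proof (rule card_universal_le)
  show "z \<in> V" using z cl_sub by blast
  show "solo z \<subseteq> V" by (auto simp: solo_def clU_def)
  show "adj z y" if "y \<in> solo z" for y using solo_sub that by (auto simp: nb_def)
qed (rule s8)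

text \<open>With \<open>u\<close> and \<open>s\<close> for the two sizes, the pairs starting in
  \<open>univ z\<close> number \<open>u (s - 1)\<close>, and those from the rest into
  \<open>univ z\<close> number \<open>u (s - u)\<close>. The additive form avoids truncated
  subtraction.\<close>

lemma edges_solo:
  "card (univ z) * (2 * card (solo z)) \<le> ecount (solo z) (solo z) + card (univ z) * (card (univ z) + 1)"
proof -
  let ?u = "card (univ z)" and ?s = "card (solo z)"
  have us: "?u \<le> ?s" by (intro card_mono finite_solo univ_sub)
  have "(?s - 1) * ?u \<le> ecount (univ z) (solo z)"
  proof (rule ecount_ge)
    fix y assume y: "y \<in> univ z"
    then have "solo z - {y} \<subseteq> nb (solo z) y" by (auto simp: univ_def nb_def)
    then have "card (solo z - {y}) \<le> card (nb (solo z) y)" by (intro card_mono) auto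
    moreover have "y \<in> solo z" using y univ_sub by blast
    ultimately show "?s - 1 \<le> card (nb (solo z) y)" by simp
  qed
  moreover have "?u * card (solo z - univ z) \<le> ecount (solo z - univ z) (solo z)"
  proof (rule ecount_ge)
    fix y assume y: "y \<in> solo z - univ z"
    have "univ z \<subseteq> nb (solo z) y"
    proof
      fix w assume w: "w \<in> univ z"
      then have "y \<in> solo z" "y \<noteq> w" using y by auto
      then have "adj w y" using w by (auto simp: univ_def)
      then show "w \<in> nb (solo z) y" using w univ_sub adj_sym by (auto simp: nb_def)
    qed
    then show "?u \<le> card (nb (solo z) y)" by (intro card_mono) auto
  qed
  moreover have "card (solo z - univ z) = ?s - ?u" by (intro card_Diff_subset univ_sub) auto
  moreover have "ecount (univ z \<union> (solo z - univ z)) (solo z) = ecount (univ z) (solo z) + ecount (solo z - univ z) (solo z)"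
    by (rule ecount_Un1) auto
  moreover have "univ z \<union> (solo z - univ z) = solo z" using univ_sub by blast
  ultimately have main: "(?s - 1) * ?u + ?u * (?s - ?u) \<le> ecount (solo z) (solo z)" by simp
  obtain n where n: "?s = ?u + n" using us le_Suc_ex by blast
  show ?thesis
  proof (cases "?u = 0")
    case False
    then obtain w where w: "?u = Suc w" using not0_implies_Suc by blast
    show ?thesis using main unfolding n w by (simp add: algebra_simps)
  qed simp
qed

lemma sum_degB: "(\<Sum>z\<in>S1. degB z) = ecount S1 B"
  by (simp add: ecount_def)

lemma B_dom: "y \<in> B \<Longrightarrow> \<not> miss y S1" "y \<in> B \<Longrightarrow> \<not> miss y S2"
proof -
  assume "y \<in> B"
  then have "y \<in> clU c J" using CJ by (auto simp: clU_def)
  then show "\<not> miss y S1" "\<not> miss y S2" using dom1 dom2 J_outside by blast+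
qed

lemma cardB: "card B = card C * t"
  by (rule card_clUJ[OF CJ])

lemma sum_solo: "2 * (card C * t) \<le> (\<Sum>z\<in>S1. card (solo z)) + ecount S1 B"
proof -
  have "(\<Sum>z\<in>S1. card (solo z)) = card (\<Union>z\<in>S1. solo z)"
    by (rule card_UN_disjoint[symmetric]) (auto simp: solo_def)
  also have "(\<Union>z\<in>S1. solo z) = {y \<in> B. card (nb S1 y) = 1}"
  proof (intro set_eqI iffI)
    fix y assume "y \<in> {y \<in> B. card (nb S1 y) = 1}"
    then obtain z where "y \<in> B" "nb S1 y = {z}" using card_1_singletonE by blast
    then show "y \<in> (\<Union>z\<in>S1. solo z)" using nb_subset[of S1 y] by (auto simp: solo_def)
  qed (auto simp: solo_def)
  \<comment> \<open>The claim now follows pointwise: a vertex of \<open>B\<close> with one neighbour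
    in \<open>S1\<close> counts once as solo and once as an edge, any other has at least two
    edges.\<close>
  also have "card \<dots> = (\<Sum>y\<in>B. if card (nb S1 y) = 1 then 1 else 0)"
    by (simp add: sum.If_cases Int_def)
  finally have e1: "(\<Sum>z\<in>S1. card (solo z)) = (\<Sum>y\<in>B. if card (nb S1 y) = 1 then 1 else 0)" .
  have "2 * (card C * t) = (\<Sum>y\<in>B. 2)" using cardB by simp
  also have "\<dots> \<le> (\<Sum>y\<in>B. (if card (nb S1 y) = 1 then 1 else 0) + card (nb S1 y))"
  proof (rule sum_mono)
    fix y assume "y \<in> B"
    then have "1 \<le> card (nb S1 y)" using not_missI B_dom by blast
    then show "2 \<le> (if card (nb S1 y) = 1 then 1 else 0) + card (nb S1 y)" by auto
  qed
  also have "\<dots> = (\<Sum>z\<in>S1. card (solo z)) + ecount B S1"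
    unfolding e1 ecount_def by (rule sum.distrib)
  also have "ecount B S1 = ecount S1 B" by (rule ecount_sym[OF clU_sub cl_sub])
  finally show ?thesis .
qed

definition movables :: "'a set" where "movables = {z \<in> S1. miss z S2}"

lemma movables_sub: "movables \<subseteq> S1"
  by (auto simp: movables_def)

lemma finite_movables [simp]: "finite movables"
  using movables_sub finite_subset by blast

text \<open>By \<open>movable\<close>, all solo vertices of movable \<open>z\<close> are neighbours
  of the single vertex \<open>m\<close>, whose degree is at most \<open>r\<close>.\<close>

lemma sum_movables: "(\<Sum>z\<in>movables. card (solo z)) \<le> r"
proof -
  have "(\<Sum>z\<in>movables. card (solo z)) = card (\<Union>z\<in>movables. solo z)"
    by (rule card_UN_disjoint[symmetric]) (auto simp: solo_def)
  also have "(\<Union>z\<in>movables. solo z) \<subseteq> nb V m"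
  proof
    fix y assume "y \<in> (\<Union>z\<in>movables. solo z)"
    then obtain z where z: "z \<in> S1" "miss z S2" and y: "y \<in> solo z" by (auto simp: movables_def)
    have "y \<in> V \<and> y \<notin> clU c ({i, j} \<union> L)" using soloJ[OF y] J_outside by blast
    then have "adj y m" using movable[OF z, of y] soloJ[OF y] by blast
    then show "y \<in> nb V m" using adj_sym \<open>y \<in> V \<and> _\<close> by (auto simp: nb_def)
  qed
  then have "card (\<Union>z\<in>movables. solo z) \<le> card (nb V m)" by (intro card_mono) auto
  also have "\<dots> \<le> r" by (rule degr)
  finally show ?thesis .
qed

lemma degB_le: "degB z \<le> r"
  using card_mono[OF finite_nb nb_mono[OF clU_sub]] degr le_trans by blast

lemma degB_nonmov:
  assumes "z \<in> S1 - movables" shows "degB z + 1 \<le> r" "1 \<le> card (nb S2 z)"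
proof -
  show 1: "1 \<le> card (nb S2 z)" using assms not_missI by (auto simp: movables_def)
  have "B \<inter> S2 = {}" using CJ by (auto simp: clU_def cls_def)
  then have "card (nb (B \<union> S2) z) = degB z + card (nb S2 z)" by (rule card_nb_Un)
  moreover have "card (nb (B \<union> S2) z) \<le> card (nb V z)"
    by (intro card_mono finite_nb nb_mono) (auto simp: clU_def cls_def)
  ultimately show "degB z + 1 \<le> r" using 1 degr[of z] by linarith
qed

text \<open>With 8 solo vertices, \<open>univ z\<close> is too small to be all of
  \<open>solo z\<close>, so \<open>univ_all\<close> shows that \<open>z\<close> has a neighbour in
  every class of \<open>C\<close>.\<close>

lemma solo_large:
  assumes z: "z \<in> S1" and s8: "8 \<le> card (solo z)"
  shows "card C \<le> degB z" "card (solo z) \<le> 4 + 2 * (degB z - card C)"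
proof -
  have u: "card (univ z) \<le> 4" by (rule card_univ_solo_le[OF assms])
  have hit: "\<not> miss z (cl c p)" if "p \<in> C" for p
    using univ_all[OF z that] u s8 by auto
  show "card C \<le> degB z" "card (solo z) \<le> 4 + 2 * (degB z - card C)" using hits_all_count[OF z hit] u by auto
qed

lemma sum_split: "(\<Sum>z\<in>S1. f z) = (\<Sum>z\<in>movables. f z) + (\<Sum>z\<in>S1 - movables. f z)" for f :: "'a \<Rightarrow> 'b::comm_monoid_add"
  by (simp add: sum.subset_diff[OF movables_sub finite_cl] add.commute)

lemma card_nonmov: "card movables + card (S1 - movables) + 1 = t"
  using card_Diff_subset[OF finite_movables movables_sub] card_mono[OF finite_cl movables_sub] cardS1 t_pos by simp

text \<open>A vertex \<open>z\<close> of \<open>S1\<close> with a neighbour in \<open>S2\<close> has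
  at most \<open>r - 1\<close> neighbours in \<open>B\<close>, one more than \<open>card C\<close>;
  so \<open>solo_large\<close> would allow only 6 solo vertices, and there are at most 7 in any
  case. The movable vertices have at most \<open>r\<close> solo vertices altogether.
  \<open>sum_solo\<close> then asks for more edges than the degrees provide.\<close>

lemma strongly_connected_absurd:
  assumes cC: "card C = r - 2" shows False
proof -
  let ?nm = "card (S1 - movables)" and ?mv = "card movables"
  have "card (solo z) \<le> 7" if z: "z \<in> S1 - movables" for z
  proof (rule ccontr)
    assume "\<not> card (solo z) \<le> 7"
    then have "8 \<le> card (solo z)" by simp
    with solo_large[of z] z have "card (solo z) \<le> 4 + 2 * (degB z - card C)" by simp
    then show False using \<open>8 \<le> _\<close> degB_nonmov(1)[OF z] cC by linarith
  qed
  then have "(\<Sum>z\<in>S1 - movables. card (solo z)) \<le> 7 * ?nm" using sum_bounded_above[of "S1 - movables" "\<lambda>z. card (solo z)" 7] by simp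
  then have s: "(\<Sum>z\<in>S1. card (solo z)) \<le> r + 7 * ?nm" using sum_split[of "\<lambda>z. card (solo z)"] sum_movables by linarith
  have "(\<Sum>z\<in>movables. degB z) \<le> r * ?mv" using sum_bounded_above[of movables degB r] degB_le by (simp add: mult.commute)
  moreover have "(\<Sum>z\<in>S1 - movables. degB z) \<le> (r - 1) * ?nm"
    using sum_bounded_above[of "S1 - movables" degB "r - 1"] degB_nonmov(1) by (fastforce simp: mult.commute)
  ultimately have d: "ecount S1 B \<le> r * ?mv + (r - 1) * ?nm"
    using sum_split[of degB] sum_degB by simp
  obtain g where g: "r = 10 + g" using r10 le_Suc_ex by blast
  have tt: "t = ?mv + ?nm + 1" using card_nonmov by simp
  have "2 * ((8 + g) * t) \<le> (r + 7 * ?nm) + (r * ?mv + (r - 1) * ?nm)"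
    using sum_solo s d unfolding cC g by simp
  then show False unfolding tt g by (simp add: algebra_simps)
qed

text \<open>\<open>S1\<close>, \<open>S2\<close> and class \<open>l\<close> each send about
  \<open>(r - 3) * t\<close> edges or more to \<open>B\<close>, which the bipartite bound tolerates
  only for r < 12. In the two remaining cases \<open>sum_solo\<close> turns upper bounds on solo
  sets into a larger lower bound for \<open>?e1\<close>, and hence for \<open>?e2\<close>. For r =
  10 the edges inside the solo sets must be counted as well, against the bound 7/2.\<close>

lemma special_class_absurd:
  assumes cC: "card C = r - 3" and l: "l < r" "l \<notin> {i, j} \<union> C"
    and el: "(r - 3) * t \<le> ecount (cl c l) B + 1" and wlog: "ecount S1 B \<le> ecount S2 B"
  shows False
proof -
  let ?e1 = "ecount S1 B" and ?e2 = "ecount S2 B" and ?e3 = "ecount (cl c l) B"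
  let ?X = "S1 \<union> S2 \<union> cl c l"
  have dXY: "?X \<inter> B = {}" using l CJ by (auto simp: clU_def cls_def)
  have d12: "S1 \<inter> S2 = {}" "(S1 \<union> S2) \<inter> cl c l = {}" using ji l by (auto simp: cls_def)
  have eX: "ecount ?X B = ?e1 + ?e2 + ?e3"
    using ecount_Un1[of "S1 \<union> S2" "cl c l" B] ecount_Un1[of S1 S2 B] d12 by simp
  have XV: "?X \<subseteq> V" using cl_sub[of c] by blast
  have "l \<noteq> i" "l \<noteq> j" using l by auto
  then have "card (cl c l) = t" using near_card[OF nearc l(1)] by simp
  then have cX: "card ?X + 2 = 3 * t"
    using d12 cardS1 cardS2 t_pos by (simp add: card_Un_disjoint)
  have cB: "card B = (r - 3) * t" using cardB cC by simp
  have rt: "(r - 3) * t + 3 * t = r * t" using r10 by (simp add: add_mult_distrib[symmetric])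
  have cXB: "card ?X + card B + 2 = r * t" using cX cB rt by linarith
  have "4 * ecount ?X B + 18 \<le> 9 * (card ?X + card B + 2)" using bip[OF XV clU_sub dXY] by simp
  then have bipX: "4 * ?e1 + 4 * ?e2 + 4 * ?e3 + 18 \<le> 9 * (r * t)"
    unfolding cXB eX by (simp only: add_mult_distrib2)
  have e1: "(r - 3) * t \<le> ?e1"
    using ecount_ge[of B 1 S1] not_missI[OF B_dom(1)] cB ecount_sym[OF clU_sub cl_sub, of c C c i] by simp
  have "r < 12"
  proof (rule ccontr)
    assume "\<not> r < 12"
    then obtain g where g: "r = 12 + g" using le_Suc_ex not_less by blast
    have "12 * P + 14 \<le> 9 * Q"
      if "4 * ?e1 + 4 * ?e2 + 4 * ?e3 + 18 \<le> 9 * Q" "P \<le> ?e1" "P \<le> ?e3 + 1" for P Q :: nat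
      using that wlog by linarith
    from this[OF bipX e1 el] have "12 * ((r - 3) * t) + 14 \<le> 9 * (r * t)" .
    then show False unfolding g by (simp add: algebra_simps)
  qed
  then consider "r = 10" | "r = 11" using r10 by linarith
  then show False
  proof cases
    case 2
    \<comment> \<open>Equality occurs for 7 solo vertices with degree 7, and for 8 with degree
      10.\<close>
    have loc: "3 * card (solo z) \<le> 14 + degB z + (if z \<in> movables then card (solo z) else 0)" if z: "z \<in> S1" for z
    proof (cases "8 \<le> card (solo z)")
      case False then show ?thesis using solo_le[of z] by simp
    next
      case True
      have "8 \<le> degB z" "card (solo z) \<le> 4 + 2 * (degB z - 8)" using solo_large[OF z True] cC 2 by auto
      then show ?thesis
      proof (cases "z \<in> movables")
        case True then show ?thesis using \<open>8 \<le> degB z\<close> \<open>card (solo z) \<le> 4 + 2 * (degB z - 8)\<close> degB_le[of z] 2 by simp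
      next
        case False
        then have "degB z \<le> 10" using degB_nonmov(1)[of z] z 2 by simp
        then show ?thesis using \<open>8 \<le> degB z\<close> \<open>card (solo z) \<le> 4 + 2 * (degB z - 8)\<close> False by simp
      qed
    qed
    have "(\<Sum>z\<in>S1. 3 * card (solo z)) \<le> (\<Sum>z\<in>S1. 14 + degB z + (if z \<in> movables then card (solo z) else 0))"
      using loc by (rule sum_mono)
    also have "\<dots> = 14 * (t - 1) + ?e1 + (\<Sum>z\<in>S1. if z \<in> movables then card (solo z) else 0)"
      using cardS1 sum_degB by (simp add: sum.distrib)
    also have "(\<Sum>z\<in>S1. if z \<in> movables then card (solo z) else 0) = (\<Sum>z\<in>movables. card (solo z))"
      by (rule sum.mono_neutral_cong_right) (use movables_sub in auto)
    finally have "3 * (\<Sum>z\<in>S1. card (solo z)) \<le> 14 * (t - 1) + ?e1 + 11"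
      using sum_movables 2 by (simp add: sum_distrib_left)
    moreover have "2 * (8 * t) \<le> (\<Sum>z\<in>S1. card (solo z)) + ?e1" using sum_solo cC 2 by simp
    ultimately have "34 * t + 3 \<le> 4 * ?e1" using t_pos by linarith
    moreover have "8 * ?e1 + 32 * t + 14 \<le> 99 * t" using bipX el wlog 2 by simp
    ultimately show False by linarith
  next
    case 1
    let ?E = "\<lambda>z. ecount (solo z) (solo z)"
    \<comment> \<open>The term \<open>?E z\<close> is paid by edges inside \<open>B\<close>, and the
      2 by an edge from \<open>z\<close> to \<open>S2\<close>, seen from both ends. The extra term
      for movable \<open>z\<close> is bounded in total by \<open>sum_movables\<close>.\<close>
    have loc: "14 * int (card (solo z)) - 30 \<le> int (?E z) + 4 * int (degB z) +
        (if z \<in> movables then 4 * int (card (solo z)) else 2)" if z: "z \<in> S1" for z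
    proof -
      define s u d where "s = int (card (solo z))" and "u = int (card (univ z))" and "d = int (degB z)"
      have us: "0 \<le> u" "u \<le> s" "s \<le> d"
        unfolding s_def u_def d_def using card_mono[OF finite_solo univ_sub] solo_le by auto
      have "int (card (univ z) * (2 * card (solo z))) \<le> int (ecount (solo z) (solo z) + card (univ z) * (card (univ z) + 1))"
        using edges_solo[of z] by (simp only: of_nat_le_iff)
      then have E: "u * (2 * s) \<le> int (?E z) + u * (u + 1)"
        unfolding s_def u_def by (simp add: algebra_simps)
      then have E': "u * (u + 2 * (s - u) - 1) \<le> int (?E z)" by (simp add: algebra_simps)
      have main: "14 * s - 30 \<le> int (?E z) + 4 * d + (if z \<in> movables then 4 * s else 2)"
      proof (cases "\<exists>p\<in>C. miss z (cl c p)")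
        case True
        then have "u = s" unfolding u_def s_def using univ_all[OF z] by auto
        then have "s * s - s \<le> int (?E z)" using E' by (simp add: algebra_simps)
        moreover have "0 \<le> (2 * s - 11)\<^sup>2" by simp
        then have "14 * s - 30 \<le> s * s - s + 4 * s + 2" by (simp add: power2_eq_square algebra_simps)
        moreover have "10 * s - 30 \<le> s * s - s + 4 * s"
        proof -
          have "0 \<le> (2 * s - 7)\<^sup>2" by simp
          then show ?thesis by (simp add: power2_eq_square algebra_simps)
        qed
        ultimately show ?thesis using us by (cases "z \<in> movables") auto
      next
        case False
        then have hit: "\<And>p. p \<in> C \<Longrightarrow> \<not> miss z (cl c p)" by blast
        have hc: "7 \<le> degB z" "card (solo z) \<le> card (univ z) + 2 * (degB z - 7)"
          using hits_all_count[OF z hit] cC 1 by auto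
        obtain k where k: "degB z = 7 + k" using hc(1) le_Suc_ex by blast
        have d7: "7 \<le> d" "s - u \<le> 2 * (d - 7)" using hc(2) unfolding d_def s_def u_def k by simp_all
        show ?thesis
        proof (cases "z \<in> movables")
          case True
          have "d \<le> 10" using degB_le[of z] 1 unfolding d_def by simp
          then have "10 * (u + (s - u)) - 30 \<le> u * (u + 2 * (s - u) - 1) + 4 * (7 + (d - 7))"
            using us d7 by (intro quad_bound_mov) auto
          then show ?thesis using True E' by simp
        next
          case False
          have "d \<le> 9" using degB_nonmov(1)[of z] z False 1 unfolding d_def by simp
          then have "14 * (u + (s - u)) - 30 \<le> u * (u + 2 * (s - u) - 1) + 4 * (7 + (d - 7)) + 2"
            using us d7 by (intro quad_bound_nonmov) auto
          then show ?thesis using False E' by simp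
        qed
      qed
      then show ?thesis unfolding s_def d_def .
    qed
    define ss EE mm nm where "ss = (\<Sum>z\<in>S1. card (solo z))" and "EE = (\<Sum>z\<in>S1. ?E z)"
      and "mm = (\<Sum>z\<in>movables. card (solo z))" and "nm = card (S1 - movables)"
    have "(\<Sum>z\<in>S1. 14 * int (card (solo z)) - 30) \<le> (\<Sum>z\<in>S1. int (?E z) + 4 * int (degB z) +
        (if z \<in> movables then 4 * int (card (solo z)) else 2))"
      using loc by (rule sum_mono)
    also have "\<dots> = int EE + 4 * int ?e1 + (\<Sum>z\<in>S1. if z \<in> movables then 4 * int (card (solo z)) else 2)"
      using sum_degB by (simp add: sum.distrib EE_def sum_distrib_left[symmetric] flip: of_nat_sum)
    also have "(\<Sum>z\<in>S1. if z \<in> movables then 4 * int (card (solo z)) else 2) = 4 * int mm + 2 * int nm"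
      unfolding sum_split[of "\<lambda>z. if z \<in> movables then 4 * int (card (solo z)) else 2"]
      by (simp add: mm_def nm_def sum_distrib_left)
    also have "(\<Sum>z\<in>S1. 14 * int (card (solo z)) - 30) = 14 * int ss - 30 * int (t - 1)"
      using cardS1 by (simp add: sum_subtractf ss_def sum_distrib_left)
    finally have I1: "14 * int ss - 30 * int (t - 1) \<le> int EE + 4 * int ?e1 + (4 * int mm + 2 * int nm)" .
    have mm: "mm \<le> 10" using sum_movables 1 by (simp add: mm_def)
    have I2: "14 * t \<le> ss + ?e1" using sum_solo cC 1 by (simp add: ss_def)
    have nm: "nm \<le> ecount S1 S2"
    proof -
      have "1 * card (S1 - movables) \<le> ecount (S1 - movables) S2" using degB_nonmov(2) by (intro ecount_ge) auto
      also have "\<dots> \<le> ecount S1 S2" by (rule ecount_mono) auto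
      finally show ?thesis by (simp add: nm_def)
    qed
    have EEB: "EE \<le> ecount B B"
    proof -
      have "EE \<le> (\<Sum>z\<in>S1. ecount (solo z) B)"
        unfolding EE_def by (intro sum_mono ecount_mono) (auto simp: solo_def)
      also have "\<dots> = ecount (\<Union>z\<in>S1. solo z) B"
        unfolding ecount_def by (rule sum.UNION_disjoint[symmetric]) (auto simp: solo_def)
      also have "\<dots> \<le> ecount B B" by (rule ecount_mono) (auto simp: solo_def)
      finally show ?thesis .
    qed
    have finX: "finite ?X" by simp
    have "ecount (?X \<union> B) (?X \<union> B) = ecount ?X ?X + ecount ?X B + ecount B ?X + ecount B B"
      using ecount_Un1[OF finX finite_clU dXY, of "?X \<union> B"] ecount_Un2[OF dXY] by simp
    moreover have "ecount B ?X = ecount ?X B" by (rule ecount_sym[OF clU_sub XV])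
    moreover have "ecount (?X \<union> B) (?X \<union> B) \<le> 7 * card (?X \<union> B)"
      using dens XV clU_sub by simp
    moreover have "card (?X \<union> B) + 2 = 10 * t"
      using card_Un_disjoint[OF finX finite_clU dXY] cXB 1 by simp
    moreover have "2 * ecount S1 S2 \<le> ecount ?X ?X"
    proof -
      have "ecount S1 S2 + ecount S2 S1 \<le> ecount S1 ?X + ecount S2 ?X"
        by (intro add_mono ecount_mono) auto
      also have "\<dots> = ecount (S1 \<union> S2) ?X" using ecount_Un1[of S1 S2 ?X] d12 by simp
      also have "\<dots> \<le> ecount ?X ?X" by (rule ecount_mono) auto
      finally have "ecount S1 S2 + ecount S2 S1 \<le> ecount ?X ?X" .
      moreover have "ecount S2 S1 = ecount S1 S2" by (rule ecount_sym) (auto simp: cls_def)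
      ultimately show ?thesis by simp
    qed
    \<comment> \<open>This is the density bound for \<open>?X \<union> B\<close>, which has
      \<open>10 * t - 2\<close> vertices; the doubled terms count an edge from both sides.\<close>
    ultimately have I3: "2 * nm + 2 * ?e1 + 2 * ?e2 + 2 * ?e3 + EE + 14 \<le> 70 * t" using eX nm EEB by linarith
    have I4: "8 * ?e1 + 28 * t + 14 \<le> 90 * t" "7 * t \<le> ?e3 + 1" using bipX el wlog 1 by auto
    show False using I1 I2 I3 I4 mm wlog t_pos by linarith
  qed
qed

end

section \<open>Excluding twins and openings\<close>

context low_defect
begin

lemma no_twin_aux:
  assumes T: "twin c i j m L Z" and no: "\<And>c' i' j' m' l Z'. L = {} \<Longrightarrow> \<not> twin c' i' j' m' {l} Z'"
  shows False
proof -
  interpret A: twin_state V adj r t x c i j m L Z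
    by unfold_locales (fact T, erule no)
  from A.connectivity show False
  proof
    assume a: "L = {} \<and> (\<forall>p\<in>A.J. \<forall>q\<in>A.J. (p, q) \<in> A.R\<^sup>*)"
    interpret A2: connected_twin V adj r t x c i j m L Z A.J
      by unfold_locales (use a in blast)+
    show False using A2.strongly_connected_absurd A.cardJ a by simp
  next
    assume "\<exists>C l. C \<subseteq> A.J \<and> card C = r - 3 \<and> l < r \<and> l \<notin> {i, j} \<union> C \<and> (\<forall>p\<in>C. \<forall>q\<in>C. (p, q) \<in> A.R\<^sup>*) \<and>
      (r - 3) * t \<le> ecount (cl c l) (clU c C) + 1"
    then obtain C l where C: "C \<subseteq> A.J" "card C = r - 3" "l < r" "l \<notin> {i, j} \<union> C"
      "\<And>p q. p \<in> C \<Longrightarrow> q \<in> C \<Longrightarrow> (p, q) \<in> A.R\<^sup>*" "(r - 3) * t \<le> ecount (cl c l) (clU c C) + 1" by blast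
    interpret A2: connected_twin V adj r t x c i j m L Z C
      by unfold_locales (fact C(1), rule C(5))
    show False
    proof (cases "ecount A.S1 A2.B \<le> ecount A.S2 A2.B")
      case True then show False using A2.special_class_absurd[OF C(2-4,6)] by blast
    next
      case False
      \<comment> \<open>The set with fewer edges to \<open>B\<close> is \<open>S2\<close>, so the
        twin is replaced by its mirror image, which leaves \<open>C\<close>, \<open>l\<close> and
        their arcs unchanged.\<close>
      let ?c = "c(m := i)"
      note sh = near_shift[OF A.nearc A.mj A.ji A.mi]
      have JJ: "{..<r} - ({j, i} \<union> L) = A.J" by auto
      have same: "cl ?c k = cl c k" if "k \<in> A.J" for k using sh(4) that by auto
      have "arcs (V - {x}) ?c ({..<r} - ({j, i} \<union> L)) = A.R"
        unfolding JJ unfolding arcs_def using same by auto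
      then have CR: "(p, q) \<in> (arcs (V - {x}) ?c ({..<r} - ({j, i} \<union> L)))\<^sup>*" if "p \<in> C" "q \<in> C" for p q
        using C(5)[OF that] by simp
      have CJ': "C \<subseteq> {..<r} - ({j, i} \<union> L)" using C(1) JJ by simp
      interpret M: connected_twin V adj r t x ?c j i m L Z C
        by unfold_locales (fact A.mirror, erule no, fact CJ', rule CR)
      have mB: "clU ?c C = clU c C" unfolding clU_UN using same C(1) by auto
      have "m \<notin> cl c i" using A.mj A.ji by (auto simp: cls_def)
      then have ms: "cl ?c i - {m} = cl c i" using sh(2) by simp
      have "cl ?c l = cl c l" using sh(4) C(4) by auto
      then show False
        using M.special_class_absurd[of l] C(2-4,6) False unfolding mB ms sh(3) by auto
    qed
  qed
qed

theorem no_twin: "\<not> twin c i j m L Z"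
proof
  assume T: "twin c i j m L Z"
  \<comment> \<open>Twins with a third dominating class are excluded first: for them the second
    premise of \<open>no_twin_aux\<close> is vacuous.\<close>
  have "\<not> twin c' i' j' m' {l} Z'" for c' i' j' m' l Z'
    using no_twin_aux[of c' i' j' m' "{l}" Z'] by blast
  then show False using no_twin_aux[OF T] by blast
qed

theorem no_opening:
  assumes "near c i" "m \<in> cl c j" "miss m (cl c i)" "j \<noteq> i"
  shows False
  using opening_twin[OF assms] no_twin by blast

end

context fgraph
begin

text \<open>A connected set has at least \<open>card T - 1\<close> edges: grow a subset from one
  vertex, gaining an edge with each new vertex. Connectedness is expressed by edges leaving every
  proper nonempty subset.\<close>

lemma spanning_count:
  assumes "finite T" "T \<noteq> {}"
    and connectivity: "\<And>P. P \<subset> T \<Longrightarrow> P \<noteq> {} \<Longrightarrow> \<exists>u\<in>P. \<exists>v\<in>T - P. adj u v"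
  shows "2 * card T \<le> ecount T T + 2"
proof -
  have "\<exists>P\<subseteq>T. card P = Suc k \<and> 2 * k \<le> ecount P P" if "Suc k \<le> card T" for k
    using that
  proof (induction k)
    case 0
    obtain v where "v \<in> T" using assms(2) by blast
    then show ?case by (intro exI[of _ "{v}"]) auto
  next
    case (Suc k)
    then obtain P where P: "P \<subseteq> T" "card P = Suc k" "2 * k \<le> ecount P P" by auto
    have finP: "finite P" using P(1) assms(1) finite_subset by blast
    have "P \<noteq> T" "P \<noteq> {}" using P Suc.prems by auto
    then obtain u v where univ: "u \<in> P" "v \<in> T - P" "adj u v" using connectivity[of P] P(1) by blast
    have dj: "P \<inter> {v} = {}" using univ by blast
    have "ecount (P \<union> {v}) (P \<union> {v}) = ecount P P + ecount P {v} + ecount {v} P + ecount {v} {v}"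
      using ecount_Un1[OF finP _ dj, of "P \<union> {v}"] ecount_Un2[OF dj] by simp
    moreover have "1 \<le> ecount {v} P"
    proof -
      have "u \<in> nb P v" using univ adj_sym by (auto simp: nb_def)
      then show ?thesis using card_gt_0_iff[of "nb P v"] by (auto simp: ecount_def Suc_le_eq)
    qed
    moreover have "1 \<le> ecount P {v}"
    proof -
      have "v \<in> nb {v} u" using univ by (auto simp: nb_def)
      then have "1 \<le> card (nb {v} u)" using card_gt_0_iff[of "nb {v} u"] by (auto simp: Suc_le_eq)
      also have "\<dots> \<le> ecount P {v}" unfolding ecount_def using univ(1) finP by (intro member_le_sum) auto
      finally show ?thesis .
    qed
    ultimately have "2 * Suc k \<le> ecount (insert v P) (insert v P)" using P(3) by simp
    moreover have "card (insert v P) = Suc (Suc k)" using P(2) univ finP by simp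
    moreover have "insert v P \<subseteq> T" using P(1) univ by blast
    ultimately show ?case by blast
  qed
  from this[of "card T - 1"] obtain P where P: "P \<subseteq> T" "card P = card T" "2 * (card T - 1) \<le> ecount P P"
    using assms(1,2) by (auto simp: card_gt_0_iff Suc_diff_1)
  then have "P = T" using card_subset_eq[OF assms(1)] by blast
  then show ?thesis using P by simp
qed

end

section \<open>A small class that dominates everything\<close>

locale dominating_state = low_defect V adj r t x for V :: "'a set" and adj r t x +
  fixes c :: "'a \<Rightarrow> nat" and i :: nat
  assumes nearc: "near c i"
begin

abbreviation W where "W \<equiv> cl c i"
abbreviation Jc where "Jc \<equiv> {..<r} - {i}"

text \<open>A coloured vertex without neighbours in the small class would be an opening. Stated for
  every nearly equitable colouring, so that it can be applied after an exchange.\<close>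

lemma dominated:
  assumes "near c' i'" "v \<in> V" "v \<notin> cl c' i'" shows "\<not> miss v (cl c' i')"
proof (cases "v = x")
  case True
  then show ?thesis using x_hits[OF assms(1) reaching_self[OF near_lt[OF assms(1)], of "{}"]] by simp
next
  case False
  then have "v \<in> cl c' (c' v)" "c' v \<noteq> i'" using assms by (auto simp: cls_def)
  then show ?thesis using no_opening[OF assms(1)] by blast
qed

lemma cardW: "card W = t - 1"
  using near_card[OF nearc near_lt[OF nearc]] by simp

lemma indep: "u \<in> cl c k \<Longrightarrow> v \<in> cl c k \<Longrightarrow> \<not> adj u v"
  using proper_miss[OF near_proper[OF nearc]] by (auto simp: miss_iff)

definition solo :: "'a \<Rightarrow> 'a set" where "solo w = {y \<in> V - W. nb W y = {w}}"

definition univ :: "'a \<Rightarrow> 'a set" where "univ w = {y \<in> solo w. \<forall>y'\<in>solo w. y' \<noteq> y \<longrightarrow> adj y y'}"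

text \<open>Exchanging \<open>w\<close> and \<open>y\<close> gives another colouring with small
  class \<open>i\<close>. A solo vertex of \<open>w\<close> not adjacent to \<open>y\<close> would
  then have no neighbour in it, against \<open>dominated\<close>.\<close>

lemma unique_univ:
  assumes w: "w \<in> W" and y: "y \<in> solo w" "y \<noteq> x" "nb (cl c (c y)) w = {y}"
  shows "y \<in> univ w"
proof -
  have yV: "y \<in> V - {x}" "c y \<noteq> i" "nb W y = {w}" using y by (auto simp: solo_def cls_def)
  have yq: "y \<in> cl c (c y)" using yV by (auto simp: cls_def)
  have wV: "w \<in> V - {x}" "c w = i" using w by (auto simp: cls_def)
  have "adj y y'" if y': "y' \<in> solo w" "y' \<noteq> y" for y'
  proof (rule ccontr)
    assume nadj: "\<not> adj y y'"
    let ?c = "c(w := c y, y := i)"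
    have wy: "w \<noteq> y" using yV wV by auto
    have ci: "cl ?c i = insert y (W - {w})" using yV wV wy by (auto simp: cls_def)
    have cq: "cl ?c (c y) = insert w (cl c (c y) - {y})" using yV wV wy by (auto simp: cls_def)
    have ck: "cl ?c k = cl c k" if "k \<noteq> i" "k \<noteq> c y" for k using that yV wV by (auto simp: cls_def)
    have "proper (V - {x}) ?c"
    proof (rule properI_cls)
      fix k u v assume univ: "u \<in> cl ?c k" "v \<in> cl ?c k"
      consider "k = i" | "k = c y" | "k \<noteq> i" "k \<noteq> c y" by blast
      then show "\<not> adj u v"
      proof cases
        case 1
        have "\<not> adj y a \<and> \<not> adj a y" if "a \<in> W - {w}" for a
        proof -
          have "\<not> adj y a" using yV(3) that by (auto simp: nb_def)
          then show ?thesis using adj_sym by blast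
        qed
        moreover have "u \<in> insert y (W - {w})" "v \<in> insert y (W - {w})" using univ unfolding 1 ci .
        ultimately show ?thesis using indep[of u i v] adj_irrefl by blast
      next
        case 2
        have "\<not> adj w a \<and> \<not> adj a w" if "a \<in> cl c (c y) - {y}" for a
        proof -
          have "\<not> adj w a" using y(3) that by (auto simp: nb_def)
          then show ?thesis using adj_sym by blast
        qed
        moreover have "u \<in> insert w (cl c (c y) - {y})" "v \<in> insert w (cl c (c y) - {y})"
          using univ unfolding 2 cq .
        ultimately show ?thesis using indep[of u "c y" v] adj_irrefl by blast
      next
        case 3
        then show ?thesis using univ indep[of u k v] unfolding ck[OF 3] by blast
      qed
    qed
    moreover have "card (cl ?c k) = card (cl c k)" for k
    proof -
      consider "k = i" | "k = c y" | "k \<noteq> i" "k \<noteq> c y" by blast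
      then show ?thesis
      proof cases
        case 1
        have "y \<notin> W" using yV by (auto simp: cls_def)
        then show ?thesis using 1 ci card_Suc_Diff1[OF finite_cl w] by simp
      next
        case 2
        have "w \<notin> cl c (c y)" using wV yV by (auto simp: cls_def)
        then show ?thesis using 2 cq card_Suc_Diff1[OF finite_cl yq] by simp
      next
        case 3 then show ?thesis using ck by simp
      qed
    qed
    moreover have "c y < r" using near_color[OF nearc] yV by auto
    ultimately have near': "near ?c i" using nearc unfolding near_def by auto
    have y'V: "y' \<in> V" "y' \<notin> W" "nb W y' = {w}" using y' by (auto simp: solo_def)
    have "y' \<notin> cl ?c i" using ci y'V y'(2) by blast
    moreover have "miss y' (cl ?c i)"
      unfolding ci using y'V(3) nadj adj_sym by (auto simp: miss_iff nb_def)
    ultimately show False using dominated[OF near' y'V(1)] by blast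
  qed
  then show ?thesis using y(1) by (auto simp: univ_def)
qed

text \<open>These sets are the unions of connected components of the graph induced by
  \<open>W\<close> and class \<open>q\<close>; on them the two colours can be swapped.\<close>

definition closedY :: "nat \<Rightarrow> 'a set \<Rightarrow> bool" where
  "closedY q S \<longleftrightarrow> S \<subseteq> W \<union> cl c q \<and> (\<forall>u\<in>S. \<forall>v\<in>W \<union> cl c q. adj u v \<longrightarrow> v \<in> S)"

lemma closedY_other: "closedY q S \<Longrightarrow> u \<in> S \<Longrightarrow> v \<in> W \<union> cl c q \<Longrightarrow> v \<notin> S \<Longrightarrow> \<not> adj u v \<and> \<not> adj v u"
  unfolding closedY_def using adj_sym by blast

text \<open>With surplus one, swapping the colours on \<open>S\<close> makes \<open>q\<close> the
  small class. It consists of old members of class \<open>q\<close> and of \<open>W\<close>, to none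
  of which \<open>w0\<close> is adjacent; as \<open>w0\<close> keeps colour \<open>i\<close>, this
  contradicts \<open>dominated\<close>.\<close>

lemma flip:
  assumes q: "q < r" "q \<noteq> i" and S: "closedY q S" "card (S \<inter> cl c q) = card (S \<inter> W) + 1"
    and w0: "w0 \<in> W" "miss w0 (cl c q)" "w0 \<notin> S"
  shows False
proof -
  let ?Y = "cl c q"
  let ?c = "\<lambda>v. if v \<in> S then (if v \<in> W then q else i) else c v"
  have SW: "S \<subseteq> W \<union> ?Y" using S by (auto simp: closedY_def)
  have dj: "W \<inter> ?Y = {}" using q by (intro cl_disj) auto
  have SV: "S \<subseteq> V - {x}" using SW by (auto simp: cls_def)
  have ci: "cl ?c i = (W - S) \<union> (S \<inter> ?Y)"
    using SW SV q by (auto simp: cls_def)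
  have cq: "cl ?c q = (?Y - S) \<union> (S \<inter> W)"
    using SW SV q by (auto simp: cls_def)
  have ck: "cl ?c k = cl c k" if "k \<noteq> i" "k \<noteq> q" for k
    using SW SV that by (auto simp: cls_def)
  have mix: "\<not> adj u v \<and> \<not> adj v u" if "u \<in> S" "v \<in> (W \<union> ?Y) - S" for u v
    using closedY_other[OF S(1)] that by blast
  have "proper (V - {x}) ?c"
  proof (rule properI_cls)
    fix k u v assume univ: "u \<in> cl ?c k" "v \<in> cl ?c k"
    consider "k = i" | "k = q" | "k \<noteq> i" "k \<noteq> q" by blast
    then show "\<not> adj u v"
    proof cases
      case 1
      then have "u \<in> (W - S) \<union> (S \<inter> ?Y)" "v \<in> (W - S) \<union> (S \<inter> ?Y)" using univ ci by auto
      then show ?thesis using indep mix by blast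
    next
      case 2
      then have "u \<in> (?Y - S) \<union> (S \<inter> W)" "v \<in> (?Y - S) \<union> (S \<inter> W)" using univ cq by auto
      then show ?thesis using indep mix by blast
    next
      case 3 then show ?thesis using univ ck[OF 3] indep by blast
    qed
  qed
  moreover have "\<forall>v\<in>V - {x}. ?c v < r" using nearc q near_lt[OF nearc] by (auto simp: near_def)
  moreover have cardY: "card ?Y = t" using near_card[OF nearc q(1)] q by simp
  have cWS: "card (W - S) + card (S \<inter> W) = t - 1"
    using card_Diff_subset_Int[of W S] card_mono[OF finite_cl, of "W \<inter> S" c i] cardW by (simp add: Int_commute)
  have cYS: "card (?Y - S) + card (S \<inter> ?Y) = t"
    using card_Diff_subset_Int[of ?Y S] card_mono[OF finite_cl, of "?Y \<inter> S" c q] cardY by (simp add: Int_commute)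
  have c1: "card (cl ?c i) = t"
    unfolding ci using cWS S(2) dj t_pos by (subst card_Un_disjoint) auto
  have c2: "card (cl ?c q) = t - 1"
    unfolding cq using cYS S(2) dj by (subst card_Un_disjoint) auto
  have "card (cl ?c k) = (if k = q then t - 1 else t)" if "k < r" for k
  proof -
    consider "k = i" | "k = q" | "k \<noteq> i" "k \<noteq> q" by blast
    then show ?thesis
    proof cases
      case 3 then show ?thesis using ck[OF 3] near_card[OF nearc that] by simp
    qed (use c1 c2 q in auto)
  qed
  ultimately have near': "near ?c q" using q unfolding near_def by blast
  have "w0 \<notin> cl ?c q" unfolding cq using w0 dj by blast
  moreover have "miss w0 (cl ?c q)" unfolding cq using w0 indep[of w0 i] by (auto simp: miss_iff)
  moreover have "w0 \<in> V" using w0(1) by (auto simp: cls_def)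
  ultimately show False using dominated[OF near'] by blast
qed

text \<open>A minimal closed set with more vertices in the other class than in \<open>W\<close> is connected. If its surplus
  were at most \<open>card I\<close>, exchanging it together with some vertices of \<open>I\<close> would leave a vertex of \<open>I\<close>
  without neighbours in the new small class.\<close>

lemma component:
  assumes q: "q < r" "q \<noteq> i" and I: "I = {w \<in> W. miss w (cl c q)}" "I \<noteq> {}"
  shows "\<exists>T. closedY q T \<and> T \<inter> I = {} \<and> card (T \<inter> W) + card I + 1 \<le> card (T \<inter> cl c q) \<and>
    card (T \<inter> W) + card (T \<inter> cl c q) \<le> ecount (T \<inter> W) (T \<inter> cl c q) + 1"
proof -
  let ?Y = "cl c q"
  have dj: "W \<inter> ?Y = {}" using q by (intro cl_disj) auto
  have cardY: "card ?Y = t" using near_card[OF nearc q(1)] q by simp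
  have IW: "I \<subseteq> W" and finI: "finite I" using I(1) finite_subset[of I W] by auto
  have nI: "\<not> adj a b \<and> \<not> adj b a" if "a \<in> I" "b \<in> W \<union> ?Y" for a b
    using that I(1) indep[of a i b] indep[of b i a] adj_sym by (auto simp: miss_iff)
  define G where "G T \<longleftrightarrow> closedY q T \<and> T \<inter> I = {} \<and> card (T \<inter> W) < card (T \<inter> ?Y)" for T
  have "G ((W - I) \<union> ?Y)"
  proof -
    have "((W - I) \<union> ?Y) \<inter> W = W - I" "((W - I) \<union> ?Y) \<inter> ?Y = ?Y" using dj by auto
    moreover have "card (W - I) \<le> t - 1" using card_mono[of W "W - I"] cardW by auto
    ultimately show ?thesis unfolding G_def closedY_def using nI IW dj cardY t_pos by auto
  qed
  from ex_has_least_nat[of G, OF this, of card] obtain T where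
    T: "G T" and Tmin: "\<And>T'. G T' \<Longrightarrow> card T \<le> card T'" by blast
  have cT: "closedY q T" "T \<inter> I = {}" "card (T \<inter> W) < card (T \<inter> ?Y)" using T by (auto simp: G_def)
  have TWY: "T \<subseteq> W \<union> ?Y" using cT by (auto simp: closedY_def)
  have finT: "finite T" using TWY finite_subset by blast
  have Teq: "T = (T \<inter> W) \<union> (T \<inter> ?Y)" using TWY by blast
  have big: "card (T \<inter> W) + card I + 1 \<le> card (T \<inter> ?Y)"
  proof (rule ccontr)
    assume "\<not> ?thesis"
    then have le: "card (T \<inter> ?Y) - card (T \<inter> W) - 1 < card I" using cT(3) by linarith
    \<comment> \<open>Adding isolated vertices from \<open>I\<close> lowers the surplus to exactly
      one, as \<open>flip\<close> requires. Fewer than \<open>card I\<close> are needed, so some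
      \<open>w0\<close> stays behind.\<close>
    then obtain I' where I': "I' \<subseteq> I" "card I' = card (T \<inter> ?Y) - card (T \<inter> W) - 1"
      using obtain_subset_with_card_n[of "card (T \<inter> ?Y) - card (T \<inter> W) - 1" I] by auto
    obtain w0 where w0: "w0 \<in> I - I'" using I' le finI by (metis Diff_eq_empty_iff all_not_in_conv card_mono finite_subset not_less)
    have cl: "closedY q (T \<union> I')"
      using cT(1) nI I'(1) IW unfolding closedY_def by blast
    have "(T \<union> I') \<inter> ?Y = T \<inter> ?Y" using I'(1) IW dj by blast
    moreover have "(T \<union> I') \<inter> W = (T \<inter> W) \<union> I'" using I'(1) IW by blast
    moreover have "card ((T \<inter> W) \<union> I') = card (T \<inter> W) + card I'"
      using I'(1) cT(2) finI finT finite_subset by (intro card_Un_disjoint) auto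
    ultimately have "card ((T \<union> I') \<inter> ?Y) = card ((T \<union> I') \<inter> W) + 1" using I'(2) cT(3) by simp
    moreover have "w0 \<in> W" "miss w0 ?Y" "w0 \<notin> T \<union> I'" using w0 I(1) cT(2) by auto
    ultimately show False using flip[OF q cl] by blast
  qed
  have "2 * card T \<le> ecount T T + 2"
  proof (rule spanning_count[OF finT])
    show "T \<noteq> {}" using cT(3) by auto
    fix P assume P: "P \<subset> T" "P \<noteq> {}"
    show "\<exists>u\<in>P. \<exists>v\<in>T - P. adj u v"
    proof (rule ccontr)
      \<comment> \<open>If no edge joins \<open>P\<close> to \<open>T - P\<close>, both parts are
        closed, and one of them still has positive surplus, against the minimality of
        \<open>T\<close>.\<close>
      assume no: "\<not> ?thesis"
      have nn: "\<not> adj u v \<and> \<not> adj v u" if "u \<in> P" "v \<in> T - P" for u v using no that adj_sym by blast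
      have cP: "closedY q P" "closedY q (T - P)"
        using cT(1) P(1) nn unfolding closedY_def by blast+
      have finP: "finite P" using P(1) finT finite_subset by blast
      have less: "card P < card T" "card (T - P) < card T"
        using psubset_card_mono[OF finT, of P] psubset_card_mono[OF finT, of "T - P"] P by blast+
      have "\<not> G P" "\<not> G (T - P)" using Tmin less not_less by blast+
      then have "card (P \<inter> ?Y) \<le> card (P \<inter> W)" "card ((T - P) \<inter> ?Y) \<le> card ((T - P) \<inter> W)"
        using cP cT(2) P(1) by (auto simp: G_def)
      moreover have "card (T \<inter> A) = card (P \<inter> A) + card ((T - P) \<inter> A)" for A
      proof -
        have "T \<inter> A = (P \<inter> A) \<union> ((T - P) \<inter> A)" using P(1) by blast
        then show ?thesis using finP finT card_Un_disjoint[of "P \<inter> A" "(T - P) \<inter> A"] by auto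
      qed
      ultimately show False using cT(3) by (metis add_mono not_less)
    qed
  qed
  moreover have "card T = card (T \<inter> W) + card (T \<inter> ?Y)"
    by (subst Teq, rule card_Un_disjoint) (use finT dj in auto)
  moreover have "ecount T T = 2 * ecount (T \<inter> W) (T \<inter> ?Y)"
  proof -
    let ?A = "T \<inter> W" and ?B = "T \<inter> ?Y"
    have d: "?A \<inter> ?B = {}" using dj by blast
    have z: "ecount ?A ?A = 0" "ecount ?B ?B = 0"
      using indep by (auto simp: ecount_def nb_def)
    have "ecount (?A \<union> ?B) (?A \<union> ?B) = ecount ?A ?A + ecount ?A ?B + ecount ?B ?A + ecount ?B ?B"
      using ecount_Un1[of ?A ?B "?A \<union> ?B"] ecount_Un2[OF d] d finT by simp
    moreover have "ecount ?B ?A = ecount ?A ?B" by (rule ecount_sym) (auto simp: cls_def)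
    ultimately show ?thesis using z Teq by simp
  qed
  ultimately show ?thesis using cT big by (intro exI[of _ T]) auto
qed

end

section \<open>Weights sent into the small class\<close>

context dominating_state
begin

definition dW :: "'a \<Rightarrow> nat" where "dW y = card (nb W y)"

definition degY :: "nat \<Rightarrow> 'a \<Rightarrow> nat" where "degY q w = card (nb (cl c q) w)"

text \<open>Every vertex outside \<open>W\<close> distributes weight 1 equally among its neighbours in \<open>W\<close>; \<open>lost q w\<close> is what
  \<open>w\<close> lacks from class \<open>q\<close> compared with its degree into that class.\<close>

definition lost :: "nat \<Rightarrow> 'a \<Rightarrow> real" where
  "lost q w = (\<Sum>y\<in>nb (cl c q) w. 1 - 1 / real (dW y))"

lemma dW_pos: "y \<in> V \<Longrightarrow> y \<notin> W \<Longrightarrow> 1 \<le> dW y"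
  unfolding dW_def using dominated[OF nearc] not_missI by blast

text \<open>Each vertex of \<open>S\<close> spends its whole weight 1 inside \<open>A\<close>,
  because all its neighbours in \<open>W\<close> lie there.\<close>

lemma sum_inverse_dW:
  assumes "A \<subseteq> W" "S \<subseteq> V - W" "\<And>y. y \<in> S \<Longrightarrow> nb A y = nb W y"
  shows "(\<Sum>w\<in>A. \<Sum>y\<in>nb S w. 1 / real (dW y)) = real (card S)"
proof -
  have fin: "finite A" "finite S" using assms finite_subset[of A W] finite_subV[of S] by auto
  have "(\<Sum>w\<in>A. \<Sum>y\<in>nb S w. 1 / real (dW y)) = (\<Sum>w\<in>A. \<Sum>y\<in>S. if adj w y then 1 / real (dW y) else 0)"
    unfolding nb_def using fin by (simp add: sum.inter_filter)
  also have "\<dots> = (\<Sum>y\<in>S. \<Sum>w\<in>A. if adj w y then 1 / real (dW y) else 0)" by (rule sum.swap)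
  also have "\<dots> = (\<Sum>y\<in>S. 1)"
  proof (rule sum.cong[OF refl])
    fix y assume y: "y \<in> S"
    have "(\<Sum>w\<in>A. if adj w y then 1 / real (dW y) else 0) = (\<Sum>w\<in>A. if adj y w then 1 / real (dW y) else 0)"
      using adj_sym by (intro sum.cong refl) meson
    also have "\<dots> = (\<Sum>w\<in>nb A y. 1 / real (dW y))"
      unfolding nb_def by (rule sum.inter_filter[OF fin(1), symmetric])
    also have "\<dots> = real (dW y) * (1 / real (dW y))" using assms(3)[OF y] by (simp add: dW_def)
    also have "\<dots> = 1" using dW_pos[of y] y assms(2) by auto
    finally show "(\<Sum>w\<in>A. if adj w y then 1 / real (dW y) else 0) = 1" .
  qed
  finally show ?thesis by simp
qed

text \<open>\<open>K\<close> is the trace on \<open>W\<close> of the set \<open>T\<close> from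
  \<open>component\<close>, or empty if no vertex of \<open>W\<close> misses the class. Inside
  \<open>T\<close> the edges exceed the transmitted weight \<open>card (T \<inter> cl c q)\<close>
  by at least \<open>card K - 1\<close>, which is the first claim. The second uses the surplus of
  \<open>T\<close> over \<open>card I\<close>; truncated subtraction makes the vertices of
  \<open>I\<close> contribute 0 to the sum.\<close>

lemma class_bound:
  assumes q: "q < r" "q \<noteq> i"
  shows "\<exists>K\<subseteq>W. real (card K) \<le> (\<Sum>w\<in>K. lost q w) + 1 \<and>
    card K + (\<Sum>w\<in>W - K. degY q w - 1) + t \<le> 1 + ecount W (cl c q)"
proof -
  let ?Y = "cl c q"
  define I where "I = {w \<in> W. miss w ?Y}"
  have dj: "W \<inter> ?Y = {}" using q by (intro cl_disj) auto
  have pos: "1 \<le> degY q w" if "w \<in> W - I" for w using that not_missI by (auto simp: I_def degY_def)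
  have zero: "degY q w = 0" if "w \<in> I" for w using that by (auto simp: I_def degY_def miss_def)
  have IW: "I \<subseteq> W" by (auto simp: I_def)
  have finI: "finite I" using IW finite_subset by blast
  have eW: "ecount W ?Y = (\<Sum>w\<in>W. degY q w)" by (simp add: ecount_def degY_def)
  have sub: "(\<Sum>w\<in>A. degY q w - 1) + card A = (\<Sum>w\<in>A. degY q w)" if "A \<subseteq> W - I" for A
  proof -
    have "(\<Sum>w\<in>A. degY q w - 1) + card A = (\<Sum>w\<in>A. (degY q w - 1) + 1)" by (simp only: sum.distrib card_eq_sum)
    also have "\<dots> = (\<Sum>w\<in>A. degY q w)" using pos that by (intro sum.cong refl) fastforce
    finally show ?thesis .
  qed
  show ?thesis
  proof (cases "I = {}")
    case True
    have "(\<Sum>w\<in>W. degY q w - 1) + card W = ecount W ?Y" using sub[of W] True eW by simp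
    then show ?thesis using cardW t_pos by (intro exI[of _ "{}"]) auto
  next
    case False
    from component[OF q I_def False] obtain T where T: "closedY q T" "T \<inter> I = {}"
      "card (T \<inter> W) + card I + 1 \<le> card (T \<inter> ?Y)"
      "card (T \<inter> W) + card (T \<inter> ?Y) \<le> ecount (T \<inter> W) (T \<inter> ?Y) + 1" by blast
    let ?K = "T \<inter> W"
    have nbK: "nb ?Y w = nb (T \<inter> ?Y) w" if "w \<in> ?K" for w
      using T(1) that by (auto simp: closedY_def nb_def)
    have eK: "ecount ?K (T \<inter> ?Y) = (\<Sum>w\<in>?K. degY q w)" using nbK by (simp add: ecount_def degY_def)
    have "(\<Sum>w\<in>?K. lost q w) = (\<Sum>w\<in>?K. real (degY q w) - (\<Sum>y\<in>nb (T \<inter> ?Y) w. 1 / real (dW y)))"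
      using nbK by (intro sum.cong refl) (simp add: lost_def sum_subtractf degY_def)
    also have "\<dots> = real (ecount ?K (T \<inter> ?Y)) - (\<Sum>w\<in>?K. \<Sum>y\<in>nb (T \<inter> ?Y) w. 1 / real (dW y))"
      by (simp add: sum_subtractf eK)
    also have "(\<Sum>w\<in>?K. \<Sum>y\<in>nb (T \<inter> ?Y) w. 1 / real (dW y)) = real (card (T \<inter> ?Y))"
    proof (rule sum_inverse_dW)
      show "T \<inter> ?Y \<subseteq> V - W" using dj by (auto simp: cls_def)
      show "nb ?K y = nb W y" if "y \<in> T \<inter> ?Y" for y
        using T(1) that by (auto simp: closedY_def nb_def)
    qed auto
    finally have l: "real (card ?K) \<le> (\<Sum>w\<in>?K. lost q w) + 1" using T(4) by linarith
    have dis: "W - ?K = (W - ?K - I) \<union> I" "(W - ?K - I) \<inter> I = {}" using T(2) IW by auto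
    have "(\<Sum>w\<in>W - ?K. degY q w - 1) = (\<Sum>w\<in>W - ?K - I. degY q w - 1) + (\<Sum>w\<in>I. degY q w - 1)"
      by (subst dis(1), rule sum.union_disjoint) (use dis(2) finI in auto)
    then have s1: "(\<Sum>w\<in>W - ?K. degY q w - 1) = (\<Sum>w\<in>W - ?K - I. degY q w - 1)" using zero by simp
    have s2: "(\<Sum>w\<in>W - ?K - I. degY q w - 1) + card (W - ?K - I) = (\<Sum>w\<in>W - ?K - I. degY q w)"
      by (rule sub) auto
    have "(\<Sum>w\<in>W - ?K. degY q w) = (\<Sum>w\<in>W - ?K - I. degY q w) + (\<Sum>w\<in>I. degY q w)"
      by (subst dis(1), rule sum.union_disjoint) (use dis(2) finI in auto)
    then have s3: "(\<Sum>w\<in>W - ?K. degY q w) = (\<Sum>w\<in>W - ?K - I. degY q w)" using zero by simp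
    have s4: "ecount W ?Y = (\<Sum>w\<in>W - ?K. degY q w) + ecount ?K (T \<inter> ?Y)"
      unfolding eK eW by (rule sum.subset_diff) auto
    have "card (W - ?K) = card (W - ?K - I) + card I"
      by (subst dis(1), rule card_Un_disjoint) (use dis(2) finI in auto)
    moreover have "card W = card (W - ?K) + card ?K"
      using card_Diff_subset_Int[of W T] card_mono[OF finite_cl, of "W \<inter> T" c i]
      by (simp add: Int_commute Diff_Int)
    ultimately have cc: "card (W - ?K - I) + card I + card ?K + 1 = t" using cardW t_pos by simp
    have "card ?K + (\<Sum>w\<in>W - ?K. degY q w - 1) + t \<le> 1 + ecount W ?Y"
      using s1 s2 s3 s4 cc T(3,4) by linarith
    with l show ?thesis by (intro exI[of _ ?K]) auto
  qed
qed

lemma nb_outside: "w \<in> W \<Longrightarrow> nb (V - W) w = nb V w"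
  using indep[of w i] by (auto simp: nb_def)

lemma VW_split: "V - W = insert x (clU c Jc)" "x \<notin> clU c Jc"
  using xV near_color[OF nearc] by (auto simp: clU_def cls_def)

lemma solo_sub: "solo w \<subseteq> nb (V - W) w"
proof
  fix y assume "y \<in> solo w"
  then have "y \<in> V - W" "nb W y = {w}" by (auto simp: solo_def)
  then have "adj y w" by (auto simp: nb_def)
  then show "y \<in> nb (V - W) w" using \<open>y \<in> V - W\<close> adj_sym by (auto simp: nb_def)
qed

lemma finite_solo [simp, intro]: "finite (solo w)"
  using finite_subset[OF solo_sub] by blast

text \<open>Let b be the sum. If the bound failed, there would be at least 8 solo vertices, hence at
  most 4 universal ones. The other solo vertices are \<open>x\<close> or lie in classes where
  \<open>w\<close> has several neighbours, at most 2 b in all. Since b <= 2, the count 1 + 4 + 2 b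
  is too small for r >= 10.\<close>

lemma solo_bound:
  assumes w: "w \<in> W" shows "card (solo w) + 3 \<le> r + (\<Sum>q\<in>Jc. degY q w - 1)"
proof (rule ccontr)
  let ?b = "\<Sum>q\<in>Jc. degY q w - 1"
  assume "\<not> ?thesis"
  then have s: "r + ?b \<le> card (solo w) + 2" by simp
  have "card (solo w) \<le> card (nb (V - W) w)" by (intro card_mono finite_nb solo_sub)
  also have "\<dots> \<le> r" using nb_outside[OF w] degr by simp
  finally have b2: "?b \<le> 2" using s by linarith
  have u4: "card (univ w) \<le> 4" unfolding univ_def
  proof (rule card_universal_le)
    show "w \<in> V" using w by (auto simp: cls_def)
    show "solo w \<subseteq> V" by (auto simp: solo_def)
    show "adj w y" if "y \<in> solo w" for y using solo_sub that by (auto simp: nb_def)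
    show "8 \<le> card (solo w)" using s r10 by linarith
  qed
  have "solo w \<subseteq> insert x (univ w \<union> (\<Union>q\<in>{q\<in>Jc. 2 \<le> degY q w}. nb (cl c q) w))"
  proof
    fix y assume y: "y \<in> solo w"
    show "y \<in> insert x (univ w \<union> (\<Union>q\<in>{q\<in>Jc. 2 \<le> degY q w}. nb (cl c q) w))"
    proof (cases "y = x \<or> y \<in> univ w")
      case False
      have "y \<in> nb (V - W) w" using y solo_sub by blast
      then have yn: "y \<in> nb (cl c (c y)) w" "c y \<in> Jc"
        using False near_color[OF nearc] by (auto simp: nb_def cls_def)
      have "degY (c y) w \<noteq> 1"
      proof
        assume "degY (c y) w = 1"
        then have "nb (cl c (c y)) w = {y}" using yn card_1_singletonE unfolding degY_def by (metis singletonD)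
        then show False using unique_univ[OF w y] False by blast
      qed
      moreover have "degY (c y) w \<noteq> 0" using yn(1) unfolding degY_def by auto
      ultimately show ?thesis using yn by auto
    qed auto
  qed
  then have "card (solo w) \<le> card (insert x (univ w \<union> (\<Union>q\<in>{q\<in>Jc. 2 \<le> degY q w}. nb (cl c q) w)))"
    by (intro card_mono) (auto simp: univ_def)
  also have "\<dots> \<le> 1 + card (univ w \<union> (\<Union>q\<in>{q\<in>Jc. 2 \<le> degY q w}. nb (cl c q) w))"
    by (simp add: card_insert_le_m1 card_insert_if univ_def)
  also have "card (univ w \<union> (\<Union>q\<in>{q\<in>Jc. 2 \<le> degY q w}. nb (cl c q) w))
      \<le> card (univ w) + card (\<Union>q\<in>{q\<in>Jc. 2 \<le> degY q w}. nb (cl c q) w)" by (rule card_Un_le)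
  also have "card (\<Union>q\<in>{q\<in>Jc. 2 \<le> degY q w}. nb (cl c q) w) \<le> (\<Sum>q\<in>{q\<in>Jc. 2 \<le> degY q w}. degY q w)"
    unfolding degY_def by (intro card_UN_le) auto
  also have "\<dots> \<le> (\<Sum>q\<in>{q\<in>Jc. 2 \<le> degY q w}. 2 * (degY q w - 1))" by (intro sum_mono) auto
  also have "\<dots> \<le> (\<Sum>q\<in>Jc. 2 * (degY q w - 1))" by (intro sum_mono2) auto
  also have "\<dots> = 2 * ?b" by (simp add: sum_distrib_left)
  finally have "card (solo w) \<le> 1 + (card (univ w) + 2 * ?b)" by simp
  then show False using s b2 u4 r10 by linarith
qed

definition share :: "'a \<Rightarrow> real" where
  "share w = (\<Sum>y\<in>nb (V - W) w. 1 / real (dW y))"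

text \<open>A neighbour sends \<open>w\<close> at most half its weight unless it is solo, in which
  case it sends all of it.\<close>

lemma share_le_solo:
  assumes w: "w \<in> W" shows "2 * share w \<le> real r + real (card (solo w))"
proof -
  have "2 * share w = (\<Sum>y\<in>nb (V - W) w. 2 / real (dW y))"
    by (simp add: share_def sum_distrib_left)
  also have "\<dots> \<le> (\<Sum>y\<in>nb (V - W) w. 1 + (if y \<in> solo w then 1 else 0))"
  proof (rule sum_mono)
    fix y assume y: "y \<in> nb (V - W) w"
    then have yV: "y \<in> V - W" "adj y w" using adj_sym by (auto simp: nb_def)
    show "2 / real (dW y) \<le> 1 + (if y \<in> solo w then 1 else 0)"
    proof (cases "dW y = 1")
      case True
      moreover have "w \<in> nb W y" using yV w by (auto simp: nb_def)
      ultimately have "nb W y = {w}" unfolding dW_def using card_1_singletonE by (metis singletonD)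
      then show ?thesis using True yV by (simp add: solo_def)
    next
      case False
      then have "2 \<le> dW y" using dW_pos[of y] yV by auto
      then have "2 / real (dW y) \<le> 1" by simp
      then show ?thesis by auto
    qed
  qed
  also have "\<dots> = real (card (nb (V - W) w)) + real (card (nb (V - W) w \<inter> solo w))"
    by (simp add: sum.distrib sum.If_cases)
  also have "nb (V - W) w \<inter> solo w = solo w" using solo_sub by blast
  finally show ?thesis using nb_outside[OF w] degr[of w] by simp
qed

lemma share_le_lost:
  assumes w: "w \<in> W" and Q: "Q \<subseteq> Jc" shows "share w \<le> real r - (\<Sum>q\<in>Q. lost q w)"
proof -
  let ?l = "\<lambda>y. 1 - 1 / real (dW y)"
  have nn: "0 \<le> ?l y" if "y \<in> nb (V - W) w" for y
  proof -
    have "1 \<le> dW y" using dW_pos[of y] that by (auto simp: nb_def)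
    then show ?thesis by simp
  qed
  have "(\<Sum>q\<in>Q. lost q w) = (\<Sum>y\<in>(\<Union>q\<in>Q. nb (cl c q) w). ?l y)"
    unfolding lost_def
  proof (rule sum.UNION_disjoint[symmetric])
    show "finite Q" using Q finite_subset by blast
    show "\<forall>q\<in>Q. \<forall>p\<in>Q. q \<noteq> p \<longrightarrow> nb (cl c q) w \<inter> nb (cl c p) w = {}"
      by (auto simp: nb_def cls_def)
  qed simp
  also have "\<dots> \<le> (\<Sum>y\<in>nb (V - W) w. ?l y)"
  proof (rule sum_mono2)
    show "(\<Union>q\<in>Q. nb (cl c q) w) \<subseteq> nb (V - W) w" using Q by (auto simp: nb_def cls_def)
  qed (use nn in auto)
  also have "\<dots> = real (card (nb (V - W) w)) - share w" by (simp add: share_def sum_subtractf)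
  finally show ?thesis using nb_outside[OF w] degr[of w] by simp
qed

text \<open>The shares sum to \<open>card (V - W) = r * t - t + 1\<close>, while the degrees of
  \<open>W\<close> bound them from above. Twice the total is bounded by
  \<open>2 * r * t - 2 * t - 1\<close>, too small by 3.\<close>

lemma contradiction: False
proof -
  have "\<forall>q\<in>Jc. \<exists>K\<subseteq>W. real (card K) \<le> (\<Sum>w\<in>K. lost q w) + 1 \<and>
    card K + (\<Sum>w\<in>W - K. degY q w - 1) + t \<le> 1 + ecount W (cl c q)"
    using class_bound by blast
  then obtain K where K: "\<And>q. q \<in> Jc \<Longrightarrow> K q \<subseteq> W"
    "\<And>q. q \<in> Jc \<Longrightarrow> real (card (K q)) \<le> (\<Sum>w\<in>K q. lost q w) + 1"
    "\<And>q. q \<in> Jc \<Longrightarrow> card (K q) + (\<Sum>w\<in>W - K q. degY q w - 1) + t \<le> 1 + ecount W (cl c q)" by metis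
  \<comment> \<open>For \<open>w\<close> in \<open>K q\<close> the charges add up to
    \<open>3 - 2 * lost q w\<close>: the 3 offsets the deficit in \<open>per\<close>, and the rest
    reflects the weight lost. By \<open>class_bound\<close>, the sum of \<open>h q\<close> over
    \<open>W\<close> is at most 2.\<close>
  define g where "g q w = (if w \<in> K q then 1 else degY q w - 1)" for q w
  define h where "h q w = (if w \<in> K q then 2 - 2 * lost q w else 0)" for q w
  have finJ: "finite Jc" by simp
  have per: "2 * share w \<le> 2 * real r - 3 + (\<Sum>q\<in>Jc. real (g q w) + h q w)" if w: "w \<in> W" for w
  proof (cases "\<exists>q\<in>Jc. w \<in> K q")
    case False
    then have "(\<Sum>q\<in>Jc. real (g q w) + h q w) = real (\<Sum>q\<in>Jc. degY q w - 1)"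
      by (simp add: g_def h_def)
    moreover have "real (card (solo w)) + 3 \<le> real r + real (\<Sum>q\<in>Jc. degY q w - 1)"
      using solo_bound[OF w] by linarith
    ultimately show ?thesis using share_le_solo[OF w] by linarith
  next
    case True
    define Q where "Q = {q \<in> Jc. w \<in> K q}"
    have QJ: "Q \<subseteq> Jc" "finite Q" and "Q \<noteq> {}" using True by (auto simp: Q_def)
    then have "1 \<le> card Q" by (simp add: card_gt_0_iff Suc_le_eq)
    have "(\<Sum>q\<in>Q. 3 - 2 * lost q w) = (\<Sum>q\<in>Q. real (g q w) + h q w)"
      by (intro sum.cong refl) (auto simp: Q_def g_def h_def)
    also have "\<dots> \<le> (\<Sum>q\<in>Jc. real (g q w) + h q w)"
      by (rule sum_mono2) (auto simp: Q_def h_def)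
    finally have "3 * real (card Q) - 2 * (\<Sum>q\<in>Q. lost q w) \<le> (\<Sum>q\<in>Jc. real (g q w) + h q w)"
      by (simp add: sum_subtractf sum_distrib_left)
    then show ?thesis using share_le_lost[OF w QJ(1)] \<open>1 \<le> card Q\<close> by linarith
  qed
  have "(\<Sum>w\<in>W. share w) = real (card (V - W))"
    unfolding share_def by (rule sum_inverse_dW) auto
  moreover have "card (V - W) = card V - card W" by (rule card_Diff_subset[OF finite_cl cl_sub])
  moreover have "t - 1 \<le> r * t" using r10 by (metis diff_le_self le_trans mult_le_mono1 mult_1 one_le_numeral order_trans)
  ultimately have tot: "(\<Sum>w\<in>W. share w) = real r * real t - real t + 1"
    using cardV cardW t_pos by (simp add: of_nat_diff)
  have "2 * (\<Sum>w\<in>W. share w) \<le> (\<Sum>w\<in>W. 2 * real r - 3 + (\<Sum>q\<in>Jc. real (g q w) + h q w))"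
    unfolding sum_distrib_left by (rule sum_mono) (rule per)
  also have "\<dots> = (2 * real r - 3) * (real t - 1) + (\<Sum>w\<in>W. \<Sum>q\<in>Jc. real (g q w) + h q w)"
    using cardW t_pos by (simp add: sum.distrib of_nat_diff)
  also have "(\<Sum>w\<in>W. \<Sum>q\<in>Jc. real (g q w) + h q w) = (\<Sum>q\<in>Jc. \<Sum>w\<in>W. real (g q w) + h q w)"
    by (rule sum.swap)
  also have "\<dots> \<le> (\<Sum>q\<in>Jc. 3 + real (ecount W (cl c q)) - real t)"
  proof (rule sum_mono)
    fix q assume q: "q \<in> Jc"
    have KW: "K q \<subseteq> W" "finite (K q)" using K(1)[OF q] finite_subset[of "K q" W] by auto
    have "(\<Sum>w\<in>W. g q w) = (\<Sum>w\<in>W - K q. g q w) + (\<Sum>w\<in>K q. g q w)"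
      by (rule sum.subset_diff[OF KW(1)]) simp
    also have "\<dots> = (\<Sum>w\<in>W - K q. degY q w - 1) + card (K q)" by (simp add: g_def)
    finally have g: "(\<Sum>w\<in>W. g q w) + t \<le> 1 + ecount W (cl c q)" using K(3)[OF q] by simp
    have "(\<Sum>w\<in>W. h q w) = (\<Sum>w\<in>K q. 2 - 2 * lost q w)"
      by (rule sum.mono_neutral_cong_right) (use KW in \<open>auto simp: h_def\<close>)
    also have "\<dots> = 2 * real (card (K q)) - 2 * (\<Sum>w\<in>K q. lost q w)"
      by (simp add: sum_subtractf sum_distrib_left)
    finally have "(\<Sum>w\<in>W. h q w) \<le> 2" using K(2)[OF q] by linarith
    moreover have "(\<Sum>w\<in>W. real (g q w)) + real t \<le> 1 + real (ecount W (cl c q))"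
      using g by (simp flip: of_nat_sum of_nat_add of_nat_Suc)
    ultimately show "(\<Sum>w\<in>W. real (g q w) + h q w) \<le> 3 + real (ecount W (cl c q)) - real t"
      by (simp add: sum.distrib)
  qed
  also have "\<dots> = 3 * (real r - 1) + real (\<Sum>q\<in>Jc. ecount W (cl c q)) - (real r - 1) * real t"
    using near_lt[OF nearc] r10 by (simp add: sum.distrib sum_subtractf of_nat_diff)
  also have "real (\<Sum>q\<in>Jc. ecount W (cl c q)) \<le> real r * (real t - 1) - 1"
  proof -
    have "(\<Sum>q\<in>Jc. ecount W (cl c q)) = ecount W (clU c Jc)"
      unfolding ecount_def card_nb_clU[OF finJ] by (rule sum.swap)
    moreover have "ecount W (V - W) = ecount W {x} + ecount W (clU c Jc)"
      unfolding VW_split(1) using ecount_Un2[of "{x}" "clU c Jc" W] VW_split(2) by simp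
    moreover have "ecount W {x} = ecount {x} W" by (rule ecount_sym) (use xV in \<open>auto simp: cls_def\<close>)
    moreover have "1 \<le> ecount {x} W" using dW_pos[OF xV] by (simp add: ecount_def dW_def cls_def)
    moreover have "ecount W (V - W) \<le> r * (t - 1)"
      unfolding ecount_def using sum_bounded_above[of W "\<lambda>v. card (nb (V - W) v)" r] nb_outside degr cardW
      by (simp add: mult.commute)
    ultimately have "(\<Sum>q\<in>Jc. ecount W (cl c q)) + 1 \<le> r * (t - 1)" by linarith
    then have "real ((\<Sum>q\<in>Jc. ecount W (cl c q)) + 1) \<le> real (r * (t - 1))" by (simp only: of_nat_le_iff)
    then show ?thesis using t_pos by (simp add: of_nat_diff)
  qed
  finally have "2 * (\<Sum>w\<in>W. share w) \<le> (2 * real r - 3) * (real t - 1) +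
    (3 * (real r - 1) + (real r * (real t - 1) - 1) - (real r - 1) * real t)" by simp
  then show False unfolding tot by (simp add: algebra_simps)
qed

end

theorem (in low_defect) no_near: "\<not> near c i"
proof
  assume "near c i"
  then interpret dominating_state V adj r t x c i by unfold_locales
  show False by (rule contradiction)
qed

section \<open>Maximum degree at most seven\<close>

text \<open>Take a largest proper subset \<open>M\<close> of \<open>A\<close> in which every element
  reaches \<open>i\<close> within \<open>M\<close>. Some \<open>u\<close> outside has an arc into
  \<open>M\<close>, and maximality forces \<open>A = insert u M\<close>; so nobody needs
  \<open>u\<close> on the way to \<open>i\<close>.\<close>

lemma terminal_vertex:
  assumes fin: "finite A" and i: "i \<in> A" and A2: "A \<noteq> {i}"
    and reach: "\<And>p. p \<in> A \<Longrightarrow> (p, i) \<in> {(a, b) \<in> R. a \<in> A \<and> b \<in> A}\<^sup>*"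
  shows "\<exists>v\<in>A. v \<noteq> i \<and> (\<forall>p\<in>A - {v}. (p, i) \<in> {(a, b) \<in> R. a \<in> A - {v} \<and> b \<in> A - {v}}\<^sup>*)"
proof -
  let ?R = "\<lambda>M. {(a, b) \<in> R. a \<in> M \<and> b \<in> M}"
  define G where "G M \<longleftrightarrow> M \<subset> A \<and> i \<in> M \<and> (\<forall>p\<in>M. (p, i) \<in> (?R M)\<^sup>*)" for M
  have "G {i}" using i A2 by (auto simp: G_def)
  moreover have "card M < card A + 1" if "G M" for M
    using that psubset_card_mono[OF fin, of M] by (simp add: G_def)
  ultimately obtain M where M: "G M" and max: "\<And>M'. G M' \<Longrightarrow> card M' \<le> card M"
    using ex_has_greatest_nat[of G "{i}" card "card A + 1"] by (metis less_imp_le)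
  have MA: "M \<subset> A" "i \<in> M" "\<And>p. p \<in> M \<Longrightarrow> (p, i) \<in> (?R M)\<^sup>*" using M by (auto simp: G_def)
  have "\<exists>u\<in>A - M. \<exists>v\<in>M. (u, v) \<in> R"
  proof (rule ccontr)
    assume no: "\<not> ?thesis"
    obtain p where p: "p \<in> A - M" using MA by blast
    have "(p, s) \<in> (?R A)\<^sup>* \<Longrightarrow> s \<in> A - M" for s
    proof (induction rule: rtrancl_induct)
      case base show ?case by (rule p)
    next
      case (step y z) then show ?case using no by blast
    qed
    then show False using reach[of p] p MA(2) by blast
  qed
  then obtain u v where u: "u \<in> A - M" "v \<in> M" "(u, v) \<in> R" by blast
  have mono: "(?R M)\<^sup>* \<subseteq> (?R (insert u M))\<^sup>*" by (rule rtrancl_mono) auto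
  have good: "(p, i) \<in> (?R (insert u M))\<^sup>*" if "p \<in> insert u M" for p
  proof (cases "p = u")
    case True
    have "(u, v) \<in> ?R (insert u M)" using u by auto
    then show ?thesis using True MA(3)[OF u(2)] mono by (meson converse_rtrancl_into_rtrancl subsetD)
  next
    case False then show ?thesis using that MA(3) mono by blast
  qed
  have "insert u M = A"
  proof (rule ccontr)
    assume "insert u M \<noteq> A"
    then have "G (insert u M)" using good u MA by (auto simp: G_def)
    then have "card (insert u M) \<le> card M" by (rule max)
    moreover have "finite M" using MA fin finite_subset by blast
    ultimately show False using u by simp
  qed
  then have "A - {u} = M" using u by blast
  then show ?thesis using MA u by (intro bexI[of _ u]) auto
qed

lemma equal_split:
  assumes "finite K" "finite S" "card S = card K * t"
  shows "\<exists>f. (\<forall>v\<in>S. f v \<in> K) \<and> (\<forall>k\<in>K. card {v \<in> S. f v = k} = t)"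
  using assms
proof (induction arbitrary: S rule: finite_induct)
  case empty then show ?case by auto
next
  case (insert k K)
  then have "t \<le> card S" by simp
  then obtain T where T: "T \<subseteq> S" "card T = t" by (rule obtain_subset_with_card_n)
  have finT: "finite T" using T insert.prems finite_subset by blast
  have "card (S - T) = card K * t" using T finT insert by (simp add: card_Diff_subset)
  then obtain f where f: "\<forall>v\<in>S - T. f v \<in> K" "\<forall>k\<in>K. card {v \<in> S - T. f v = k} = t"
    using insert.IH[of "S - T"] insert.prems by auto
  let ?f = "\<lambda>v. if v \<in> T then k else f v"
  have "{v \<in> S. ?f v = k} = T" using T f(1) insert.hyps by auto
  moreover have "{v \<in> S. ?f v = k'} = {v \<in> S - T. f v = k'}" if "k' \<in> K" for k'
    using that insert.hyps by auto
  ultimately show ?case using f T by (intro exI[of _ ?f]) auto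
qed

locale deg7_defect = defect +
  assumes deg7: "card (nb V v) \<le> 7"
begin

lemma no_near_deg7: "\<not> near c i"
proof
  assume nearc: "near c i"
  let ?A = "reaching c {} i"
  let ?X = "clU c ?A" and ?a = "card (reaching c {} i)"
  have Ar: "?A \<subseteq> {..<r}" using reaching_sub[of c "{}" i] by simp
  have finA: "finite ?A" using Ar finite_subset by blast
  have iA: "i \<in> ?A" using reaching_self[OF near_lt[OF nearc], of "{}"] by simp
  have a1: "1 \<le> ?a" using iA finA card_gt_0_iff by (metis Suc_leI One_nat_def empty_iff)
  have hit: "\<not> miss v (cl c p)" if "v \<in> V - ?X" "p \<in> ?A" for v p
    using reaching_hits[OF nearc that(2), of v] that(1) by simp
  have hitA: "?a \<le> card (nb ?X v)" if "v \<in> V - ?X" for v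
    using hit[OF that] finA by (intro card_nb_clU_ge) auto
  have nbX7: "card (nb ?X v) + card (nb (V - ?X) v) \<le> 7" for v
  proof -
    have "card (nb (?X \<union> (V - ?X)) v) = card (nb ?X v) + card (nb (V - ?X) v)"
      by (rule card_nb_Un) auto
    moreover have "?X \<union> (V - ?X) = V" using clU_sub by blast
    ultimately show ?thesis using deg7[of v] by simp
  qed
  have xY: "x \<in> V - ?X" using xV by (auto simp: clU_def)
  have a7: "?a \<le> 7" using hitA[OF xY] nbX7[of x] by linarith
  have cX: "card ?X + 1 = ?a * t" using card_clU[OF nearc Ar] iA by simp
  have rt: "r * t = ?a * t + (r - ?a) * t" using a7 r10 by (simp add: add_mult_distrib[symmetric])
  have "card (V - ?X) = r * t - card ?X" using card_Diff_subset[OF finite_clU clU_sub] cardV by simp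
  then have cY: "card (V - ?X) = (r - ?a) * t + 1" using cX rt by simp
  have e1: "?a * card (V - ?X) \<le> ecount (V - ?X) ?X" using hitA by (rule ecount_ge)
  have esym: "ecount (V - ?X) ?X = ecount ?X (V - ?X)" by (rule ecount_sym) (use clU_sub in auto)
  have e2: "ecount ?X (V - ?X) \<le> 7 * card ?X"
  proof -
    have "card (nb (V - ?X) v) \<le> 7" for v using nbX7[of v] by linarith
    then show ?thesis
      unfolding ecount_def using sum_bounded_above[of ?X "\<lambda>v. card (nb (V - ?X) v)" 7] by (simp add: mult.commute)
  qed
  \<comment> \<open>Otherwise at least \<open>7 * t + 1\<close> outside vertices each send
    \<open>?a\<close> edges into \<open>?X\<close>, whose \<open>?a * t - 1\<close> vertices can
    receive only 7 each.\<close>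
  have "r - ?a \<le> 6"
  proof (rule ccontr)
    assume "\<not> r - ?a \<le> 6"
    then have "7 * t \<le> (r - ?a) * t" by simp
    then have "?a * (7 * t + 1) \<le> ?a * card (V - ?X)" using cY by (intro mult_le_mono2) simp
    then have "?a * (7 * t + 1) \<le> 7 * card ?X" using e1 e2 esym by linarith
    moreover have "?a * (7 * t + 1) = 7 * (?a * t) + ?a" by (simp add: algebra_simps)
    ultimately show False using cX a1 by linarith
  qed
  moreover have "\<not> (4 \<le> ?a \<and> ?a + 4 \<le> r)"
  proof
    assume a: "4 \<le> ?a \<and> ?a + 4 \<le> r"
    have "?a * (r - ?a) * t \<le> ecount (V - ?X) ?X + 1" using e1 cY by (simp add: algebra_simps)
    then show False using dens_contradiction[of "V - ?X" ?X ?a] a clU_sub by auto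
  qed
  ultimately have a: "?a = 7" and r: "r = 10" using a7 r10 by linarith+
  have cY: "card (V - ?X) = 3 * t + 1" using cY a r by simp
  have Yind: "nb (V - ?X) v = {}" if "v \<in> V - ?X" for v
  proof -
    have "card (nb (V - ?X) v) = 0" using hitA[OF that] nbX7[of v] a by linarith
    then show ?thesis by simp
  qed
  have one: "card (nb (cl c p) v) = 1" if "v \<in> V - ?X" "p \<in> ?A" for v p
  proof -
    have ge: "1 \<le> card (nb (cl c k) v)" if "k \<in> ?A" for k using hit[OF \<open>v \<in> V - ?X\<close> that] not_missI by blast
    have "(\<Sum>k\<in>?A. card (nb (cl c k) v)) \<le> 7" using card_nb_clU[OF finA, of c v] nbX7[of v] by linarith
    moreover have "(\<Sum>k\<in>?A. card (nb (cl c k) v)) = card (nb (cl c p) v) + (\<Sum>k\<in>?A - {p}. card (nb (cl c k) v))"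
      by (rule sum.remove[OF finA that(2)])
    moreover have "card (?A - {p}) * 1 \<le> (\<Sum>k\<in>?A - {p}. card (nb (cl c k) v))"
      using sum_bounded_below[of "?A - {p}" 1 "\<lambda>k. card (nb (cl c k) v)"] ge by simp
    moreover have "card (?A - {p}) = 6" using a that(2) finA by simp
    ultimately show ?thesis using ge[OF that(2)] by linarith
  qed
  let ?R = "arcs (V - {x}) c {..<r}"
  have arcsR: "{(p, q) \<in> ?R. p \<in> M \<and> q \<in> M} = arcs (V - {x}) c M" if "M \<subseteq> {..<r}" for M
    using that by (auto simp: arcs_def)
  have "(p, i) \<in> {(a, b) \<in> ?R. a \<in> ?A \<and> b \<in> ?A}\<^sup>*" if "p \<in> ?A" for p
  proof -
    have "(p, i) \<in> ?R\<^sup>*" using that by (simp add: reaching_def)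
    then show ?thesis
    proof (induction rule: converse_rtrancl_induct)
      case base show ?case by simp
    next
      case (step y z)
      have "y < r" "z < r" using step(1) by (auto simp: arcs_def)
      then have "y \<in> ?A" "z \<in> ?A"
        using step(1,2) converse_rtrancl_into_rtrancl[OF step(1,2)] by (auto simp: reaching_def)
      then show ?case using step(1,3) by (auto intro: converse_rtrancl_into_rtrancl)
    qed
  qed
  moreover have "?A \<noteq> {i}"
  proof
    assume "?A = {i}"
    then have "?a = 1" by simp
    then show False using a by simp
  qed
  ultimately obtain v0 where v0: "v0 \<in> ?A" "v0 \<noteq> i"
    "\<And>p. p \<in> ?A - {v0} \<Longrightarrow> (p, i) \<in> (arcs (V - {x}) c (?A - {v0}))\<^sup>*"
    using terminal_vertex[OF finA iA, of ?R] arcsR[of "?A - {_}"] Ar by (metis (no_types, lifting) Diff_subset subset_trans)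
  let ?J = "?A - {v0}" and ?U = "cl c v0"
  have v0r: "v0 < r" using v0 Ar by auto
  have cardU: "card ?U = t" using near_card[OF nearc v0r] v0 by simp
  have UX: "?U \<subseteq> ?X" using v0 by (auto simp: clU_def cls_def)
  \<comment> \<open>The \<open>3 * t + 1\<close> outside vertices send one edge each to the
    \<open>t\<close> vertices of \<open>?U\<close>.\<close>
  have "\<exists>z\<in>?U. 4 \<le> card (nb (V - ?X) z)"
  proof (rule ccontr)
    assume "\<not> ?thesis"
    then have "\<And>z. z \<in> ?U \<Longrightarrow> card (nb (V - ?X) z) \<le> 3" by auto
    then have "ecount ?U (V - ?X) \<le> 3 * t"
      unfolding ecount_def using sum_bounded_above[of ?U "\<lambda>v. card (nb (V - ?X) v)" 3] cardU by (simp add: mult.commute)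
    moreover have "1 * card (V - ?X) \<le> ecount (V - ?X) ?U" using one v0 by (intro ecount_ge) auto
    moreover have "ecount (V - ?X) ?U = ecount ?U (V - ?X)" by (rule ecount_sym) (auto simp: cls_def)
    ultimately show False using cY by linarith
  qed
  then obtain z where z: "z \<in> ?U" "4 \<le> card (nb (V - ?X) z)" by blast
  have "\<exists>p\<in>?J. miss z (cl c p)"
  proof (rule ccontr)
    assume "\<not> ?thesis"
    then have "card ?J \<le> card (nb (clU c ?J) z)" using finA by (intro card_nb_clU_ge) auto
    also have "\<dots> \<le> card (nb ?X z)" by (intro card_mono finite_nb nb_mono) (auto simp: clU_def)
    finally show False using nbX7[of z] z(2) a v0(1) finA by simp
  qed
  then obtain p where p: "p \<in> ?J" "miss z (cl c p)" by blast
  obtain y where y: "y \<in> nb (V - ?X) z" using z(2) by (metis card.empty ex_in_conv not_numeral_le_zero)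
  have yV: "y \<in> V - ?X" "adj y z" using y adj_sym by (auto simp: nb_def)
  have ynb: "nb ?U y = {z}"
  proof -
    have "z \<in> nb ?U y" using yV z by (auto simp: nb_def)
    then show ?thesis using one[OF yV(1) v0(1)] card_1_singletonE by (metis singletonD)
  qed
  let ?D = "insert y (?X - {z})" and ?c = "c(y := v0)"
  have zX: "z \<in> ?X" "z \<in> V" "c z = v0" using z(1) UX cl_sub by (auto simp: cls_def)
  have yz: "y \<noteq> z" using yV zX by blast
  have cJ: "cls ?D ?c k = cl c k" if "k \<in> ?J" for k
    using that yV zX by (auto simp: cls_def clU_def)
  have c0: "cls ?D ?c v0 = insert y (?U - {z})"
    using yV zX v0(1) by (auto simp: cls_def clU_def)
  have ind: "\<not> adj u v" if "u \<in> cl c k" "v \<in> cl c k" for u v k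
    using proper_miss[OF near_proper[OF nearc] that(1)] that(2) by (auto simp: miss_iff)
  have pr: "proper ?D ?c"
    unfolding proper_def
  proof (intro ballI impI notI)
    fix u v assume univ: "u \<in> ?D" "v \<in> ?D" "adj u v" "?c u = ?c v"
    obtain k where k: "?c u = k" "?c v = k" using univ(4) by metis
    have in': "u \<in> cls ?D ?c k" "v \<in> cls ?D ?c k" using univ(1,2) k unfolding cls_def by blast+
    have "k \<in> ?A" using k(1) univ(1) v0(1) by (auto simp: clU_def split: if_splits)
    show False
    proof (cases "k = v0")
      case True
      have "u \<in> insert y (?U - {z})" "v \<in> insert y (?U - {z})" using in' unfolding True c0 .
      moreover have "\<not> adj y w \<and> \<not> adj w y" if "w \<in> ?U - {z}" for w
      proof -
        have "\<not> adj y w" using ynb that by (auto simp: nb_def)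
        then show ?thesis using adj_sym by blast
      qed
      ultimately show False using univ(3) ind[of u v0 v] adj_irrefl by blast
    next
      case False
      then have "k \<in> ?J" using \<open>k \<in> ?A\<close> by blast
      then show False using in' ind univ(3) unfolding cJ[OF \<open>k \<in> ?J\<close>] by blast
    qed
  qed
  have arcsJ: "arcs ?D ?c ?J = arcs (V - {x}) c ?J"
  proof (rule set_eqI)
    fix e :: "nat \<times> nat"
    obtain p1 p2 where e: "e = (p1, p2)" by (cases e)
    show "e \<in> arcs ?D ?c ?J \<longleftrightarrow> e \<in> arcs (V - {x}) c ?J"
    proof (cases "p1 \<in> ?J \<and> p2 \<in> ?J")
      case True then show ?thesis unfolding e arcs_def using cJ[of p1] cJ[of p2] by simp
    next
      case False then show ?thesis unfolding e arcs_def by blast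
    qed
  qed
  have ins: "insert z ?D = insert y ?X" using zX by blast
  have "\<exists>c'. proper (insert z ?D) c' \<and> (\<forall>v\<in>?D. ?c v \<notin> ?J \<longrightarrow> c' v = ?c v) \<and>
    (\<forall>v\<in>?D. ?c v \<in> ?J \<longrightarrow> c' v \<in> ?J) \<and> c' z \<in> ?J \<and>
    (\<forall>k. card (cls (insert z ?D) c' k) = card (cls ?D ?c k) + (if k = i then 1 else 0))"
  proof (rule absorb)
    show "(p, i) \<in> (arcs ?D ?c ?J)\<^sup>*" unfolding arcsJ by (rule v0(3)[OF p(1)])
    show "miss z (cls ?D ?c p)" unfolding cJ[OF p(1)] by (rule p(2))
    show "insert z ?D \<subseteq> V" unfolding ins using yV clU_sub by auto
    show "z \<notin> ?D" using yz by blast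
    show "proper ?D ?c" by (rule pr)
    show "p \<in> ?J" by (rule p(1))
    show "finite ?J" using finA by simp
  qed
  then obtain c' where c': "proper (insert y ?X) c'" "\<forall>v\<in>?D. ?c v \<notin> ?J \<longrightarrow> c' v = ?c v"
    "\<forall>v\<in>?D. ?c v \<in> ?J \<longrightarrow> c' v \<in> ?J" "c' z \<in> ?J"
    "\<forall>k. card (cls (insert y ?X) c' k) = card (cls ?D ?c k) + (if k = i then 1 else 0)"
    unfolding ins by blast
  have c'A: "c' v \<in> ?A" if v: "v \<in> insert y ?X" for v
  proof (cases "v = z")
    case False
    then have vD: "v \<in> ?D" using v by blast
    have "?c v \<in> ?A" using v v0(1) by (auto simp: clU_def)
    show ?thesis
    proof (cases "?c v \<in> ?J")
      case True then show ?thesis using c'(3) vD by blast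
    next
      case False
      then have "c' v = ?c v" using c'(2) vD by blast
      then show ?thesis using \<open>?c v \<in> ?A\<close> by simp
    qed
  qed (use c'(4) in blast)
  have sz: "card (cls (insert y ?X) c' k) = t" if k: "k \<in> ?A" for k
  proof (cases "k = v0")
    case True
    have "y \<notin> ?U - {z}" using yV UX by blast
    then have "card (cls ?D ?c v0) = t" unfolding c0 using card_Suc_Diff1[OF finite_cl z(1)] cardU by simp
    then show ?thesis using c'(5) True v0(2) by simp
  next
    case False
    then have "card (cls ?D ?c k) = card (cl c k)" using cJ k by simp
    moreover have "k < r" using k Ar by auto
    ultimately show ?thesis using c'(5) near_card[OF nearc \<open>k < r\<close>] t_pos by auto
  qed
  let ?S = "V - ?X - {y}" and ?K = "{..<r} - ?A"
  have "card ?S = 3 * t" using cY yV by simp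
  moreover have "card ?K = 3" using a r Ar finA by (simp add: card_Diff_subset)
  ultimately obtain f where f: "\<forall>v\<in>?S. f v \<in> ?K" "\<forall>k\<in>?K. card {v \<in> ?S. f v = k} = t"
    using equal_split[of ?K ?S t] finV by auto
  define h where "h v = (if v \<in> insert y ?X then c' v else f v)" for v
  have VS: "V = insert y ?X \<union> ?S" using yV clU_sub by blast
  have hA: "h v \<in> ?A" if "v \<in> insert y ?X" for v using c'A[OF that] that by (simp add: h_def)
  have hK: "h v \<in> ?K" if "v \<in> ?S" for v using f(1) that by (auto simp: h_def)
  show False
  proof (rule notdone[of h])
    show "proper V h" unfolding proper_def
    proof (intro ballI impI notI)
      fix u v assume univ: "u \<in> V" "v \<in> V" "adj u v" "h u = h v"
      show False
      proof (cases "u \<in> insert y ?X")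
        case True
        have "v \<in> insert y ?X"
        proof (rule ccontr)
          assume "v \<notin> insert y ?X"
          then have "v \<in> ?S" using univ(2) by blast
          then show False using hK[of v] hA[OF True] univ(4) by simp
        qed
        then show False using True c'(1) univ unfolding proper_def by (metis h_def)
      next
        case False
        then have "u \<in> ?S" using univ(1) by blast
        have "v \<in> ?S"
        proof (rule ccontr)
          assume "v \<notin> ?S"
          then have "v \<in> insert y ?X" using univ(2) by blast
          then show False using hA[of v] hK[OF \<open>u \<in> ?S\<close>] univ(4) by simp
        qed
        then show False using Yind[of u] \<open>u \<in> ?S\<close> univ(3) by (auto simp: nb_def)
      qed
    qed
    show "h v < r" if "v \<in> V" for v using hA[of v] hK[of v] that VS Ar by auto
    show "card (cls V h k) = t" if "k < r" for k
    proof (cases "k \<in> ?A")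
      case True
      have "cls V h k = cls (insert y ?X) c' k"
      proof (intro set_eqI iffI)
        fix v assume v: "v \<in> cls V h k"
        then have "v \<in> insert y ?X" using hK[of v] True VS by (auto simp: cls_def)
        then show "v \<in> cls (insert y ?X) c' k" using v unfolding cls_def h_def by simp
      next
        fix v assume "v \<in> cls (insert y ?X) c' k"
        then show "v \<in> cls V h k" using VS unfolding cls_def h_def by simp blast
      qed
      then show ?thesis using sz[OF True] by simp
    next
      case False
      have "cls V h k = {v \<in> ?S. f v = k}"
      proof (intro set_eqI iffI)
        fix v assume v: "v \<in> cls V h k"
        then have "v \<notin> insert y ?X" using hA[of v] False by (auto simp: cls_def)
        then show "v \<in> {v \<in> ?S. f v = k}" using v unfolding cls_def h_def by simp
      next
        fix v assume "v \<in> {v \<in> ?S. f v = k}"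
        then show "v \<in> cls V h k" unfolding cls_def h_def by simp
      qed
      then show ?thesis using f(2) False that by simp
    qed
  qed
qed

end

section \<open>The induction\<close>

locale sparse = fgraph V adj for V :: "'a set" and adj +
  fixes r :: nat
  assumes r10: "10 \<le> r"
    and degr: "card (nb V v) \<le> r"
    and dens: "H \<subseteq> V \<Longrightarrow> ecount H H \<le> 7 * card H"
    and bip: "X \<subseteq> V \<Longrightarrow> Y \<subseteq> V \<Longrightarrow> X \<inter> Y = {} \<Longrightarrow> 4 * ecount X Y \<le> 9 * (card X + card Y)"
begin

text \<open>The degrees inside \<open>X\<close> average at most 7, so if none is below 7, all are
  equal to 7.\<close>

lemma low_degree:
  assumes "X \<subseteq> V" "X \<noteq> {}"
  shows "(\<exists>v\<in>X. card (nb X v) \<le> 6) \<or> (\<forall>v\<in>X. card (nb X v) = 7)"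
proof (rule ccontr)
  assume "\<not> ?thesis"
  then have ge: "\<And>v. v \<in> X \<Longrightarrow> 7 \<le> card (nb X v)" and "\<exists>v\<in>X. card (nb X v) \<noteq> 7"
    by (auto simp: not_le)
  then obtain v where "v \<in> X" "card (nb X v) \<noteq> 7" by blast
  then have v: "v \<in> X" "8 \<le> card (nb X v)" using ge[of v] by auto
  have fX: "finite X" using assms finite_subV by blast
  have "7 * card (X - {v}) \<le> ecount (X - {v}) X" using ge by (intro ecount_ge) auto
  moreover have "ecount X X = card (nb X v) + ecount (X - {v}) X"
    unfolding ecount_def by (rule sum.remove[OF fX v(1)])
  moreover have "card X = card (X - {v}) + 1" using card_Suc_Diff1[OF fX v(1)] by simp
  ultimately show False using dens[OF assms(1)] v(2) by linarith
qed

text \<open>Vertices outside \<open>X\<close> become isolated instead of being deleted, so the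
  number of vertices remains divisible by \<open>r\<close>.\<close>

definition adjX :: "'a set \<Rightarrow> 'a \<Rightarrow> 'a \<Rightarrow> bool" where
  "adjX X u v \<longleftrightarrow> adj u v \<and> u \<in> X \<and> v \<in> X"

lemma sparse_sub: "X \<subseteq> V \<Longrightarrow> V' \<subseteq> V \<Longrightarrow> X \<subseteq> V' \<Longrightarrow> sparse V' (adjX X) r"
proof -
  assume X: "X \<subseteq> V" "V' \<subseteq> V" "X \<subseteq> V'"
  interpret G: fgraph V' "adjX X"
  proof
    show "finite V'" using X(2) by (rule finite_subV)
    show "adjX X v u" if "adjX X u v" for u v using that adj_sym[of u v] by (simp add: adjX_def)
    show "\<not> adjX X u u" for u using adj_irrefl[of u] by (simp add: adjX_def)
    show "v \<in> V'" if "adjX X u v" for u v using that X(3) by (auto simp: adjX_def)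
  qed
  have nb: "card (G.nb Y v) \<le> card (nb Y v)" for Y v
    by (rule card_mono[OF finite_nb]) (auto simp: G.nb_def nb_def adjX_def)
  have ec: "G.ecount A B \<le> ecount A B" for A B
    unfolding G.ecount_def ecount_def by (rule sum_mono) (rule nb)
  show ?thesis
  proof unfold_locales
    show "10 \<le> r" by (rule r10)
    have "card (nb V' v) \<le> card (nb V v)" for v by (intro card_mono finite_nb nb_mono X)
    then show "card (G.nb V' v) \<le> r" for v using nb degr le_trans by meson
    show "G.ecount H H \<le> 7 * card H" if "H \<subseteq> V'" for H
      using ec[of H H] dens[of H] that X by (meson le_trans subset_trans)
    show "4 * G.ecount A B \<le> 9 * (card A + card B)" if "A \<subseteq> V'" "B \<subseteq> V'" "A \<inter> B = {}" for A B
      using ec[of A B] bip[of A B] that X by (meson le_trans mult_le_mono2 subset_trans)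
  qed
qed

definition full :: "('a \<Rightarrow> 'a \<Rightarrow> bool) \<Rightarrow> nat \<Rightarrow> ('a \<Rightarrow> nat) \<Rightarrow> bool" where
  "full ad t c \<longleftrightarrow> (\<forall>u\<in>V. \<forall>v\<in>V. ad u v \<longrightarrow> c u \<noteq> c v) \<and> (\<forall>v\<in>V. c v < r) \<and>
     (\<forall>i<r. card {v \<in> V. c v = i} = t)"

text \<open>Induction on the vertices still carrying edges. Uncolouring \<open>x\<close> in a
  colouring for \<open>X - {x}\<close> leaves its class with \<open>t - 1\<close> vertices; if no
  full colouring existed for \<open>X\<close>, this would be the nearly equitable colouring excluded
  before.\<close>

lemma full_exists:
  assumes n: "card V = r * t" and XV: "X \<subseteq> V" shows "\<exists>c. full (adjX X) t c"
  using XV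
proof (induction "card X" arbitrary: X)
  case 0
  then have "X = {}" using finite_subV by auto
  obtain f where "\<forall>v\<in>V. f v \<in> {..<r}" "\<forall>k\<in>{..<r}. card {v \<in> V. f v = k} = t"
    using equal_split[of "{..<r}" V t] finV n by auto
  then show ?case using \<open>X = {}\<close> by (intro exI[of _ f]) (auto simp: full_def adjX_def)
next
  case (Suc k)
  have fX: "finite X" "X \<noteq> {}" using Suc finite_subV by auto
  interpret G: sparse V "adjX X" r by (rule sparse_sub) (use Suc.prems in auto)
  have nbX: "G.nb V v = (if v \<in> X then nb X v else {})" for v
    using Suc.prems by (auto simp: G.nb_def nb_def adjX_def)
  obtain x where x: "x \<in> X" "card (nb X x) \<le> 6 \<or> (\<forall>v\<in>X. card (nb X v) = 7)"
    using low_degree[OF Suc.prems fX(2)] fX(2) by blast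
  have "k = card (X - {x})" using Suc.hyps(2) x(1) by simp
  from Suc.hyps(1)[OF this] Suc.prems obtain c where c: "full (adjX (X - {x})) t c" by blast
  have xV: "x \<in> V" using x Suc.prems by blast
  show ?case
  proof (rule ccontr)
    assume nf: "\<nexists>c. full (adjX X) t c"
    interpret D: defect V "adjX X" r t x
    proof unfold_locales
      fix c' assume "G.proper V c'" "\<And>v. v \<in> V \<Longrightarrow> c' v < r" "\<And>i. i < r \<Longrightarrow> card (G.cls V c' i) = t"
      then have "full (adjX X) t c'" unfolding full_def G.proper_def G.cls_def by blast
      then show False using nf by blast
    qed (use xV n r10 G.degr G.dens G.bip in auto)
    have t0: "0 < t" by (rule D.t_pos)
    have "D.near c (c x)"
      unfolding D.near_def
    proof (intro conjI ballI allI impI)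
      show "G.proper (V - {x}) c"
        using c unfolding G.proper_def full_def adjX_def by auto
      show "c v < r" if "v \<in> V - {x}" for v using c that by (auto simp: full_def)
      show "c x < r" using c xV by (auto simp: full_def)
      fix k assume "k < r"
      then have ck: "card {v \<in> V. c v = k} = t" using c by (auto simp: full_def)
      have "G.cls (V - {x}) c k = {v \<in> V. c v = k} - {x}" by (auto simp: G.cls_def)
      then show "card (G.cls (V - {x}) c k) = (if k = c x then t - 1 else t)"
        using ck xV finV by (auto simp: card_Diff_singleton_if)
    qed
    moreover have "\<not> D.near c (c x)"
    proof (cases "card (nb X x) \<le> 6")
      case True
      interpret low_defect V "adjX X" r t x
        by unfold_locales (simp add: nbX x(1) True)
      show ?thesis by (rule no_near)
    next
      case False
      then have all7: "\<forall>v\<in>X. card (nb X v) = 7" using x by blast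
      interpret deg7_defect V "adjX X" r t x
        by unfold_locales (simp add: nbX all7)
      show ?thesis by (rule no_near_deg7)
    qed
    ultimately show False by blast
  qed
qed

lemma divisible:
  assumes "card V = r * t"
  shows "\<exists>c. proper V c \<and> (\<forall>v\<in>V. c v < r) \<and> (\<forall>i<r. card (cls V c i) = t)"
proof -
  obtain c where "full (adjX V) t c" using full_exists[OF assms] by blast
  then show ?thesis by (intro exI[of _ c]) (auto simp: full_def proper_def cls_def adjX_def)
qed

end

text \<open>The vertices of an added clique receive distinct colours, so removing them again keeps the class
  sizes within one of each other.\<close>

fun adj_clique :: "('a \<Rightarrow> 'a \<Rightarrow> bool) \<Rightarrow> nat \<Rightarrow> 'a + nat \<Rightarrow> 'a + nat \<Rightarrow> bool" where
  "adj_clique ad k (Inl u) (Inl v) = ad u v"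
| "adj_clique ad k (Inr a) (Inr b) = (a \<noteq> b \<and> a < k \<and> b < k)"
| "adj_clique ad k _ _ = False"

context sparse
begin

text \<open>Clique vertices have degree below 7. For disjoint parts of sizes a and b, a + b <= 6
  gives 4 a b <= (a + b)^2 <= 6 (a + b), within the bipartite bound.\<close>

lemma sparse_clique:
  assumes k: "k \<le> 6"
  shows "sparse (Inl ` V \<union> Inr ` {..<k}) (adj_clique adj k) r"
proof -
  let ?V = "Inl ` V \<union> Inr ` {..<k} :: ('a + nat) set"
  interpret G: fgraph ?V "adj_clique adj k"
  proof
    show "finite ?V" using finV by simp
    show "adj_clique adj k v u" if "adj_clique adj k u v" for u v
      using that adj_sym by (cases u; cases v) auto
    show "\<not> adj_clique adj k u u" for u using adj_irrefl by (cases u) auto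
    show "v \<in> ?V" if "adj_clique adj k u v" for u v
      using that adj_in by (cases u; cases v) auto
  qed
  define L where "L X = {v. Inl v \<in> X}" for X :: "('a + nat) set"
  define R where "R X = {b. Inr b \<in> X}" for X :: "('a + nat) set"
  have Xeq: "X = Inl ` L X \<union> Inr ` R X" for X
  proof (intro set_eqI iffI)
    fix v assume "v \<in> X" then show "v \<in> Inl ` L X \<union> Inr ` R X" by (cases v) (auto simp: L_def R_def)
  qed (auto simp: L_def R_def)
  have sub: "L X \<subseteq> V" "R X \<subseteq> {..<k}" if "X \<subseteq> ?V" for X using that by (auto simp: L_def R_def)
  have fin: "finite (L X)" "finite (R X)" if "X \<subseteq> ?V" for X
    using sub[OF that] finite_subV finite_subset by blast+
  have cX: "card X = card (L X) + card (R X)" if "X \<subseteq> ?V" for X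
  proof -
    have "card X = card (Inl ` L X \<union> Inr ` R X :: ('a + nat) set)" using Xeq by simp
    also have "\<dots> = card (L X) + card (R X)"
      using fin[OF that] by (subst card_Un_disjoint) (auto simp: card_image)
    finally show ?thesis .
  qed
  have nbL: "card (G.nb X (Inl v)) = card (nb (L X) v)" for X v
  proof -
    have "G.nb X (Inl v) = Inl ` nb (L X) v"
    proof (intro set_eqI iffI)
      fix w assume "w \<in> G.nb X (Inl v)"
      then show "w \<in> Inl ` nb (L X) v" by (cases w) (auto simp: G.nb_def nb_def L_def)
    qed (auto simp: G.nb_def nb_def L_def)
    then show ?thesis by (simp add: card_image)
  qed
  have nbR: "G.nb X (Inr b) \<subseteq> Inr ` (R X - {b})" for X b
  proof
    fix w assume "w \<in> G.nb X (Inr b)"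
    then show "w \<in> Inr ` (R X - {b})" by (cases w) (auto simp: G.nb_def R_def)
  qed
  have nbR': "card (G.nb X (Inr b)) \<le> card (R X - {b})" if "X \<subseteq> ?V" for X b
  proof -
    have "card (G.nb X (Inr b)) \<le> card (Inr ` (R X - {b}) :: ('a + nat) set)"
      using fin[OF that] by (intro card_mono nbR) auto
    then show ?thesis by (simp add: card_image)
  qed
  have ecL: "G.ecount (Inl ` A) Y = ecount A (L Y)" for A Y
    unfolding G.ecount_def ecount_def by (subst sum.reindex) (auto simp: nbL)
  have ec: "G.ecount X Y = ecount (L X) (L Y) + (\<Sum>b\<in>R X. card (G.nb Y (Inr b)))" if "X \<subseteq> ?V" for X Y
  proof -
    have "G.ecount X Y = G.ecount (Inl ` L X \<union> Inr ` R X) Y" using Xeq by simp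
    also have "\<dots> = G.ecount (Inl ` L X) Y + G.ecount (Inr ` R X) Y"
      using fin[OF that] by (intro G.ecount_Un1) auto
    also have "G.ecount (Inr ` R X) Y = (\<Sum>b\<in>R X. card (G.nb Y (Inr b)))"
      unfolding G.ecount_def by (subst sum.reindex) auto
    finally show ?thesis using ecL by simp
  qed
  have cR: "card (R X) \<le> 6" if "X \<subseteq> ?V" for X
    using card_mono[OF _ sub(2)[OF that]] k by simp
  show ?thesis
  proof unfold_locales
    show "10 \<le> r" by (rule r10)
    show "card (G.nb ?V v) \<le> r" for v
    proof (cases v)
      case (Inl a)
      have "L ?V = V" by (auto simp: L_def)
      then show ?thesis using nbL[of ?V a] degr[of a] Inl by simp
    next
      case (Inr b)
      have "card (R ?V - {b}) \<le> card (R ?V)" using fin[of ?V] by (intro card_mono) auto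
      then show ?thesis using nbR'[of ?V b] cR[of ?V] r10 Inr by simp
    qed
    show "G.ecount H H \<le> 7 * card H" if H: "H \<subseteq> ?V" for H
    proof -
      have "card (G.nb H (Inr b)) \<le> 6" for b
        using nbR'[OF H, of b] cR[OF H] card_mono[OF fin(2)[OF H], of "R H - {b}"] by simp
      then have "(\<Sum>b\<in>R H. card (G.nb H (Inr b))) \<le> 6 * card (R H)"
        using sum_bounded_above[of "R H" "\<lambda>b. card (G.nb H (Inr b))" 6] by (simp add: mult.commute)
      then show ?thesis using ec[OF H, of H] dens[OF sub(1)[OF H]] cX[OF H] by simp
    qed
    show "4 * G.ecount X Y \<le> 9 * (card X + card Y)"
      if X: "X \<subseteq> ?V" and Y: "Y \<subseteq> ?V" and d: "X \<inter> Y = {}" for X Y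
    proof -
      let ?a = "card (R X)" and ?b = "card (R Y)"
      have "R X \<inter> R Y = {}" using d by (auto simp: R_def)
      then have "?a + ?b = card (R X \<union> R Y)" using fin X Y by (simp add: card_Un_disjoint)
      also have "\<dots> \<le> card {..<k}" using sub X Y by (intro card_mono) auto
      finally have ab: "?a + ?b \<le> 6" using k by simp
      have "card (G.nb Y (Inr b)) \<le> ?b" for b
        using nbR'[OF Y, of b] card_mono[OF fin(2)[OF Y], of "R Y - {b}"] by simp
      then have "(\<Sum>b\<in>R X. card (G.nb Y (Inr b))) \<le> ?a * ?b"
        using sum_bounded_above[of "R X" "\<lambda>b. card (G.nb Y (Inr b))" ?b] by simp
      moreover have "4 * (?a * ?b) \<le> 9 * ?a + 9 * ?b"
      proof -
        have "4 * (?a * ?b) \<le> (?a + ?b) * (?a + ?b)"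
        proof -
          have "0 \<le> (int ?a - int ?b)\<^sup>2" by simp
          then have "4 * (int ?a * int ?b) \<le> (int ?a + int ?b) * (int ?a + int ?b)"
            by (simp add: power2_eq_square algebra_simps)
          then show ?thesis by (metis (no_types, lifting) of_nat_add of_nat_le_iff of_nat_mult of_nat_numeral)
        qed
        also have "\<dots> \<le> 6 * (?a + ?b)" using ab by (intro mult_le_mono1)
        finally show ?thesis by simp
      qed
      moreover have "L X \<inter> L Y = {}" using d by (auto simp: L_def)
      then have "4 * ecount (L X) (L Y) \<le> 9 * (card (L X) + card (L Y))" using bip sub X Y by blast
      ultimately show ?thesis using ec[OF X, of Y] cX[OF X] cX[OF Y] by (simp add: algebra_simps)
    qed
  qed
qed

end

text \<open>Induction on the number of vertices, to learn how many classes are small once a vertex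
  \<open>v\<close> of degree at most 7 is removed. With at least 8 small classes \<open>v\<close>
  fits into one of them; with fewer, at most 6 padding vertices are needed.\<close>

theorem equitable_exists:
  assumes "sparse V adj r"
  shows "\<exists>c q. (\<forall>u\<in>V. \<forall>v\<in>V. adj u v \<longrightarrow> c u \<noteq> c v) \<and> (\<forall>v\<in>V. c v < r) \<and>
    (\<forall>i<r. card {v \<in> V. c v = i} = q \<or> card {v \<in> V. c v = i} = q + 1)"
  using assms
proof (induction "card V" arbitrary: V adj)
  case 0
  then interpret sparse V adj r by simp
  have "V = {}" using 0 finV by simp
  then show ?case by simp
next
  case (Suc n)
  then interpret sparse V adj r by simp
  have Vne: "V \<noteq> {}" using Suc.hyps(2) by auto
  obtain v where v: "v \<in> V" "card (nb V v) \<le> 7"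
    using low_degree[of V] Vne by fastforce
  let ?V = "V - {v}" and ?adj = "adjX (V - {v})"
  have "n = card ?V" using Suc.hyps(2) v(1) by simp
  moreover have "sparse ?V ?adj r" by (rule sparse_sub) auto
  ultimately obtain c q0 where c: "\<forall>u\<in>?V. \<forall>w\<in>?V. ?adj u w \<longrightarrow> c u \<noteq> c w" "\<forall>w\<in>?V. c w < r"
    "\<forall>i<r. card {w \<in> ?V. c w = i} = q0 \<or> card {w \<in> ?V. c w = i} = q0 + 1"
    using Suc.hyps(1) by blast
  have cadj: "c u \<noteq> c w" if "u \<in> ?V" "w \<in> ?V" "adj u w" for u w
    using c(1) that by (auto simp: adjX_def)
  \<comment> \<open>The size \<open>q\<close> is chosen so that it is attained; if all classes have
    size \<open>q0 + 1\<close>, that number becomes \<open>q\<close>.\<close>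
  obtain q where q: "\<forall>i<r. card {w \<in> ?V. c w = i} = q \<or> card {w \<in> ?V. c w = i} = q + 1"
    "\<exists>i<r. card {w \<in> ?V. c w = i} = q"
  proof (cases "\<exists>i<r. card {w \<in> ?V. c w = i} = q0")
    case True then show ?thesis using that c(3) by blast
  next
    case False
    then have "\<forall>i<r. card {w \<in> ?V. c w = i} = q0 + 1" using c(3) by blast
    moreover have "0 < r" using r10 by simp
    ultimately show ?thesis using that[of "q0 + 1"] by blast
  qed
  define Sm where "Sm = {i \<in> {..<r}. card {w \<in> ?V. c w = i} = q}"
  have finSm: "finite Sm" by (simp add: Sm_def)
  show ?case
  proof (cases "8 \<le> card Sm")
    case True
    have "\<exists>i\<in>Sm. miss v (cls ?V c i)"
    proof (rule ccontr)
      assume no: "\<not> ?thesis"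
      have "card (nb (\<Union>i\<in>Sm. cls ?V c i) v) = (\<Sum>i\<in>Sm. card (nb (cls ?V c i) v))"
        by (rule card_nb_UN[OF finSm]) (auto simp: cls_def)
      moreover have "(\<Sum>i\<in>Sm. 1) \<le> (\<Sum>i\<in>Sm. card (nb (cls ?V c i) v))"
        using no not_missI by (intro sum_mono) auto
      moreover have "card (nb (\<Union>i\<in>Sm. cls ?V c i) v) \<le> card (nb V v)"
        by (intro card_mono finite_nb nb_mono) (auto simp: cls_def)
      ultimately show False using True v(2) by simp
    qed
    then obtain i where i: "i \<in> Sm" "miss v (cls ?V c i)" by blast
    have nv: "\<not> adj v w \<and> \<not> adj w v" if "w \<in> ?V" "c w = i" for w
      using i(2) that adj_sym by (auto simp: miss_iff cls_def)
    let ?c = "c(v := i)"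
    have "?c u \<noteq> ?c w" if "u \<in> V" "w \<in> V" "adj u w" for u w
      using that nv[of u] nv[of w] cadj[of u w] adj_irrefl by auto
    moreover have "?c w < r" if "w \<in> V" for w using that c(2) i(1) by (auto simp: Sm_def)
    moreover have "card {w \<in> V. ?c w = k} = q \<or> card {w \<in> V. ?c w = k} = q + 1" if "k < r" for k
    proof (cases "k = i")
      case True
      have "{w \<in> V. ?c w = k} = insert v {w \<in> ?V. c w = i}" using True v(1) by auto
      moreover have "finite {w \<in> ?V. c w = i}" using finV by simp
      ultimately have "card {w \<in> V. ?c w = k} = q + 1" using i(1) by (simp add: Sm_def)
      then show ?thesis by blast
    next
      case False
      have "{w \<in> V. ?c w = k} = {w \<in> ?V. c w = k}" using False by auto
      then show ?thesis using q(1) that by simp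
    qed
    ultimately show ?thesis by (intro exI[of _ ?c] exI[of _ q]) blast
  next
    case False
    \<comment> \<open>Each small class lacks one vertex, and \<open>v\<close> itself makes up for
      one of them.\<close>
    define k where "k = card Sm - 1"
    have Sm1: "1 \<le> card Sm" using q(2) finSm by (auto simp: Sm_def Suc_le_eq card_gt_0_iff)
    have k6: "k \<le> 6" using False by (simp add: k_def)
    have "card ?V = (\<Sum>i<r. card {w \<in> ?V. c w = i})"
    proof -
      have "?V = (\<Union>i<r. {w \<in> ?V. c w = i})" using c(2) by auto
      then have "card ?V = card (\<Union>i<r. {w \<in> ?V. c w = i})" by (rule arg_cong)
      also have "\<dots> = (\<Sum>i<r. card {w \<in> ?V. c w = i})"
        using finV by (intro card_UN_disjoint) auto
      finally show ?thesis .
    qed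
    then have "card ?V + card Sm = (\<Sum>i<r. card {w \<in> ?V. c w = i}) + (\<Sum>i<r. if i \<in> Sm then 1 else 0)"
      by (simp add: sum.If_cases Sm_def Int_def)
    also have "\<dots> = (\<Sum>i<r. card {w \<in> ?V. c w = i} + (if i \<in> Sm then 1 else 0))"
      by (simp only: sum.distrib)
    also have "\<dots> = (\<Sum>i<r. q + 1)"
      using q(1) by (intro sum.cong refl) (auto simp: Sm_def)
    finally have sz: "card V + k = r * (q + 1)"
      using Sm1 card_Suc_Diff1[OF finV v(1)] by (simp add: k_def)
    let ?V2 = "Inl ` V \<union> Inr ` {..<k} :: ('a + nat) set"
    interpret G: sparse ?V2 "adj_clique adj k" r by (rule sparse_clique[OF k6])
    have "card ?V2 = card V + k" using finV by (subst card_Un_disjoint) (auto simp: card_image)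
    then obtain d where d: "G.proper ?V2 d" "\<forall>w\<in>?V2. d w < r" "\<forall>i<r. card (G.cls ?V2 d i) = q + 1"
      using G.divisible[of "q + 1"] sz by auto
    let ?c = "\<lambda>w. d (Inl w)"
    have "?c u \<noteq> ?c w" if "u \<in> V" "w \<in> V" "adj u w" for u w
      using d(1) that unfolding G.proper_def by auto
    moreover have "?c w < r" if "w \<in> V" for w using that d(2) by auto
    moreover have "card {w \<in> V. ?c w = i} = q \<or> card {w \<in> V. ?c w = i} = q + 1" if "i < r" for i
    proof -
      let ?B = "{b \<in> {..<k}. d (Inr b) = i}"
      have "G.cls ?V2 d i = Inl ` {w \<in> V. ?c w = i} \<union> Inr ` ?B" by (auto simp: G.cls_def)
      moreover have "card (Inl ` {w \<in> V. ?c w = i} \<union> Inr ` ?B) = card {w \<in> V. ?c w = i} + card ?B"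
        using finV by (subst card_Un_disjoint) (auto simp: card_image)
      moreover have "card ?B \<le> 1"
      proof (rule ccontr)
        assume "\<not> card ?B \<le> 1"
        then obtain a b where "a \<in> ?B" "b \<in> ?B" "a \<noteq> b"
          using card_le_Suc0_iff_eq[of ?B] by auto
        then show False using d(1) unfolding G.proper_def by auto
      qed
      ultimately show ?thesis using d(3) that by auto
    qed
    ultimately show ?thesis by (intro exI[of _ ?c] exI[of _ q]) blast
  qed
qed

section \<open>Translation between edge sets and adjacency\<close>

theorem theorem2:
  fixes V :: "'a set" and E :: "'a set set" and r :: nat
  assumes "finite_simple_graph V E"
    and "\<And>W F. subgraph W F V E \<Longrightarrow> real (card F) \<le> 7 / 2 * real (card W)"
    and "\<And>W F. subgraph W F V E \<Longrightarrow> bipartite W F \<Longrightarrow> real (card F) \<le> 9 / 4 * real (card W)"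
    and "max_degree V E \<ge> 10"
    and "r \<ge> max_degree V E"
  shows "\<exists>C. equitable_coloring V E r C"
proof -
  have finV: "finite V" and Esub: "\<And>e. e \<in> E \<Longrightarrow> e \<subseteq> V \<and> card e = 2"
    using assms(1) by (auto simp: finite_simple_graph_def)
  have finE: "finite E" using finV Esub by (intro finite_subset[of E "Pow V"]) auto
  define adj where "adj u v \<longleftrightarrow> {u, v} \<in> E" for u v
  have ne: "u \<noteq> v" if "adj u v" for u v using that Esub[of "{u, v}"] by (auto simp: adj_def)
  interpret G: fgraph V adj
  proof
    show "finite V" by (rule finV)
    show "adj v u" if "adj u v" for u v using that by (simp add: adj_def insert_commute)
    show "\<not> adj u u" for u using ne by blast
    show "v \<in> V" if "adj u v" for u v using that Esub[of "{u, v}"] by (auto simp: adj_def)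
  qed
  have ecard: "G.ecount X Y = card {(a, b) \<in> X \<times> Y. adj a b}" if "X \<subseteq> V" "Y \<subseteq> V" for X Y
  proof -
    have "{(a, b) \<in> X \<times> Y. adj a b} = Sigma X (G.nb Y)" by (auto simp: G.nb_def)
    moreover have "finite X" using that finV finite_subset by blast
    ultimately show ?thesis by (simp add: G.ecount_def)
  qed
  have deg: "card (G.nb V v) \<le> r" for v
  proof (cases "v \<in> V")
    case True
    have "{e \<in> E. v \<in> e} = (\<lambda>u. {v, u}) ` G.nb V v"
    proof (intro set_eqI iffI)
      fix e assume e: "e \<in> {e \<in> E. v \<in> e}"
      then obtain a b where ab: "e = {a, b}" "a \<noteq> b" using Esub[of e] by (auto simp: card_2_iff)
      then have "e = {v, if a = v then b else a}" using e by auto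
      moreover have "(if a = v then b else a) \<in> V" using e Esub[of e] ab by auto
      ultimately show "e \<in> (\<lambda>u. {v, u}) ` G.nb V v" using e by (auto simp: G.nb_def adj_def)
    qed (auto simp: G.nb_def adj_def)
    moreover have "inj_on (\<lambda>u. {v, u}) (G.nb V v)" by (auto simp: inj_on_def doubleton_eq_iff)
    ultimately have "card (G.nb V v) = degree E v" by (simp add: degree_def card_image)
    also have "\<dots> \<le> max_degree V E" unfolding max_degree_def using True finV by (intro Max_ge) auto
    finally show ?thesis using assms(5) by simp
  next
    case False
    have "\<not> adj v u" for u using False Esub[of "{v, u}"] by (auto simp: adj_def)
    then show ?thesis by (simp add: G.nb_def)
  qed
  have dens: "G.ecount H H \<le> 7 * card H" if H: "H \<subseteq> V" for H
  proof -
    let ?F = "{e \<in> E. e \<subseteq> H}"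
    have "subgraph H ?F V E"
      using H Esub finV finite_subset by (auto simp: subgraph_def finite_simple_graph_def)
    then have "real (card ?F) \<le> 7 / 2 * real (card H)" by (rule assms(2))
    moreover have "G.ecount H H \<le> 2 * card ?F"
    proof -
      have fH: "finite H" using H finV finite_subset by blast
      have "{(a, b) \<in> H \<times> H. adj a b} \<subseteq> (\<Union>e\<in>?F. {(a, b) \<in> H \<times> H. {a, b} = e})"
        by (auto simp: adj_def)
      then have "G.ecount H H \<le> card (\<Union>e\<in>?F. {(a, b) \<in> H \<times> H. {a, b} = e})"
        unfolding ecard[OF H H] using fH finE
        by (intro card_mono finite_subset[of "\<Union>e\<in>?F. {(a, b) \<in> H \<times> H. {a, b} = e}" "H \<times> H"]) auto
      also have "\<dots> \<le> (\<Sum>e\<in>?F. card {(a, b) \<in> H \<times> H. {a, b} = e})"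
        using finE by (intro card_UN_le) auto
      also have "\<dots> \<le> (\<Sum>e\<in>?F. 2)"
      proof (rule sum_mono)
        fix e assume "e \<in> ?F"
        then obtain a b where "e = {a, b}" using Esub[of e] by (auto simp: card_2_iff)
        then have "{(a, b) \<in> H \<times> H. {a, b} = e} \<subseteq> {(a, b), (b, a)}" by (auto simp: doubleton_eq_iff)
        then have "card {(a, b) \<in> H \<times> H. {a, b} = e} \<le> card {(a, b), (b, a)}"
          by (rule card_mono[rotated]) simp
        moreover have "card {(a, b), (b, a)} \<le> 2" by (cases "a = b") auto
        ultimately show "card {(a, b) \<in> H \<times> H. {a, b} = e} \<le> 2" by (rule le_trans)
      qed
      finally show ?thesis by simp
    qed
    ultimately show ?thesis by linarith
  qed
  have bip: "4 * G.ecount X Y \<le> 9 * (card X + card Y)" if XY: "X \<subseteq> V" "Y \<subseteq> V" "X \<inter> Y = {}" for X Y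
  proof -
    let ?P = "{(a, b) \<in> X \<times> Y. adj a b}"
    let ?F = "(\<lambda>(a, b). {a, b}) ` ?P"
    have f: "finite X" "finite Y"
      using finite_subset[OF XY(1) finV] finite_subset[OF XY(2) finV] by auto
    have "inj_on (\<lambda>(a, b). {a, b}) ?P" using XY(3) by (auto simp: inj_on_def doubleton_eq_iff)
    then have "card ?F = G.ecount X Y" using ecard[OF XY(1,2)] by (simp add: card_image)
    moreover have "subgraph (X \<union> Y) ?F V E"
      unfolding subgraph_def finite_simple_graph_def
    proof (intro conjI ballI)
      show "?F \<subseteq> E" by (auto simp: adj_def)
      fix e assume "e \<in> ?F"
      then obtain a b where "e = {a, b}" "a \<in> X" "b \<in> Y" by auto
      moreover have "a \<noteq> b" using calculation XY(3) by auto
      ultimately show "e \<subseteq> X \<union> Y" "card e = 2" by auto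
    qed (use XY f in auto)
    moreover have "bipartite (X \<union> Y) ?F" unfolding bipartite_def
      using XY(3) by (intro exI[of _ X] exI[of _ Y]) fastforce
    ultimately have "real (G.ecount X Y) \<le> 9 / 4 * real (card (X \<union> Y))" using assms(3)[of "X \<union> Y" ?F] by simp
    then show ?thesis using card_Un_disjoint[OF f XY(3)] by simp
  qed
  have "sparse V adj r"
    by unfold_locales (use assms(4,5) deg dens bip in auto)
  from equitable_exists[OF this] obtain c q where c: "\<forall>u\<in>V. \<forall>v\<in>V. adj u v \<longrightarrow> c u \<noteq> c v" "\<forall>v\<in>V. c v < r"
    "\<forall>i<r. card {v \<in> V. c v = i} = q \<or> card {v \<in> V. c v = i} = q + 1" by blast
  \<comment> \<open>Colours start at 0, but the classes are indexed from 1.\<close>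
  define C where "C i = {v \<in> V. Suc (c v) = i}" for i
  have cC: "card (C i) = q \<or> card (C i) = q + 1" if i: "i \<in> {1..r}" for i
  proof -
    have "C i = {v \<in> V. c v = i - 1}" using i by (auto simp: C_def)
    moreover have "i - 1 < r" using i by auto
    ultimately show ?thesis using c(3) by simp
  qed
  have "(\<Union>i\<in>{1..r}. C i) = V"
  proof (intro set_eqI iffI)
    fix v assume "v \<in> V"
    moreover have "Suc (c v) \<in> {1..r}" using c(2) \<open>v \<in> V\<close> by auto
    ultimately show "v \<in> (\<Union>i\<in>{1..r}. C i)" by (auto simp: C_def)
  qed (auto simp: C_def)
  moreover have "disjoint_family_on C {1..r}" by (auto simp: disjoint_family_on_def C_def)
  moreover have "independent_set V E (C i)" for i
    using c(1) by (fastforce simp: independent_set_def C_def adj_def)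
  moreover have "\<bar>int (card (C i)) - int (card (C j))\<bar> \<le> 1" if "i \<in> {1..r}" "j \<in> {1..r}" for i j
    using cC[OF that(1)] cC[OF that(2)] by auto
  ultimately have "equitable_coloring V E r C" unfolding equitable_coloring_def by blast
  then show ?thesis by blast
qed

end
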